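(* Let $\mathbb K\in\{\mathbb R,\mathbb C\}$ and let $X$ be a $\mathbb K$-Banach space with $\dim_{\mathbb K}X>1$. Let $$\mathscr G(X)\times_{\mathcal C}\mathscr G(X):=\{(E,F)\in\mathscr G(X)\times\mathscr G(X):F\text{ is a complement of }E\},$$ and let $\mathcal T$ be the topology on it induced from the product topology on $\mathscr G(X)\times\mathscr G(X)$. There is a $\mathbb K$-analytic Banach manifold structure on $\mathscr G(X)\times_{\mathcal C}\mathscr G(X)$ compatible with $\mathcal T$ such that, under the projection $\kappa_1:\mathscr G(X)\times_{\mathcal C}\mathscr G(X)\to\mathscr G(X)$ onto the first coordinate, one obtains a locally trivial $\mathbb K$-analytic affine-Banach bundle structure on $\mathscr G(X)\times_{\mathcal C}\mathscr G(X)$.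
   Context: **Grassmann manifold.** $\mathcal L(X,Y)$ is the Banach space of bounded $\mathbb K$-linear operators. $\mathscr G(X)$ is the set of all non-zero proper closed complemented subspaces of $X$. For $F\in\mathscr G(X)$, $\mathcal C_F$ is the set of closed complements of $F$ in $X$. For $E\in\mathcal C_F$ the map $q_{E,F}:\mathcal L(E,F)\to\mathcal C_F$, $q_{E,F}(T)=(I+T)(E)$, is a bijection with inverse $p_{E,F}$. $\mathscr G(X)$ carries a Hausdorff metrizable topology in which each $\mathcal C_F$ is open and each $p_{E,F}$ is a homeomorphism, and the charts $(\mathcal C_F,p_{E,F},\mathcal L(E,F))$ form a $\mathbb K$-analytic atlas for $\mathscr G(X)$. **Affine notions.** A subset $A$ of a $\mathbb K$-Banach space is a $\mathbb K$-affine-Banach subspace if $A-a_0$ is a closed linear subspace for one (equivalently every) $a_0\in A$. A map $S$ from $A$ to a Banach space $Y$ is $\mathbb K$-affine if $S^{a_0}:a-a_0\mapsto S(a)-S(a_0)$ is $\mathbb K$-linear on $A-a_0$. For an affine-Banach subspace $B\subseteq Y$, $\mathcal A(A,B)$ is the set of continuous $\mathbb K$-affine maps $A\to B$, regarded as an affine-Banach subspace of the Banach space of continuous affine maps $A\to Y$ with norm $\|T\|_{a_0}=\|T^{a_0}\|+\|T(a_0)\|$ (different $a_0$ give equivalent norms). **Bundles.** Let $\Omega,\Upsilon$ be $\mathbb K$-analytic Banach manifolds and $\kappa:\Upsilon\to\Omega$ a $\mathbb K$-analytic surjection. $(\Upsilon,\Omega,\kappa)$ is a locally trivial $\mathbb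 K$-analytic affine-Banach bundle if: (B1) each fiber $\Upsilon_\omega=\kappa^{-1}(\omega)$ is homeomorphic to (and carries the structure of) a $\mathbb K$-affine-Banach subspace of a $\mathbb K$-Banach space; (B2) for each $\omega_0\in\Omega$ there are an open neighborhood $V_{\omega_0}$ of $\omega_0$ and a $\mathbb K$-bi-analytic bijection $\Theta_{\omega_0}:V_{\omega_0}\times\Upsilon_{\omega_0}\to\kappa^{-1}(V_{\omega_0})$ such that for every $\omega\in V_{\omega_0}$, $\Theta_{\omega_0}|_{\{\omega\}\times\Upsilon_{\omega_0}}$ is a $\mathbb K$-affine map onto $\Upsilon_\omega$; (B3) whenever $V_{\omega_1}\cap V_{\omega_2}\neq\emptyset$, the map $\varphi:V_{\omega_1}\cap V_{\omega_2}\to\mathcal A(\Upsilon_{\omega_1},\Upsilon_{\omega_2})$, $\varphi(\omega)(x)=\Pi_2(\Theta_{\omega_2}^{-1}\circ\Theta_{\omega_1}(\omega,x))$, is $\mathbb K$-analytic, where $\Pi_2$ is the projection onto the second coordinate. *)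

theory Defs
  imports "HOL-Analysis.Analysis" "HOL-Library.Function_Algebras"
begin

text \<open>
  The scalar field \<open>\<K>\<close> is a type \<open>'k\<close> of class \<open>real_normed_field\<close>: by Gelfand-Mazur such a field is
  isometrically isomorphic to \<open>real\<close> or to \<open>complex\<close>, and both are instances of the class.
  The library has no class of vector spaces over \<open>'k\<close>, so a \<open>\<K>\<close>-Banach space \<open>X\<close> is a type of class
  \<open>banach\<close> with a scalar multiplication over \<open>'k\<close> extending the real one.
\<close>

locale banach_scaling = vector_space scale
  for scale :: "'k::real_normed_field \<Rightarrow> 'a::banach \<Rightarrow> 'a" +
  assumes scale_of_real: "scale (of_real r) x = r *\<^sub>R x"
    and norm_scale: "norm (scale c x) = norm c * norm x"


section \<open>Normed spaces with an explicit carrier\<close>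

text \<open>
  The spaces \<open>L(E,F)\<close> depend on the subspaces \<open>E\<close>, \<open>F\<close> and thus cannot be types.
  A normed space is a subset of an abelian group with its own scalar multiplication and norm.
\<close>

record ('k, 'v) nspace =
  points :: "'v set"
  nscale :: "'k \<Rightarrow> 'v \<Rightarrow> 'v"
  nrm :: "'v \<Rightarrow> real"

text \<open>The value 0 off the carrier is there because \<open>Metric_space\<close> asks for a globally nonnegative and
  symmetric function.\<close>

definition ndist :: "('k, 'v::ab_group_add) nspace \<Rightarrow> 'v \<Rightarrow> 'v \<Rightarrow> real" where
  "ndist V x y = (if x \<in> points V \<and> y \<in> points V then nrm V (x - y) else 0)"

definition ntop :: "('k, 'v::ab_group_add) nspace \<Rightarrow> 'v topology" where
  "ntop V = Metric_space.mtopology (points V) (ndist V)"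

locale banach_space_on =
  fixes V :: "('k::real_normed_field, 'v::ab_group_add) nspace"
  assumes zero_mem: "0 \<in> points V"
    and add_mem: "\<lbrakk>x \<in> points V; y \<in> points V\<rbrakk> \<Longrightarrow> x + y \<in> points V"
    and smult_mem: "x \<in> points V \<Longrightarrow> nscale V c x \<in> points V"
    and smult_add_right: "\<lbrakk>x \<in> points V; y \<in> points V\<rbrakk> \<Longrightarrow> nscale V c (x + y) = nscale V c x + nscale V c y"
    and smult_add_left: "x \<in> points V \<Longrightarrow> nscale V (c + d) x = nscale V c x + nscale V d x"
    and smult_smult: "x \<in> points V \<Longrightarrow> nscale V c (nscale V d x) = nscale V (c * d) x"
    and smult_one: "x \<in> points V \<Longrightarrow> nscale V 1 x = x"
    and nrm_nonneg: "x \<in> points V \<Longrightarrow> 0 \<le> nrm V x"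
    and nrm_eq_0: "x \<in> points V \<Longrightarrow> nrm V x = 0 \<longleftrightarrow> x = 0"
    and nrm_triangle: "\<lbrakk>x \<in> points V; y \<in> points V\<rbrakk> \<Longrightarrow> nrm V (x + y) \<le> nrm V x + nrm V y"
    and nrm_smult: "x \<in> points V \<Longrightarrow> nrm V (nscale V c x) = norm c * nrm V x"
    and complete: "Metric_space.mcomplete (points V) (ndist V)"

definition prod_nspace :: "('k, 'v) nspace \<Rightarrow> ('k, 'w) nspace \<Rightarrow> ('k, 'v \<times> 'w) nspace" where
  "prod_nspace V W =
     \<lparr>points = points V \<times> points W,
      nscale = (\<lambda>c (x, y). (nscale V c x, nscale W c y)),
      nrm = (\<lambda>(x, y). max (nrm V x) (nrm W y))\<rparr>"

definition linear_map_on ::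
  "('k, 'v::ab_group_add) nspace \<Rightarrow> ('k, 'w::ab_group_add) nspace \<Rightarrow> ('v \<Rightarrow> 'w) \<Rightarrow> bool" where
  "linear_map_on V W T \<longleftrightarrow>
     T ` points V \<subseteq> points W \<and>
     (\<forall>x\<in>points V. \<forall>y\<in>points V. T (x + y) = T x + T y) \<and>
     (\<forall>c. \<forall>x\<in>points V. T (nscale V c x) = nscale W c (T x))"

definition opnorm :: "('k, 'v) nspace \<Rightarrow> ('k, 'w) nspace \<Rightarrow> ('v \<Rightarrow> 'w) \<Rightarrow> real" where
  "opnorm V W T = (SUP x\<in>{x \<in> points V. nrm V x \<le> 1}. nrm W (T x))"

text \<open>
  A map defined on a subset of a type is represented by its extension by 0; this makes the
  representation unique and compatible with the pointwise vector space operations.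
\<close>

definition bounded_ops ::
  "('k, 'v::ab_group_add) nspace \<Rightarrow> ('k, 'w::ab_group_add) nspace \<Rightarrow> ('k, 'v \<Rightarrow> 'w) nspace" where
  "bounded_ops V W =
     \<lparr>points = {T. (\<forall>x. x \<notin> points V \<longrightarrow> T x = 0) \<and> linear_map_on V W T \<and>
                   (\<exists>C. \<forall>x\<in>points V. nrm W (T x) \<le> C * nrm V x)},
      nscale = (\<lambda>c T x. nscale W c (T x)),
      nrm = opnorm V W\<rparr>"


section \<open>Analytic maps between Banach spaces\<close>

text \<open>\<open>n\<close>-linear maps act on lists of length \<open>n\<close>; \<open>C\<close> is a bound for the norm.\<close>

definition bounded_multilinear ::
  "('k, 'v::ab_group_add) nspace \<Rightarrow> ('k, 'w::ab_group_add) nspace \<Rightarrow> nat \<Rightarrow> real \<Rightarrow> ('v list \<Rightarrow> 'w) \<Rightarrow> bool" where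
  "bounded_multilinear V W n C A \<longleftrightarrow>
     0 \<le> C \<and>
     (\<forall>xs. set xs \<subseteq> points V \<and> length xs = n \<longrightarrow>
        A xs \<in> points W \<and>
        nrm W (A xs) \<le> C * prod_list (map (nrm V) xs) \<and>
        (\<forall>i<n. \<forall>x\<in>points V. \<forall>y\<in>points V. A (xs[i := x + y]) = A (xs[i := x]) + A (xs[i := y])) \<and>
        (\<forall>i<n. \<forall>c. \<forall>x\<in>points V. A (xs[i := nscale V c x]) = nscale W c (A (xs[i := x]))))"

text \<open>
  \<open>f\<close> is analytic on the open set \<open>U\<close> if near every \<open>a \<in> U\<close> it is the sum of a power series
  \<open>f (a + h) = (\<Sum>n. A n (h, \<dots>, h))\<close> of continuous homogeneous polynomials with positive
  radius of (normal) convergence.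
\<close>

definition nspace_analytic ::
  "('k, 'v::ab_group_add) nspace \<Rightarrow> ('k, 'w::ab_group_add) nspace \<Rightarrow> 'v set \<Rightarrow> ('v \<Rightarrow> 'w) \<Rightarrow> bool" where
  "nspace_analytic V W U f \<longleftrightarrow>
     openin (ntop V) U \<and> f ` U \<subseteq> points W \<and>
     (\<forall>a\<in>U. \<exists>r>0. \<exists>A C.
        (\<forall>n. bounded_multilinear V W n (C n) (A n)) \<and>
        summable (\<lambda>n. C n * r ^ n) \<and>
        (\<forall>h\<in>points V. nrm V h < r \<longrightarrow>
           a + h \<in> U \<and>
           (\<lambda>N. nrm W (f (a + h) - (\<Sum>n<N. A n (replicate n h)))) \<longlonglongrightarrow> 0))"


section \<open>Analytic Banach manifolds\<close>

record ('k, 'p, 'v) chart =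
  chart_dom :: "'p set"
  chart_map :: "'p \<Rightarrow> 'v"
  chart_model :: "('k, 'v) nspace"

definition chart_inv :: "('k, 'p, 'v) chart \<Rightarrow> 'v \<Rightarrow> 'p" where
  "chart_inv c = the_inv_into (chart_dom c) (chart_map c)"

text \<open>The atlas need not be maximal. The model space may vary from chart to chart.\<close>

record ('k, 'p, 'v) manifold =
  mantop :: "'p topology"
  atlas :: "('k, 'p, 'v) chart set"

definition banach_manifold :: "('k::real_normed_field, 'p, 'v::ab_group_add) manifold \<Rightarrow> bool" where
  "banach_manifold M \<longleftrightarrow>
     Hausdorff_space (mantop M) \<and>
     (\<Union>c\<in>atlas M. chart_dom c) = topspace (mantop M) \<and>
     (\<forall>c\<in>atlas M.
        openin (mantop M) (chart_dom c) \<and>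
        banach_space_on (chart_model c) \<and>
        openin (ntop (chart_model c)) (chart_map c ` chart_dom c) \<and>
        homeomorphic_map (subtopology (mantop M) (chart_dom c))
          (subtopology (ntop (chart_model c)) (chart_map c ` chart_dom c)) (chart_map c)) \<and>
     (\<forall>c\<in>atlas M. \<forall>d\<in>atlas M.
        nspace_analytic (chart_model c) (chart_model d)
          (chart_map c ` (chart_dom c \<inter> chart_dom d)) (chart_map d \<circ> chart_inv c))"

text \<open>Analyticity of \<open>f\<close> on the open subset \<open>S\<close> of \<open>M\<close>, regarded as an open submanifold.\<close>

definition manifold_analytic ::
  "('k, 'p, 'v::ab_group_add) manifold \<Rightarrow> ('k, 'q, 'w::ab_group_add) manifold \<Rightarrow> 'p set \<Rightarrow> ('p \<Rightarrow> 'q) \<Rightarrow> bool" where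
  "manifold_analytic M N S f \<longleftrightarrow>
     openin (mantop M) S \<and>
     continuous_map (subtopology (mantop M) S) (mantop N) f \<and>
     (\<forall>c\<in>atlas M. \<forall>d\<in>atlas N.
        nspace_analytic (chart_model c) (chart_model d)
          (chart_map c ` {p \<in> chart_dom c \<inter> S. f p \<in> chart_dom d})
          (chart_map d \<circ> f \<circ> chart_inv c))"

definition bianalytic ::
  "('k, 'p, 'v::ab_group_add) manifold \<Rightarrow> ('k, 'q, 'w::ab_group_add) manifold \<Rightarrow>
   'p set \<Rightarrow> 'q set \<Rightarrow> ('p \<Rightarrow> 'q) \<Rightarrow> bool" where
  "bianalytic M N S R f \<longleftrightarrow>
     bij_betw f S R \<and> manifold_analytic M N S f \<and> manifold_analytic N M R (the_inv_into S f)"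

definition prod_manifold ::
  "('k, 'p, 'v) manifold \<Rightarrow> ('k, 'q, 'w) manifold \<Rightarrow> ('k, 'p \<times> 'q, 'v \<times> 'w) manifold" where
  "prod_manifold M N =
     \<lparr>mantop = prod_topology (mantop M) (mantop N),
      atlas = {\<lparr>chart_dom = chart_dom c \<times> chart_dom d,
                chart_map = map_prod (chart_map c) (chart_map d),
                chart_model = prod_nspace (chart_model c) (chart_model d)\<rparr>
               | c d. c \<in> atlas M \<and> d \<in> atlas N}\<rparr>"


section \<open>Affine-Banach subspaces and affine maps\<close>

definition direction :: "('k, 'v::ab_group_add) nspace \<Rightarrow> 'v set \<Rightarrow> 'v \<Rightarrow> ('k, 'v) nspace" where
  "direction Y A a = Y\<lparr>points := (\<lambda>x. x - a) ` A\<rparr>"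

definition affine_banach_subspace :: "('k, 'v::ab_group_add) nspace \<Rightarrow> 'v set \<Rightarrow> bool" where
  "affine_banach_subspace Y A \<longleftrightarrow>
     A \<subseteq> points Y \<and>
     (\<exists>a\<in>A. closedin (ntop Y) (points (direction Y A a)) \<and>
        0 \<in> points (direction Y A a) \<and>
        (\<forall>x\<in>points (direction Y A a). \<forall>y\<in>points (direction Y A a). x + y \<in> points (direction Y A a)) \<and>
        (\<forall>c. \<forall>x\<in>points (direction Y A a). nscale Y c x \<in> points (direction Y A a)))"

definition affine_map_on ::
  "('k, 'v::ab_group_add) nspace \<Rightarrow> 'v set \<Rightarrow> ('k, 'w::ab_group_add) nspace \<Rightarrow> ('v \<Rightarrow> 'w) \<Rightarrow> bool" where
  "affine_map_on Y A Z S \<longleftrightarrow>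
     S ` A \<subseteq> points Z \<and>
     (\<forall>a\<in>A. linear_map_on (direction Y A a) Z (\<lambda>v. S (a + v) - S a))"

text \<open>The space of continuous affine maps from \<open>A\<close> to \<open>Z\<close> with the norm based at \<open>a \<in> A\<close>.\<close>

definition affine_maps ::
  "('k, 'v::ab_group_add) nspace \<Rightarrow> 'v set \<Rightarrow> ('k, 'w::ab_group_add) nspace \<Rightarrow> 'v \<Rightarrow> ('k, 'v \<Rightarrow> 'w) nspace" where
  "affine_maps Y A Z a =
     \<lparr>points = {S. (\<forall>x. x \<notin> A \<longrightarrow> S x = 0) \<and> affine_map_on Y A Z S \<and>
                   continuous_map (subtopology (ntop Y) A) (ntop Z) S},
      nscale = (\<lambda>c S x. nscale Z c (S x)),
      nrm = (\<lambda>S. opnorm (direction Y A a) Z (\<lambda>v. S (a + v) - S a) + nrm Z (S a))\<rparr>"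

text \<open>
  A topological space identified by a homeomorphism \<open>h\<close> with the affine-Banach subspace \<open>A\<close> of
  \<open>Y\<close> is a manifold, with a global chart \<open>p \<mapsto> h p - a\<close> for each base point \<open>a \<in> A\<close>.
\<close>

definition affine_manifold ::
  "'p topology \<Rightarrow> ('p \<Rightarrow> 'v) \<Rightarrow> ('k, 'v::ab_group_add) nspace \<Rightarrow> 'v set \<Rightarrow> ('k, 'p, 'v) manifold" where
  "affine_manifold \<tau> h Y A =
     \<lparr>mantop = \<tau>,
      atlas = {\<lparr>chart_dom = topspace \<tau>, chart_map = (\<lambda>p. h p - a), chart_model = direction Y A a\<rparr>
               | a. a \<in> A}\<rparr>"


section \<open>Affine-Banach bundles\<close>

definition fiber :: "('k, 'p, 'v) manifold \<Rightarrow> ('p \<Rightarrow> 'o) \<Rightarrow> 'o set \<Rightarrow> 'p set" where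
  "fiber Up \<kappa> V = {p \<in> topspace (mantop Up). \<kappa> p \<in> V}"

text \<open>
  The affine structure of the fibers is part of the bundle structure: \<open>h \<omega>\<close> identifies the fiber over
  \<open>\<omega>\<close> with the affine-Banach subspace \<open>A \<omega>\<close> of the Banach space \<open>Y \<omega>\<close>. Affine maps between
  fibers, and the spaces of such maps, are meant with respect to this identification.
\<close>

definition affine_banach_bundle ::
  "('k::real_normed_field, 'p, 'v::ab_group_add) manifold \<Rightarrow> ('k, 'o, 'w::ab_group_add) manifold \<Rightarrow>
   ('p \<Rightarrow> 'o) \<Rightarrow> ('o \<Rightarrow> ('k, 'y::ab_group_add) nspace) \<Rightarrow> ('o \<Rightarrow> 'y set) \<Rightarrow> ('o \<Rightarrow> 'p \<Rightarrow> 'y) \<Rightarrow> bool" where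
  "affine_banach_bundle Up Om \<kappa> Y A h \<longleftrightarrow>
     (let fib = (\<lambda>\<omega>. fiber Up \<kappa> {\<omega>});
          fibtop = (\<lambda>\<omega>. subtopology (mantop Up) (fib \<omega>));
          fibman = (\<lambda>\<omega>. affine_manifold (fibtop \<omega>) (h \<omega>) (Y \<omega>) (A \<omega>));
          hinv = (\<lambda>\<omega>. the_inv_into (fib \<omega>) (h \<omega>))
      in
      banach_manifold Up \<and> banach_manifold Om \<and>
      manifold_analytic Up Om (topspace (mantop Up)) \<kappa> \<and>
      \<kappa> ` topspace (mantop Up) = topspace (mantop Om) \<and>
      (\<forall>\<omega>\<in>topspace (mantop Om).
         banach_space_on (Y \<omega>) \<and> affine_banach_subspace (Y \<omega>) (A \<omega>) \<and>
         homeomorphic_map (fibtop \<omega>) (subtopology (ntop (Y \<omega>)) (A \<omega>)) (h \<omega>)) \<and>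
      (\<exists>V \<Theta>.
         (\<forall>\<omega>0\<in>topspace (mantop Om).
            openin (mantop Om) (V \<omega>0) \<and> \<omega>0 \<in> V \<omega>0 \<and>
            bianalytic (prod_manifold Om (fibman \<omega>0)) Up
              (V \<omega>0 \<times> fib \<omega>0) (fiber Up \<kappa> (V \<omega>0)) (\<Theta> \<omega>0) \<and>
            (\<forall>\<omega>\<in>V \<omega>0.
               \<Theta> \<omega>0 ` ({\<omega>} \<times> fib \<omega>0) = fib \<omega> \<and>
               affine_map_on (Y \<omega>0) (A \<omega>0) (Y \<omega>) (\<lambda>x. h \<omega> (\<Theta> \<omega>0 (\<omega>, hinv \<omega>0 x))))) \<and>
         \<comment> \<open>the norms of \<open>Z\<close> for different base points \<open>a\<close> are equivalent\<close>
         (\<forall>\<omega>1\<in>topspace (mantop Om). \<forall>\<omega>2\<in>topspace (mantop Om). V \<omega>1 \<inter> V \<omega>2 \<noteq> {} \<longrightarrow>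
            (\<forall>a\<in>A \<omega>1.
               let Z = affine_maps (Y \<omega>1) (A \<omega>1) (Y \<omega>2) a;
                   B = {S \<in> points Z. S ` A \<omega>1 \<subseteq> A \<omega>2}
               in manifold_analytic Om (affine_manifold (subtopology (ntop Z) B) id Z B) (V \<omega>1 \<inter> V \<omega>2)
                    (\<lambda>\<omega> x. if x \<in> A \<omega>1
                            then h \<omega>2 (snd (the_inv_into (V \<omega>2 \<times> fib \<omega>2) (\<Theta> \<omega>2)
                                              (\<Theta> \<omega>1 (\<omega>, hinv \<omega>1 x))))
                            else 0)))))"


section \<open>The Grassmann manifold\<close>

definition closed_subspace :: "('k::field \<Rightarrow> 'a::banach \<Rightarrow> 'a) \<Rightarrow> 'a set \<Rightarrow> bool" where
  "closed_subspace smul E \<longleftrightarrow> module.subspace smul E \<and> closed E"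

definition complements :: "('k::field \<Rightarrow> 'a::banach \<Rightarrow> 'a) \<Rightarrow> 'a set \<Rightarrow> 'a set set" where
  "complements smul F =
     {E. closed_subspace smul E \<and> E \<inter> F = {0} \<and> {e + f | e f. e \<in> E \<and> f \<in> F} = UNIV}"

definition Grassmannian :: "('k::field \<Rightarrow> 'a::banach \<Rightarrow> 'a) \<Rightarrow> 'a set set" where
  "Grassmannian smul =
     {F. closed_subspace smul F \<and> F \<noteq> {0} \<and> F \<noteq> UNIV \<and> complements smul F \<noteq> {}}"

definition subspace_nspace :: "('k \<Rightarrow> 'a::banach \<Rightarrow> 'a) \<Rightarrow> 'a set \<Rightarrow> ('k, 'a) nspace" where
  "subspace_nspace smul E = \<lparr>points = E, nscale = smul, nrm = norm\<rparr>"

definition op_space :: "('k \<Rightarrow> 'a::banach \<Rightarrow> 'a) \<Rightarrow> 'a set \<Rightarrow> 'a set \<Rightarrow> ('k, 'a \<Rightarrow> 'a) nspace" where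
  "op_space smul E F = bounded_ops (subspace_nspace smul E) (subspace_nspace smul F)"

definition graph_map :: "'a::banach set \<Rightarrow> ('a \<Rightarrow> 'a) \<Rightarrow> 'a set" where
  "graph_map E T = (\<lambda>x. x + T x) ` E"

definition grassmann_chart ::
  "('k::field \<Rightarrow> 'a::banach \<Rightarrow> 'a) \<Rightarrow> 'a set \<Rightarrow> 'a set \<Rightarrow> ('k, 'a set, 'a \<Rightarrow> 'a) chart" where
  "grassmann_chart smul E F =
     \<lparr>chart_dom = complements smul F,
      chart_map = the_inv_into (points (op_space smul E F)) (graph_map E),
      chart_model = op_space smul E F\<rparr>"

text \<open>
  The topology for which the charts are homeomorphisms on open domains: it is generated by
  the images of open sets under the inverse charts.
\<close>

definition grassmann_topology :: "('k::field \<Rightarrow> 'a::banach \<Rightarrow> 'a) \<Rightarrow> 'a set topology" where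
  "grassmann_topology smul =
     topology_generated_by
       {graph_map E ` W | E F W. F \<in> Grassmannian smul \<and> E \<in> complements smul F \<and>
                                 openin (ntop (op_space smul E F)) W}"

definition grassmann_manifold ::
  "('k::field \<Rightarrow> 'a::banach \<Rightarrow> 'a) \<Rightarrow> ('k, 'a set, 'a \<Rightarrow> 'a) manifold" where
  "grassmann_manifold smul =
     \<lparr>mantop = grassmann_topology smul,
      atlas = {grassmann_chart smul E F | E F. F \<in> Grassmannian smul \<and> E \<in> complements smul F}\<rparr>"

definition complementary_pairs :: "('k::field \<Rightarrow> 'a::banach \<Rightarrow> 'a) \<Rightarrow> ('a set \<times> 'a set) set" where
  "complementary_pairs smul =
     {(E, F). E \<in> Grassmannian smul \<and> F \<in> Grassmannian smul \<and> F \<in> complements smul E}"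

end

theory Submission
  imports Defs
begin

text \<open>
  A pair \<open>(E, F)\<close> of complementary subspaces gives the projection onto \<open>E\<close> along \<open>F\<close>, which is bounded, and
  \<open>T \<in> L(E,F)\<close> gives the automorphism \<open>u\<^sub>T = I + T \<circ> proj E F\<close> of \<open>X\<close>, which carries \<open>E\<close> to the graph of \<open>T\<close> and
  fixes \<open>F\<close>. If \<open>g(x)\<close> is an automorphism depending analytically on \<open>x\<close>, then the chart coordinate of
  \<open>g(x) E\<close> is a rational expression in \<open>g(x)\<close> and hence analytic where it is defined; the only inverse
  that occurs is the one of an operator between two fixed subspaces, and its power series is given by an
  explicit recursion. The fiber over \<open>E\<close> is the set of complements of \<open>E\<close>, identified with \<open>L(F,E)\<close> for a
  chosen complement \<open>F\<close>, and the trivialization over \<open>{G. G \<oplus> F = X}\<close> sends a complement \<open>H\<close> of \<open>E\<close> to \<open>u\<^sub>T H\<close>,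
  where \<open>T\<close> is the coordinate of \<open>G\<close>. Thus charts, trivializations and their transition maps are all
  of the form \<open>x \<mapsto> g(x) E\<close>. On the fibers they are affine, because conjugation of projections is linear.
\<close>

section \<open>Normed spaces with a carrier\<close>

text \<open>No composition theorem for power series is proved. Analytic maps are closed here under
  sums, bounded linear images, bilinear products and the inversion of
  \<open>analytic_pseudo_inverse\<close>, and every composite is brought into such a form. For this
  the operators are extended by projections to one algebra, the bounded operators on X. An
  isomorphism between two fixed subspaces is no longer invertible after the extension; its inverse
  becomes a generalized inverse, recognized by a resolvent identity. Complementarity is itself an
  invertibility condition (\<open>cpl_iff_bij\<close>), so the domains of charts and transitions are
  open by a perturbation argument. Completeness of X enters through Baire (bounded projections),
  through the contraction principle (perturbation) and through the completeness of the model spaces.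
  The expansions work with the norm axioms alone, collected in \<open>normed_space_on\<close>; so
  the spaces of affine maps, for which just these axioms are established, can serve as
  targets.\<close>

locale normed_space_on =
  fixes V :: "('k::real_normed_field, 'v::ab_group_add) nspace"
  assumes zero_mem: "0 \<in> points V"
    and add_mem: "\<lbrakk>x \<in> points V; y \<in> points V\<rbrakk> \<Longrightarrow> x + y \<in> points V"
    and smult_mem: "x \<in> points V \<Longrightarrow> nscale V c x \<in> points V"
    and smult_add_right: "\<lbrakk>x \<in> points V; y \<in> points V\<rbrakk> \<Longrightarrow> nscale V c (x + y) = nscale V c x + nscale V c y"
    and smult_add_left: "x \<in> points V \<Longrightarrow> nscale V (c + d) x = nscale V c x + nscale V d x"
    and smult_smult: "x \<in> points V \<Longrightarrow> nscale V c (nscale V d x) = nscale V (c * d) x"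
    and smult_one: "x \<in> points V \<Longrightarrow> nscale V 1 x = x"
    and nrm_nonneg: "x \<in> points V \<Longrightarrow> 0 \<le> nrm V x"
    and nrm_eq_0: "x \<in> points V \<Longrightarrow> nrm V x = 0 \<longleftrightarrow> x = 0"
    and nrm_triangle: "\<lbrakk>x \<in> points V; y \<in> points V\<rbrakk> \<Longrightarrow> nrm V (x + y) \<le> nrm V x + nrm V y"
    and nrm_smult: "x \<in> points V \<Longrightarrow> nrm V (nscale V c x) = norm c * nrm V x"

lemma banach_space_on_iff:
  "banach_space_on V \<longleftrightarrow> normed_space_on V \<and> Metric_space.mcomplete (points V) (ndist V)"
  by (simp only: banach_space_on_def normed_space_on_def conj_assoc)

lemma banach_imp_normed: "banach_space_on V \<Longrightarrow> normed_space_on V"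
  by (simp only: banach_space_on_iff)

context normed_space_on begin

lemma smult_zero_left: "x \<in> points V \<Longrightarrow> nscale V 0 x = 0"
  using smult_add_left[of x 0 0] by simp

lemma smult_zero_right [simp]: "nscale V c 0 = 0"
  using smult_add_right[of 0 0 c] zero_mem by simp

lemma smult_minus_one: "x \<in> points V \<Longrightarrow> nscale V (-1) x = - x"
  using smult_add_left[of x 1 "-1"] smult_zero_left[of x] smult_one[of x]
  by (simp add: eq_neg_iff_add_eq_0 add.commute)

lemma uminus_mem: "x \<in> points V \<Longrightarrow> - x \<in> points V"
  using smult_mem[of x "-1"] smult_minus_one by simp

lemma diff_mem: "\<lbrakk>x \<in> points V; y \<in> points V\<rbrakk> \<Longrightarrow> x - y \<in> points V"
  using add_mem[of x "-y"] uminus_mem by simp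

lemma nrm_zero [simp]: "nrm V 0 = 0"
  using nrm_eq_0 zero_mem by simp

lemma nrm_minus: "x \<in> points V \<Longrightarrow> nrm V (- x) = nrm V x"
  using nrm_smult[of x "-1"] smult_minus_one by simp

lemma nrm_diff_commute: "\<lbrakk>x \<in> points V; y \<in> points V\<rbrakk> \<Longrightarrow> nrm V (x - y) = nrm V (y - x)"
  using nrm_minus[of "x - y"] diff_mem by simp

lemma nrm_diff_triangle:
  "\<lbrakk>x \<in> points V; y \<in> points V; z \<in> points V\<rbrakk> \<Longrightarrow> nrm V (x - z) \<le> nrm V (x - y) + nrm V (y - z)"
  using nrm_triangle[of "x - y" "y - z"] diff_mem by simp

lemma sum_mem: "(\<And>i. i \<in> I \<Longrightarrow> f i \<in> points V) \<Longrightarrow> sum f I \<in> points V"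
  by (induction I rule: infinite_finite_induct) (auto intro: zero_mem add_mem)

lemma nrm_sum: "(\<And>i. i \<in> I \<Longrightarrow> f i \<in> points V) \<Longrightarrow> nrm V (sum f I) \<le> (\<Sum>i\<in>I. nrm V (f i))"
proof (induction I rule: infinite_finite_induct)
  case (insert i I)
  then show ?case
    using nrm_triangle[of "f i" "sum f I"] sum_mem[of I f] by fastforce
qed auto

lemma Metric_space: "Metric_space (points V) (ndist V)"
proof
  show "0 \<le> ndist V x y" for x y
    by (simp add: ndist_def nrm_nonneg diff_mem)
  show "ndist V x y = ndist V y x" for x y
    by (simp add: ndist_def nrm_diff_commute)
  show "ndist V x y = 0 \<longleftrightarrow> x = y" if "x \<in> points V" "y \<in> points V" for x y
    using that nrm_eq_0[of "x - y"] diff_mem by (simp add: ndist_def)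
  show "ndist V x z \<le> ndist V x y + ndist V y z"
    if "x \<in> points V" "y \<in> points V" "z \<in> points V" for x y z
    using that by (simp add: ndist_def nrm_diff_triangle)
qed

lemma topspace_ntop [simp]: "topspace (ntop V) = points V"
  unfolding ntop_def by (simp add: Metric_space.topspace_mtopology Metric_space)

lemma openin_ntop:
  "openin (ntop V) U \<longleftrightarrow>
     U \<subseteq> points V \<and> (\<forall>x\<in>U. \<exists>r>0. \<forall>y\<in>points V. nrm V (y - x) < r \<longrightarrow> y \<in> U)"
proof -
  have "Metric_space.mball (points V) (ndist V) x r \<subseteq> U \<longleftrightarrow> (\<forall>y\<in>points V. nrm V (y - x) < r \<longrightarrow> y \<in> U)"
    if "x \<in> points V" for x r
    using that by (auto simp: Metric_space.mball_def[OF Metric_space] ndist_def nrm_diff_commute)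
  then show ?thesis
    unfolding ntop_def Metric_space.openin_mtopology[OF Metric_space] by (meson subsetD)
qed

lemma openin_ball:
  assumes "a \<in> points V" shows "openin (ntop V) {y \<in> points V. nrm V (y - a) < r}"
  unfolding openin_ntop
proof (intro conjI ballI)
  fix x assume x: "x \<in> {y \<in> points V. nrm V (y - a) < r}"
  show "\<exists>s>0. \<forall>y\<in>points V. nrm V (y - x) < s \<longrightarrow> y \<in> {y \<in> points V. nrm V (y - a) < r}"
    using x assms nrm_diff_triangle[of _ x a]
    by (intro exI[of _ "r - nrm V (x - a)"]) force
qed auto

text \<open>Charts of an affine manifold differ by their base points; this makes openness
  independent of the base point. One direction is enough, since the inverse translation has the same
  form.\<close>

lemma openin_translate:
  assumes a: "a \<in> points V" and S: "S \<subseteq> points V"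
  shows "openin (ntop V) ((\<lambda>x. x - a) ` S) \<longleftrightarrow> openin (ntop V) S"
proof -
  have *: "openin (ntop V) ((\<lambda>x. x - b) ` T)" if b: "b \<in> points V" and T: "openin (ntop V) T" for b T
    unfolding openin_ntop
  proof (intro conjI ballI)
    show "(\<lambda>x. x - b) ` T \<subseteq> points V"
      using T b by (auto simp: openin_ntop intro!: diff_mem)
    fix x assume "x \<in> (\<lambda>x. x - b) ` T"
    then obtain t where t: "t \<in> T" "x = t - b" by auto
    then obtain r where r: "r > 0" "\<forall>y\<in>points V. nrm V (y - t) < r \<longrightarrow> y \<in> T"
      using T by (auto simp: openin_ntop)
    have "y \<in> (\<lambda>x. x - b) ` T" if "y \<in> points V" "nrm V (y - x) < r" for y
    proof (rule image_eqI)
      show "y = (y + b) - b" by simp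
      show "y + b \<in> T" using r(2) that t b add_mem[of y b] by (simp add: algebra_simps)
    qed
    then show "\<exists>r>0. \<forall>y\<in>points V. nrm V (y - x) < r \<longrightarrow> y \<in> (\<lambda>x. x - b) ` T"
      using r(1) by blast
  qed
  have "(\<lambda>x. x - (-a)) ` (\<lambda>x. x - a) ` S = S"
    by (simp add: image_image)
  then show ?thesis
    using *[OF a] *[OF uminus_mem[OF a], of "(\<lambda>x. x - a) ` S"] by metis
qed

text \<open>\<open>ndist\<close> is cut off outside the carrier; here completeness is restated with
  the norm alone, so that later completeness proofs work with sequences and differences.\<close>

lemma mcomplete_iff:
  "Metric_space.mcomplete (points V) (ndist V) \<longleftrightarrow>
     (\<forall>\<sigma>. range \<sigma> \<subseteq> points V \<and> (\<forall>e>0. \<exists>N. \<forall>m\<ge>N. \<forall>n\<ge>N. nrm V (\<sigma> m - \<sigma> n) < e) \<longrightarrow>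
       (\<exists>x\<in>points V. (\<lambda>n. nrm V (\<sigma> n - x)) \<longlonglongrightarrow> 0))"
proof -
  interpret M: Metric_space "points V" "ndist V" by (rule Metric_space)
  have 1: "M.MCauchy \<sigma> \<longleftrightarrow>
      range \<sigma> \<subseteq> points V \<and> (\<forall>e>0. \<exists>N. \<forall>m\<ge>N. \<forall>n\<ge>N. nrm V (\<sigma> m - \<sigma> n) < e)" for \<sigma>
    unfolding M.MCauchy_def by (auto simp: ndist_def image_subset_iff) 
  have 2: "limitin M.mtopology \<sigma> x sequentially \<longleftrightarrow>
      x \<in> points V \<and> (\<lambda>n. nrm V (\<sigma> n - x)) \<longlonglongrightarrow> 0" if "range \<sigma> \<subseteq> points V" for \<sigma> x
  proof -
    have "\<sigma> n \<in> points V" for n using that by auto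
    then show ?thesis
      unfolding M.limitin_metric_dist_null by (auto simp: ndist_def)
  qed
  show ?thesis
    unfolding M.mcomplete_def 1
    by (intro all_cong1 imp_cong refl) (simp only: 2 Bex_def)
qed

end

section \<open>Products of normed spaces\<close>

lemma normed_prod_nspace:
  assumes "normed_space_on V" "normed_space_on W"
  shows "normed_space_on (prod_nspace V W)"
proof -
  interpret V: normed_space_on V by fact
  interpret W: normed_space_on W by fact
  have max0: "max (nrm V x) (nrm W y) = 0 \<longleftrightarrow> x = 0 \<and> y = 0" if "x \<in> points V" "y \<in> points W" for x y
    using that V.nrm_nonneg[of x] W.nrm_nonneg[of y] V.nrm_eq_0[of x] W.nrm_eq_0[of y]
    by (metis max.absorb1 max.absorb2 max_def order_antisym)
  show ?thesis
    by unfold_locales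
      (auto simp: prod_nspace_def V.zero_mem W.zero_mem V.add_mem W.add_mem V.smult_mem W.smult_mem
        V.smult_add_right W.smult_add_right V.smult_add_left W.smult_add_left V.smult_smult
        W.smult_smult V.smult_one W.smult_one V.nrm_smult W.nrm_smult max0 zero_prod_def le_max_iff_disj
        V.nrm_nonneg W.nrm_nonneg max_mult_distrib_left
        intro!: order_trans[OF V.nrm_triangle] order_trans[OF W.nrm_triangle] add_mono)
qed

text \<open>For the maximum norm a ball is the product of two balls of the same radius. So balls are
  open rectangles, and every open rectangle around a point contains a ball, of the smaller of two
  radii.\<close>

lemma ntop_prod_nspace:
  assumes "normed_space_on V" "normed_space_on W"
  shows "ntop (prod_nspace V W) = prod_topology (ntop V) (ntop W)"
proof -
  interpret V: normed_space_on V by fact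
  interpret W: normed_space_on W by fact
  interpret P: normed_space_on "prod_nspace V W" by (rule normed_prod_nspace) fact+
  have pts: "points (prod_nspace V W) = points V \<times> points W"
    by (simp add: prod_nspace_def)
  have nr: "nrm (prod_nspace V W) ((y1,y2) - (x1,x2)) = max (nrm V (y1 - x1)) (nrm W (y2 - x2))"
    for y1 x1 y2 x2 by (simp add: prod_nspace_def)
  show ?thesis
    unfolding topology_eq openin_prod_topology_alt
  proof (intro allI iffI impI)
    fix S assume S: "openin (ntop (prod_nspace V W)) S"
    fix x y assume xy: "(x,y) \<in> S"
    then obtain r where r: "r > 0" "\<And>a b. \<lbrakk>a \<in> points V; b \<in> points W; nrm V (a - x) < r; nrm W (b - y) < r\<rbrakk> \<Longrightarrow> (a,b) \<in> S"
      using S unfolding P.openin_ntop pts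
      by (metis (no_types, lifting) SigmaI max_less_iff_conj nr)
    have mem: "x \<in> points V" "y \<in> points W"
      using S xy by (auto simp: P.openin_ntop pts)
    show "\<exists>U Z. openin (ntop V) U \<and> openin (ntop W) Z \<and> x \<in> U \<and> y \<in> Z \<and> U \<times> Z \<subseteq> S"
      using V.openin_ball[OF mem(1), of r] W.openin_ball[OF mem(2), of r] r mem
      by (intro exI[of _ "{a \<in> points V. nrm V (a - x) < r}"] exI[of _ "{b \<in> points W. nrm W (b - y) < r}"]) auto
  next
    fix S assume S: "\<forall>x y. (x, y) \<in> S \<longrightarrow> (\<exists>U Z. openin (ntop V) U \<and> openin (ntop W) Z \<and> x \<in> U \<and> y \<in> Z \<and> U \<times> Z \<subseteq> S)"
    show "openin (ntop (prod_nspace V W)) S"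
      unfolding P.openin_ntop pts
    proof (intro conjI ballI subsetI)
      fix p assume p: "p \<in> S"
      obtain x y where xy: "p = (x,y)" by (cases p)
      obtain U Z where UZ: "openin (ntop V) U" "openin (ntop W) Z" "x \<in> U" "y \<in> Z" "U \<times> Z \<subseteq> S"
        using S[rule_format, of x y] p xy by auto
      obtain r where r: "r > 0" "\<forall>a\<in>points V. nrm V (a - x) < r \<longrightarrow> a \<in> U"
        using UZ by (auto simp: V.openin_ntop)
      obtain s where s: "s > 0" "\<forall>a\<in>points W. nrm W (a - y) < s \<longrightarrow> a \<in> Z"
        using UZ by (auto simp: W.openin_ntop)
      show "p \<in> points V \<times> points W"
        using UZ xy by (auto simp: V.openin_ntop W.openin_ntop)
      show "\<exists>r>0. \<forall>q\<in>points V \<times> points W. nrm (prod_nspace V W) (q - p) < r \<longrightarrow> q \<in> S"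
        using r s UZ(5) xy by (intro exI[of _ "min r s"]) (auto simp: nr simp del: diff_Pair)
    qed
  qed
qed

lemma banach_prod_nspace:
  assumes "banach_space_on V" "banach_space_on W"
  shows "banach_space_on (prod_nspace V W)"
proof -
  interpret V: normed_space_on V by (rule banach_imp_normed) fact
  interpret W: normed_space_on W by (rule banach_imp_normed) fact
  interpret P: normed_space_on "prod_nspace V W" by (rule normed_prod_nspace) unfold_locales
  have pts: "points (prod_nspace V W) = points V \<times> points W"
    by (simp add: prod_nspace_def)
  have nr: "nrm (prod_nspace V W) (y - x) = max (nrm V (fst y - fst x)) (nrm W (snd y - snd x))"
    for y x by (simp add: prod_nspace_def case_prod_unfold)
  have key: "\<exists>x\<in>points (prod_nspace V W). (\<lambda>n. nrm (prod_nspace V W) (\<sigma> n - x)) \<longlonglongrightarrow> 0"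
    if \<sigma>: "range \<sigma> \<subseteq> points (prod_nspace V W)"
      and C: "\<forall>e>0. \<exists>N. \<forall>m\<ge>N. \<forall>n\<ge>N. nrm (prod_nspace V W) (\<sigma> m - \<sigma> n) < e" for \<sigma>
  proof -
    have ran: "range (fst \<circ> \<sigma>) \<subseteq> points V" "range (snd \<circ> \<sigma>) \<subseteq> points W"
      using \<sigma> by (auto simp: pts image_subset_iff mem_Times_iff)
    have cau: "\<forall>e>0. \<exists>N. \<forall>m\<ge>N. \<forall>n\<ge>N. nrm V ((fst \<circ> \<sigma>) m - (fst \<circ> \<sigma>) n) < e"
      "\<forall>e>0. \<exists>N. \<forall>m\<ge>N. \<forall>n\<ge>N. nrm W ((snd \<circ> \<sigma>) m - (snd \<circ> \<sigma>) n) < e"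
      using C unfolding nr comp_def by (meson max_less_iff_conj)+
    have "\<exists>x\<in>points V. (\<lambda>n. nrm V ((fst \<circ> \<sigma>) n - x)) \<longlonglongrightarrow> 0"
      by (rule mp[OF spec[OF conjunct2[OF assms(1)[unfolded banach_space_on_iff V.mcomplete_iff]]]])
        (intro conjI ran cau)
    moreover have "\<exists>y\<in>points W. (\<lambda>n. nrm W ((snd \<circ> \<sigma>) n - y)) \<longlonglongrightarrow> 0"
      by (rule mp[OF spec[OF conjunct2[OF assms(2)[unfolded banach_space_on_iff W.mcomplete_iff]]]])
        (intro conjI ran cau)
    ultimately obtain x y where xy: "x \<in> points V" "(\<lambda>n. nrm V ((fst \<circ> \<sigma>) n - x)) \<longlonglongrightarrow> 0"
      "y \<in> points W" "(\<lambda>n. nrm W ((snd \<circ> \<sigma>) n - y)) \<longlonglongrightarrow> 0"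
      by blast
    have "(\<lambda>n. max (nrm V (fst (\<sigma> n) - x)) (nrm W (snd (\<sigma> n) - y))) \<longlonglongrightarrow> max 0 0"
      using xy by (intro tendsto_max) auto
    then show ?thesis
      using xy by (intro bexI[of _ "(x,y)"]) (auto simp: pts nr)
  qed
  show ?thesis
    unfolding banach_space_on_iff P.mcomplete_iff
    by (intro conjI allI impI P.normed_space_on_axioms) (elim conjE, rule key)
qed

section \<open>Analytic maps\<close>

text \<open>The expansion at one point, separated from the domain: \<open>nspace_analytic\<close>
  also wants the ball to stay inside the domain, which \<open>analyticI\<close> restores by
  shrinking the radius.\<close>

definition power_series_on ::
  "('k, 'v::ab_group_add) nspace \<Rightarrow> ('k, 'w::ab_group_add) nspace \<Rightarrow> ('v \<Rightarrow> 'w) \<Rightarrow> 'v \<Rightarrow> real \<Rightarrow>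
    (nat \<Rightarrow> 'v list \<Rightarrow> 'w) \<Rightarrow> (nat \<Rightarrow> real) \<Rightarrow> bool" where
  "power_series_on V W f a r A C \<longleftrightarrow>
     r > 0 \<and> (\<forall>n. bounded_multilinear V W n (C n) (A n)) \<and> summable (\<lambda>n. C n * r ^ n) \<and>
     (\<forall>h\<in>points V. nrm V h < r \<longrightarrow>
        (\<lambda>N. nrm W (f (a + h) - (\<Sum>n<N. A n (replicate n h)))) \<longlonglongrightarrow> 0)"

lemma power_series_onD:
  assumes "power_series_on V W f a r A C"
  shows "r > 0" and "bounded_multilinear V W n (C n) (A n)" and "summable (\<lambda>n. C n * r ^ n)"
    and "\<lbrakk>h \<in> points V; nrm V h < r\<rbrakk> \<Longrightarrow>
        (\<lambda>N. nrm W (f (a + h) - (\<Sum>n<N. A n (replicate n h)))) \<longlonglongrightarrow> 0"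
  using assms by (simp_all add: power_series_on_def)

lemma analyticD:
  assumes "nspace_analytic V W U f"
  shows "openin (ntop V) U" and "x \<in> U \<Longrightarrow> f x \<in> points W"
  using assms by (simp_all only: nspace_analytic_def image_subset_iff)

lemma power_series_on_nonneg: "power_series_on V W f a r A C \<Longrightarrow> 0 \<le> C n"
  by (auto simp: power_series_on_def bounded_multilinear_def)

lemma power_series_on_mono:
  assumes "power_series_on V W f a r A C" "0 < s" "s \<le> r"
  shows "power_series_on V W f a s A C"
proof -
  have "summable (\<lambda>n. C n * s ^ n)"
  proof (rule summable_comparison_test'[where g = "\<lambda>n. C n * r ^ n" and N = 0])
    show "summable (\<lambda>n. C n * r ^ n)" using assms by (simp add: power_series_on_def)
    show "norm (C n * s ^ n) \<le> C n * r ^ n" for n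
      using assms power_series_on_nonneg[OF assms(1), of n]
      by (auto simp: abs_mult intro!: mult_left_mono power_mono)
  qed
  then show ?thesis
    using assms by (auto simp: power_series_on_def)
qed

lemma power_series_on_cong:
  assumes "power_series_on V W f a r A C" "\<And>h. h \<in> points V \<Longrightarrow> nrm V h < r \<Longrightarrow> f (a + h) = g (a + h)"
  shows "power_series_on V W g a r A C"
  using assms by (auto simp: power_series_on_def)

lemma multilinear_mem:
  "\<lbrakk>bounded_multilinear V W n C A; set xs \<subseteq> points V; length xs = n\<rbrakk> \<Longrightarrow> A xs \<in> points W"
  by (simp add: bounded_multilinear_def)

lemma multilinear_replicate_mem:
  "\<lbrakk>bounded_multilinear V W n C A; h \<in> points V\<rbrakk> \<Longrightarrow> A (replicate n h) \<in> points W"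
  by (rule multilinear_mem) auto

lemma multilinear_replicate_bound:
  "\<lbrakk>bounded_multilinear V W n C A; h \<in> points V\<rbrakk> \<Longrightarrow> nrm W (A (replicate n h)) \<le> C * nrm V h ^ n"
  unfolding bounded_multilinear_def
  by (drule conjunct2, drule spec[of _ "replicate n h"]) (auto simp: prod_list_replicate)

section \<open>Expansions, continuity and sums of analytic maps\<close>

locale two_spaces = V: normed_space_on V + W: normed_space_on W
  for V :: "('k::real_normed_field, 'v::ab_group_add) nspace"
    and W :: "('k, 'w::ab_group_add) nspace"
begin

lemma analyticI:
  assumes U: "openin (ntop V) U" and f: "f ` U \<subseteq> points W"
    and ps: "\<And>a. a \<in> U \<Longrightarrow> \<exists>r A C. power_series_on V W f a r A C"
  shows "nspace_analytic V W U f"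
  unfolding nspace_analytic_def
proof (intro conjI ballI U f)
  fix a assume a: "a \<in> U"
  obtain r A C where ps: "power_series_on V W f a r A C"
    using ps[OF a] by (elim exE) (rule that)
  have aV: "a \<in> points V" using U a by (auto simp: V.openin_ntop)
  obtain s where s: "s > 0" "\<forall>y\<in>points V. nrm V (y - a) < s \<longrightarrow> y \<in> U"
    using U a by (auto simp: V.openin_ntop)
  have "power_series_on V W f a (min r s) A C"
    by (rule power_series_on_mono[OF ps]) (use s ps in \<open>auto simp: power_series_on_def\<close>)
  moreover have "a + h \<in> U" if "h \<in> points V" "nrm V h < min r s" for h
    using s(2) that aV V.add_mem[of a h] by auto
  ultimately show "\<exists>r>0. \<exists>A C.
        (\<forall>n. bounded_multilinear V W n (C n) (A n)) \<and> summable (\<lambda>n. C n * r ^ n) \<and>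
        (\<forall>h\<in>points V. nrm V h < r \<longrightarrow>
           a + h \<in> U \<and> (\<lambda>N. nrm W (f (a + h) - (\<Sum>n<N. A n (replicate n h)))) \<longlonglongrightarrow> 0)"
    unfolding power_series_on_def by blast
qed

lemma analyticE:
  assumes "nspace_analytic V W U f" "a \<in> U"
  shows "\<exists>r A C. power_series_on V W f a r A C \<and> (\<forall>h\<in>points V. nrm V h < r \<longrightarrow> a + h \<in> U)"
proof -
  obtain r A C where "r > 0" "\<forall>n. bounded_multilinear V W n (C n) (A n)" "summable (\<lambda>n. C n * r ^ n)"
    "\<forall>h\<in>points V. nrm V h < r \<longrightarrow>
           a + h \<in> U \<and> (\<lambda>N. nrm W (f (a + h) - (\<Sum>n<N. A n (replicate n h)))) \<longlonglongrightarrow> 0"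
    using assms unfolding nspace_analytic_def by blast
  then show ?thesis
    by (intro exI[of _ r] exI[of _ A] exI[of _ C]) (simp add: power_series_on_def)
qed

lemma analytic_subset:
  assumes "nspace_analytic V W U f" "openin (ntop V) U'" "U' \<subseteq> U"
  shows "nspace_analytic V W U' f"
proof (rule analyticI)
  show "f ` U' \<subseteq> points W"
    using analyticD(2)[OF assms(1)] assms(3) by auto
  show "\<exists>r A C. power_series_on V W f a r A C" if "a \<in> U'" for a
    using analyticE[OF assms(1) subsetD[OF assms(3) that]] by (elim exE conjE) (intro exI)
qed fact

lemma analytic_cong:
  assumes "nspace_analytic V W U f" "\<And>x. x \<in> U \<Longrightarrow> f x = g x"
  shows "nspace_analytic V W U g"
proof (rule analyticI)
  show "openin (ntop V) U" by (rule analyticD[OF assms(1)])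
  show "g ` U \<subseteq> points W"
    using analyticD(2)[OF assms(1)] assms(2) by auto
  fix a assume a: "a \<in> U"
  obtain r A C where ps: "power_series_on V W f a r A C"
    and U: "\<forall>h\<in>points V. nrm V h < r \<longrightarrow> a + h \<in> U"
    using analyticE[OF assms(1) a] by (elim exE conjE) (rule that)
  have "power_series_on V W g a r A C"
    by (rule power_series_on_cong[OF ps]) (simp add: assms(2) U)
  then show "\<exists>r A C. power_series_on V W g a r A C" by (intro exI)
qed

lemma multilinear_zero:
  assumes "0 \<le> C" shows "bounded_multilinear V W n C (\<lambda>_. 0)"
  using assms unfolding bounded_multilinear_def
  by (auto simp: W.zero_mem intro!: mult_nonneg_nonneg prod_list_nonneg V.nrm_nonneg)

lemma multilinear_add:
  assumes "bounded_multilinear V W n C A" "bounded_multilinear V W n D B"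
  shows "bounded_multilinear V W n (C + D) (\<lambda>xs. A xs + B xs)"
  unfolding bounded_multilinear_def
proof (intro conjI allI impI ballI)
  show "0 \<le> C + D" using assms by (simp add: bounded_multilinear_def)
  fix xs :: "'v list" assume xs: "set xs \<subseteq> points V \<and> length xs = n"
  then have m: "A xs \<in> points W" "B xs \<in> points W"
    using assms by (simp_all add: bounded_multilinear_def)
  show "A xs + B xs \<in> points W" using m by (rule W.add_mem)
  show "nrm W (A xs + B xs) \<le> (C + D) * prod_list (map (nrm V) xs)"
    using assms xs W.nrm_triangle[OF m] unfolding bounded_multilinear_def distrib_right by fastforce
  show "A (xs[i := x + y]) + B (xs[i := x + y]) = A (xs[i := x]) + B (xs[i := x]) + (A (xs[i := y]) + B (xs[i := y]))"
    if "i < n" "x \<in> points V" "y \<in> points V" for i x y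
    using assms xs that by (simp add: bounded_multilinear_def algebra_simps)
  show "A (xs[i := nscale V c x]) + B (xs[i := nscale V c x]) = nscale W c (A (xs[i := x]) + B (xs[i := x]))"
    if "i < n" "x \<in> points V" for i c x
  proof -
    have "set (xs[i := x]) \<subseteq> points V" "length (xs[i := x]) = n"
      using xs that by (auto dest!: subsetD[OF set_update_subset_insert])
    then show ?thesis
      using assms xs that by (simp add: bounded_multilinear_def W.smult_add_right)
  qed
qed

lemma multilinear_sum:
  assumes "finite I" "\<And>i. i \<in> I \<Longrightarrow> bounded_multilinear V W n (C i) (A i)"
  shows "bounded_multilinear V W n (\<Sum>i\<in>I. C i) (\<lambda>xs. \<Sum>i\<in>I. A i xs)"
  using assms
proof (induction I)
  case empty
  then show ?case by (simp add: multilinear_zero)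
next
  case (insert i I)
  then have "bounded_multilinear V W n (C i + (\<Sum>i\<in>I. C i)) (\<lambda>xs. A i xs + (\<Sum>i\<in>I. A i xs))"
    by (intro multilinear_add insert.IH) simp_all
  then show ?case using insert.hyps by simp
qed

text \<open>The partial sums without the constant term obey the bound term by term. Convergence is
  known only as the vanishing of a residual norm, so the bound passes to the limit through the
  triangle inequality.\<close>

lemma power_series_increment:
  assumes ps: "power_series_on V W f a r A C" and f: "f a \<in> points W" "f (a + h) \<in> points W"
    and h: "h \<in> points V" "nrm V h < r"
  shows "nrm W (f (a + h) - f a) \<le> (\<Sum>n. C (Suc n) * nrm V h ^ Suc n)"
    and "f a = A 0 []"
proof -
  have bm: "bounded_multilinear V W n (C n) (A n)" for n
    by (rule power_series_onD[OF ps])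
  have mem: "A n (replicate n k) \<in> points W" if "k \<in> points V" for n k
    using multilinear_replicate_mem[OF bm that] .
  \<comment> \<open>At h = 0 the bound \<open>C n * 0 ^ n\<close> kills every term of positive
    degree.\<close>
  have zero: "A n (replicate n 0) = 0" if "n > 0" for n
    using multilinear_replicate_bound[OF bm V.zero_mem, of n] W.nrm_nonneg[OF mem[OF V.zero_mem, of n]]
      W.nrm_eq_0[OF mem[OF V.zero_mem, of n]] that by (simp add: power_0_left)
  \<comment> \<open>The empty partial sum lacks the constant term, hence the upper limit
    \<open>Suc N\<close>.\<close>
  have sumz: "(\<Sum>n<Suc N. A n (replicate n 0)) = A 0 []" for N
    unfolding sum.lessThan_Suc_shift by (simp add: zero del: replicate_Suc)
  have "(\<lambda>N. nrm W (f (a + 0) - (\<Sum>n<N. A n (replicate n 0)))) \<longlonglongrightarrow> 0"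
    using power_series_onD(4)[OF ps V.zero_mem] power_series_onD(1)[OF ps] by simp
  then have "(\<lambda>N. nrm W (f (a + 0) - (\<Sum>n<Suc N. A n (replicate n 0)))) \<longlonglongrightarrow> 0"
    by (rule LIMSEQ_Suc)
  then have "nrm W (f a - A 0 []) = 0"
    unfolding sumz by (simp add: LIMSEQ_const_iff)
  then show fa: "f a = A 0 []"
    using W.nrm_eq_0[of "f a - A 0 []"] W.diff_mem f(1) mem[OF V.zero_mem, of 0] by simp
  have smr: "summable (\<lambda>n. C n * nrm V h ^ n)"
  proof (rule summable_comparison_test'[where g = "\<lambda>n. C n * r ^ n" and N = 0])
    show "summable (\<lambda>n. C n * r ^ n)" using ps by (simp add: power_series_on_def)
    show "norm (C n * nrm V h ^ n) \<le> C n * r ^ n" for n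
      using h V.nrm_nonneg[of h] power_series_on_nonneg[OF ps, of n]
      by (auto simp: abs_mult intro!: mult_mono power_mono)
  qed
  then have sm: "summable (\<lambda>n. C (Suc n) * nrm V h ^ Suc n)"
    using summable_Suc_iff[of "\<lambda>n. C n * nrm V h ^ n"] by simp
  let ?B = "\<Sum>n. C (Suc n) * nrm V h ^ Suc n"
  let ?s = "\<lambda>N. \<Sum>n<N. A n (replicate n h)"
  have bd: "nrm W (f (a + h) - f a) \<le> nrm W (f (a + h) - ?s (Suc N)) + ?B" for N
  proof -
    have 1: "?s (Suc N) - f a = (\<Sum>n<N. A (Suc n) (replicate (Suc n) h))"
      unfolding fa sum.lessThan_Suc_shift by simp
    have "nrm W (?s (Suc N) - f a) \<le> (\<Sum>n<N. nrm W (A (Suc n) (replicate (Suc n) h)))"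
      unfolding 1 by (intro W.nrm_sum mem h)
    also have "\<dots> \<le> (\<Sum>n<N. C (Suc n) * nrm V h ^ Suc n)"
      by (intro sum_mono multilinear_replicate_bound[OF bm h(1)])
    also have "\<dots> \<le> ?B"
      using V.nrm_nonneg[OF h(1)] power_series_on_nonneg[OF ps]
      by (intro sum_le_suminf sm) (auto intro!: mult_nonneg_nonneg)
    finally show ?thesis
      using W.nrm_diff_triangle[OF f(2) W.sum_mem f(1), of "{..<Suc N}" "\<lambda>n. A n (replicate n h)"] mem[OF h(1)]
      by fastforce
  qed
  have "(\<lambda>N. nrm W (f (a + h) - ?s (Suc N)) + ?B) \<longlonglongrightarrow> 0 + ?B"
    using power_series_onD(4)[OF ps h] by (intro tendsto_intros LIMSEQ_Suc)
  then show "nrm W (f (a + h) - f a) \<le> ?B"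
    using bd by (intro LIMSEQ_le_const[of _ ?B]) auto
qed

text \<open>Every term of the tail has degree at least one, so shrinking the radius by the factor t
  gains at least one factor t. This makes the tail as small as desired, both for continuity and for
  the inverse series.\<close>

lemma power_series_tail_bound:
  assumes ps: "power_series_on V W f a r A C" and t: "0 \<le> t" "t \<le> 1"
  shows "summable (\<lambda>n. C (Suc n) * (t * r) ^ Suc n)"
    and "(\<Sum>n. C (Suc n) * (t * r) ^ Suc n) \<le> t * (\<Sum>n. C (Suc n) * r ^ Suc n)"
proof -
  have r: "r > 0" using ps by (simp add: power_series_on_def)
  have sm: "summable (\<lambda>n. C (Suc n) * r ^ Suc n)"
    using ps summable_Suc_iff[of "\<lambda>n. C n * r ^ n"] by (simp add: power_series_on_def)
  have le: "C (Suc n) * (t * r) ^ Suc n \<le> t * (C (Suc n) * r ^ Suc n)" for n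
  proof -
    have "t ^ Suc n \<le> t" using t by (metis mult.commute mult_left_le power_Suc2 power_le_one)
    then have "t ^ Suc n * (C (Suc n) * r ^ Suc n) \<le> t * (C (Suc n) * r ^ Suc n)"
      using r power_series_on_nonneg[OF ps] by (intro mult_right_mono mult_nonneg_nonneg) auto
    then show ?thesis by (simp add: power_mult_distrib algebra_simps)
  qed
  show sm2: "summable (\<lambda>n. C (Suc n) * (t * r) ^ Suc n)"
    by (rule summable_comparison_test'[where g = "\<lambda>n. t * (C (Suc n) * r ^ Suc n)" and N = 0])
      (use r t le power_series_on_nonneg[OF ps] in \<open>auto intro!: summable_mult sm simp del: power_Suc simp: abs_of_nonneg\<close>)
  show "(\<Sum>n. C (Suc n) * (t * r) ^ Suc n) \<le> t * (\<Sum>n. C (Suc n) * r ^ Suc n)"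
    unfolding suminf_mult[OF sm, symmetric] by (intro suminf_le le sm2 summable_mult sm)
qed

text \<open>The increment is bounded by the tail of the majorant series, and scaling the radius by t
  scales that tail by t.\<close>

lemma analytic_near:
  assumes an: "nspace_analytic V W U f" and a: "a \<in> U" and e: "e > 0"
  shows "\<exists>d>0. \<forall>y\<in>points V. nrm V (y - a) < d \<longrightarrow> y \<in> U \<and> nrm W (f y - f a) < e"
proof -
  obtain r A C where ps: "power_series_on V W f a r A C"
    and U: "\<forall>h\<in>points V. nrm V h < r \<longrightarrow> a + h \<in> U"
    using analyticE[OF an a] by (elim exE conjE) (rule that)
  have r: "r > 0" using ps by (simp add: power_series_on_def)
  have aV: "a \<in> points V" and fU: "f ` U \<subseteq> points W"
    using analyticD[OF an] a by (auto simp: V.openin_ntop)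
  let ?S = "\<Sum>n. C (Suc n) * r ^ Suc n"
  have sm: "summable (\<lambda>n. C (Suc n) * r ^ Suc n)"
    using ps summable_Suc_iff[of "\<lambda>n. C n * r ^ n"] by (simp add: power_series_on_def)
  have S: "?S \<ge> 0"
    using r power_series_on_nonneg[OF ps] by (intro suminf_nonneg sm) auto
  \<comment> \<open>The summand 1 guards against \<open>?S = 0\<close>, and the factor 2 leaves room
    for the strict inequality \<open>t * ?S < e\<close>.\<close>
  define t where "t = min 1 (e / (2 * (?S + 1)))"
  have t: "0 < t" "t \<le> 1" using e S by (auto simp: t_def)
  have "t * ?S \<le> e / (2 * (?S + 1)) * ?S" using S by (intro mult_right_mono) (auto simp: t_def)
  also have "\<dots> < e" using e S by (simp add: field_simps add_pos_nonneg)
  finally have tS: "t * ?S < e" .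
  show ?thesis
  proof (intro exI[of _ "t * r"] conjI ballI impI)
    show "0 < t * r" using t r by simp
    fix y assume y: "y \<in> points V" "nrm V (y - a) < t * r"
    define h where "h = y - a"
    have h: "h \<in> points V" "nrm V h < t * r" "y = a + h" using y aV by (auto simp: h_def V.diff_mem)
    have "t * r \<le> 1 * r" using t r by (intro mult_right_mono) auto
    then have hr: "nrm V h < r" using h(2) by simp
    show "y \<in> U" using U h hr by simp
    then have "nrm W (f y - f a) \<le> (\<Sum>n. C (Suc n) * nrm V h ^ Suc n)"
      using power_series_increment(1)[OF ps _ _ h(1) hr] fU a h(3) by auto
    also have "\<dots> \<le> (\<Sum>n. C (Suc n) * (t * r) ^ Suc n)"
    proof (rule suminf_le)
      show le: "C (Suc n) * nrm V h ^ Suc n \<le> C (Suc n) * (t * r) ^ Suc n" for n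
        using h V.nrm_nonneg[OF h(1)] power_series_on_nonneg[OF ps]
        by (intro mult_left_mono power_mono) auto
      show *: "summable (\<lambda>n. C (Suc n) * (t * r) ^ Suc n)"
        by (rule power_series_tail_bound(1)[OF ps]) (use t in auto)
      show "summable (\<lambda>n. C (Suc n) * nrm V h ^ Suc n)"
        by (rule summable_comparison_test'[OF *, where N = 0])
          (use le V.nrm_nonneg[OF h(1)] power_series_on_nonneg[OF ps] in \<open>auto simp del: power_Suc simp: abs_of_nonneg\<close>)
    qed
    also have "\<dots> \<le> t * ?S" by (rule power_series_tail_bound(2)[OF ps]) (use t in auto)
    finally show "nrm W (f y - f a) < e" using tS by simp
  qed
qed

text \<open>Continuity in the form used for charts: the set is open in the whole space, because the
  domain of an analytic map is open.\<close>

lemma analytic_openin_preimage: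
  assumes an: "nspace_analytic V W U f" and S: "openin (ntop W) S"
  shows "openin (ntop V) {x \<in> U. f x \<in> S}"
  unfolding V.openin_ntop
proof (intro conjI ballI)
  have UV: "U \<subseteq> points V" and fU: "f ` U \<subseteq> points W"
    using analyticD[OF an] by (auto simp: V.openin_ntop)
  then show "{x \<in> U. f x \<in> S} \<subseteq> points V" by auto
  fix a assume a: "a \<in> {x \<in> U. f x \<in> S}"
  then obtain e where e: "e > 0" "\<forall>y\<in>points W. nrm W (y - f a) < e \<longrightarrow> y \<in> S"
    using S by (auto simp: W.openin_ntop)
  then obtain d where "d > 0" "\<forall>y\<in>points V. nrm V (y - a) < d \<longrightarrow> y \<in> U \<and> nrm W (f y - f a) < e"
    using analytic_near[OF an _ e(1), of a] a by auto
  then show "\<exists>d>0. \<forall>y\<in>points V. nrm V (y - a) < d \<longrightarrow> y \<in> {x \<in> U. f x \<in> S}"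
    using e(2) fU by blast
qed

text \<open>The expansion at a has only the terms \<open>c + L a\<close> of degree 0 and L of degree
  1.\<close>

lemma analytic_affine:
  assumes U: "openin (ntop V) U" and L: "linear_map_on V W L"
    and K: "\<And>x. x \<in> points V \<Longrightarrow> nrm W (L x) \<le> K * nrm V x"
    and c: "c \<in> points W"
  shows "nspace_analytic V W U (\<lambda>x. c + L x)"
proof (rule analyticI)
  have Lm: "L x \<in> points W" if "x \<in> points V" for x
    using L that by (auto simp: linear_map_on_def)
  have La: "L (x + y) = L x + L y" if "x \<in> points V" "y \<in> points V" for x y
    using L that by (auto simp: linear_map_on_def)
  have Ls: "L (nscale V c x) = nscale W c (L x)" if "x \<in> points V" for x c
    using L that by (auto simp: linear_map_on_def)
  have UV: "U \<subseteq> points V" using U by (simp add: V.openin_ntop)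
  show "(\<lambda>x. c + L x) ` U \<subseteq> points W" using UV Lm c by (auto intro: W.add_mem)
  fix a assume a: "a \<in> U"
  then have aV: "a \<in> points V" using UV by auto
  define A where "A = (\<lambda>n xs. if n = 0 then c + L a else if n = Suc 0 then L (xs ! 0) else 0)"
  \<comment> \<open>Coefficient bounds must be nonnegative, while K may be negative if the carrier
    is trivial; hence the absolute value.\<close>
  define C where "C = (\<lambda>n::nat. if n = 0 then nrm W (c + L a) else if n = 1 then \<bar>K\<bar> else 0)"
  have K': "nrm W (L x) \<le> \<bar>K\<bar> * nrm V x" if "x \<in> points V" for x
    using K[OF that] V.nrm_nonneg[OF that] by (meson abs_ge_self mult_right_mono order_trans)
  have "bounded_multilinear V W n (C n) (A n)" for n
  proof (cases "n = 0 \<or> n = 1")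
    case True
    then show ?thesis
      unfolding bounded_multilinear_def A_def C_def
      using W.add_mem[OF c Lm[OF aV]] W.nrm_nonneg[OF W.add_mem[OF c Lm[OF aV]]]
      by (auto simp: length_Suc_conv La Ls Lm K')
  next
    case False
    then have "A n = (\<lambda>_. 0)" "C n = 0" by (auto simp: A_def C_def)
    then show ?thesis using multilinear_zero by simp
  qed
  moreover have "summable (\<lambda>n. C n * 1 ^ n)"
    by (rule summable_finite[of "{..1}"]) (auto simp: C_def)
  moreover have "(\<lambda>N. nrm W (c + L (a + h) - (\<Sum>n<N. A n (replicate n h)))) \<longlonglongrightarrow> 0" if h: "h \<in> points V" for h
  proof -
    \<comment> \<open>From two terms on the partial sums are exact, so the limit is obtained by
      shifting the index twice.\<close>
    have "(\<Sum>n<Suc (Suc N). A n (replicate n h)) = c + L (a + h)" for N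
      by (induction N) (auto simp: A_def La[OF aV h] add.assoc)
    then have "(\<lambda>N. nrm W (c + L (a + h) - (\<Sum>n<Suc (Suc N). A n (replicate n h)))) \<longlonglongrightarrow> 0"
      by simp
    then have "(\<lambda>N. nrm W (c + L (a + h) - (\<Sum>n<Suc N. A n (replicate n h)))) \<longlonglongrightarrow> 0"
      by (rule LIMSEQ_imp_Suc)
    then show ?thesis
      by (rule LIMSEQ_imp_Suc)
  qed
  ultimately show "\<exists>r A C. power_series_on V W (\<lambda>x. c + L x) a r A C"
    unfolding power_series_on_def by (intro exI[of _ 1] exI[of _ A] exI[of _ C]) auto
qed fact

lemma analytic_linear:
  assumes "openin (ntop V) U" "linear_map_on V W L" "\<And>x. x \<in> points V \<Longrightarrow> nrm W (L x) \<le> K * nrm V x"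
  shows "nspace_analytic V W U L"
  using analytic_affine[OF assms W.zero_mem] by simp

lemma analytic_const:
  assumes "openin (ntop V) U" "c \<in> points W"
  shows "nspace_analytic V W U (\<lambda>_. c)"
proof -
  have "linear_map_on V W (\<lambda>_. 0)"
    using W.smult_add_right[OF W.zero_mem W.zero_mem] by (auto simp: linear_map_on_def W.zero_mem)
  from analytic_affine[OF assms(1) this _ assms(2), of 0] show ?thesis by simp
qed

lemma analytic_add:
  assumes f: "nspace_analytic V W U f" and g: "nspace_analytic V W U g"
  shows "nspace_analytic V W U (\<lambda>x. f x + g x)"
proof (rule analyticI)
  show "openin (ntop V) U" by (rule analyticD[OF f])
  show "(\<lambda>x. f x + g x) ` U \<subseteq> points W"
    using analyticD(2)[OF f] analyticD(2)[OF g] by (auto intro!: W.add_mem)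
  fix a assume a: "a \<in> U"
  obtain r A C where ps: "power_series_on V W f a r A C"
    and rU: "\<forall>h\<in>points V. nrm V h < r \<longrightarrow> a + h \<in> U"
    using analyticE[OF f a] by (elim exE conjE) (rule that)
  obtain s B D where qs: "power_series_on V W g a s B D"
    using analyticE[OF g a] by (elim exE conjE) (rule that)
  define t where "t = min r s"
  have t: "t > 0" "t \<le> r" "t \<le> s" using power_series_onD(1)[OF ps] power_series_onD(1)[OF qs] by (auto simp: t_def)
  have ps: "power_series_on V W f a t A C" using power_series_on_mono[OF ps t(1,2)] .
  have qs: "power_series_on V W g a t B D" using power_series_on_mono[OF qs t(1,3)] .
  have "power_series_on V W (\<lambda>x. f x + g x) a t (\<lambda>n xs. A n xs + B n xs) (\<lambda>n. C n + D n)"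
    unfolding power_series_on_def
  proof (intro conjI allI ballI impI t)
    show "bounded_multilinear V W n (C n + D n) (\<lambda>xs. A n xs + B n xs)" for n
      by (intro multilinear_add power_series_onD(2)[OF ps] power_series_onD(2)[OF qs])
    show "summable (\<lambda>n. (C n + D n) * t ^ n)"
      unfolding distrib_right by (intro summable_add power_series_onD(3)[OF ps] power_series_onD(3)[OF qs])
    fix h assume h: "h \<in> points V" "nrm V h < t"
    have fg: "f (a + h) \<in> points W" "g (a + h) \<in> points W"
      using analyticD(2)[OF f] analyticD(2)[OF g] rU h t by auto
    have mem: "(\<Sum>n<N. A n (replicate n h)) \<in> points W" "(\<Sum>n<N. B n (replicate n h)) \<in> points W" for N
      using multilinear_replicate_mem[OF power_series_onD(2)[OF ps] h(1)]
        multilinear_replicate_mem[OF power_series_onD(2)[OF qs] h(1)] by (simp_all add: W.sum_mem)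
    show "(\<lambda>N. nrm W (f (a + h) + g (a + h) - (\<Sum>n<N. A n (replicate n h) + B n (replicate n h)))) \<longlonglongrightarrow> 0"
    proof (rule tendsto_sandwich[of "\<lambda>_. 0"])
      show "(\<lambda>N. nrm W (f (a + h) - (\<Sum>n<N. A n (replicate n h))) + nrm W (g (a + h) - (\<Sum>n<N. B n (replicate n h)))) \<longlonglongrightarrow> 0"
        by (intro tendsto_add_zero power_series_onD(4)[OF ps] power_series_onD(4)[OF qs] h)
      show "\<forall>\<^sub>F N in sequentially. 0 \<le> nrm W (f (a + h) + g (a + h) - (\<Sum>n<N. A n (replicate n h) + B n (replicate n h)))"
        unfolding sum.distrib using fg mem by (intro always_eventually allI W.nrm_nonneg W.diff_mem W.add_mem)
      show "\<forall>\<^sub>F N in sequentially. nrm W (f (a + h) + g (a + h) - (\<Sum>n<N. A n (replicate n h) + B n (replicate n h)))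
         \<le> nrm W (f (a + h) - (\<Sum>n<N. A n (replicate n h))) + nrm W (g (a + h) - (\<Sum>n<N. B n (replicate n h)))"
        unfolding sum.distrib add_diff_add using fg mem
        by (intro always_eventually allI W.nrm_triangle W.diff_mem)
    qed auto
  qed
  then show "\<exists>r A C. power_series_on V W (\<lambda>x. f x + g x) a r A C" by (intro exI)
qed

end

section \<open>Bilinear maps and products of power series\<close>

locale bilinear_on = V1: normed_space_on V1 + V2: normed_space_on V2 + W: normed_space_on W
  for V1 :: "('k::real_normed_field, 'u::ab_group_add) nspace"
    and V2 :: "('k, 'v::ab_group_add) nspace"
    and W :: "('k, 'w::ab_group_add) nspace" +
  fixes \<beta> :: "'u \<Rightarrow> 'v \<Rightarrow> 'w" and K :: real
  assumes mem: "\<lbrakk>x \<in> points V1; y \<in> points V2\<rbrakk> \<Longrightarrow> \<beta> x y \<in> points W"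
    and add_left: "\<lbrakk>x \<in> points V1; x' \<in> points V1; y \<in> points V2\<rbrakk> \<Longrightarrow> \<beta> (x + x') y = \<beta> x y + \<beta> x' y"
    and add_right: "\<lbrakk>x \<in> points V1; y \<in> points V2; y' \<in> points V2\<rbrakk> \<Longrightarrow> \<beta> x (y + y') = \<beta> x y + \<beta> x y'"
    and scale_left: "\<lbrakk>x \<in> points V1; y \<in> points V2\<rbrakk> \<Longrightarrow> \<beta> (nscale V1 c x) y = nscale W c (\<beta> x y)"
    and scale_right: "\<lbrakk>x \<in> points V1; y \<in> points V2\<rbrakk> \<Longrightarrow> \<beta> x (nscale V2 c y) = nscale W c (\<beta> x y)"
    and bound_nonneg: "0 \<le> K"
    and bound: "\<lbrakk>x \<in> points V1; y \<in> points V2\<rbrakk> \<Longrightarrow> nrm W (\<beta> x y) \<le> K * nrm V1 x * nrm V2 y"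
begin

lemma zero_left [simp]: "y \<in> points V2 \<Longrightarrow> \<beta> 0 y = 0"
  using add_left[of 0 0 y] V1.zero_mem by simp

lemma zero_right [simp]: "x \<in> points V1 \<Longrightarrow> \<beta> x 0 = 0"
  using add_right[of x 0 0] V2.zero_mem by simp

lemma diff_left: "\<lbrakk>x \<in> points V1; x' \<in> points V1; y \<in> points V2\<rbrakk> \<Longrightarrow> \<beta> (x - x') y = \<beta> x y - \<beta> x' y"
  using add_left[of "x - x'" x' y] V1.diff_mem by (simp add: eq_diff_eq)

lemma diff_right: "\<lbrakk>x \<in> points V1; y \<in> points V2; y' \<in> points V2\<rbrakk> \<Longrightarrow> \<beta> x (y - y') = \<beta> x y - \<beta> x y'"
  using add_right[of x "y - y'" y'] V2.diff_mem by (simp add: eq_diff_eq)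

lemma sum_left:
  "\<lbrakk>\<And>i. i \<in> I \<Longrightarrow> f i \<in> points V1; y \<in> points V2\<rbrakk> \<Longrightarrow> \<beta> (sum f I) y = (\<Sum>i\<in>I. \<beta> (f i) y)"
  by (induction I rule: infinite_finite_induct) (auto simp: add_left V1.sum_mem)

lemma sum_right:
  "\<lbrakk>\<And>i. i \<in> I \<Longrightarrow> f i \<in> points V2; x \<in> points V1\<rbrakk> \<Longrightarrow> \<beta> x (sum f I) = (\<Sum>i\<in>I. \<beta> x (f i))"
  by (induction I rule: infinite_finite_induct) (auto simp: add_right V2.sum_mem)

text \<open>The difference splits as \<open>\<beta> (f - s N) g + \<beta> (s N) (g - t N)\<close>;
  the second summand tends to 0 because the \<open>s N\<close> are bounded by M.\<close>

lemma bilinear_tendsto: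
  assumes s: "\<And>N. s N \<in> points V1" "\<And>N. nrm V1 (s N) \<le> M" and t: "\<And>N. t N \<in> points V2"
    and f: "f \<in> points V1" and g: "g \<in> points V2"
    and sf: "(\<lambda>N::nat. nrm V1 (f - s N)) \<longlonglongrightarrow> 0" and tg: "(\<lambda>N. nrm V2 (g - t N)) \<longlonglongrightarrow> 0"
  shows "(\<lambda>N. nrm W (\<beta> f g - \<beta> (s N) (t N))) \<longlonglongrightarrow> 0"
proof (rule tendsto_sandwich[of "\<lambda>_. 0"])
  show "(\<lambda>N. K * nrm V1 (f - s N) * nrm V2 g + K * M * nrm V2 (g - t N)) \<longlonglongrightarrow> 0"
    using sf tg by (auto intro!: tendsto_eq_intros)
  show "\<forall>\<^sub>F N in sequentially. 0 \<le> nrm W (\<beta> f g - \<beta> (s N) (t N))"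
    by (intro always_eventually allI W.nrm_nonneg W.diff_mem mem s t f g)
  show "\<forall>\<^sub>F N in sequentially. nrm W (\<beta> f g - \<beta> (s N) (t N))
      \<le> K * nrm V1 (f - s N) * nrm V2 g + K * M * nrm V2 (g - t N)"
  proof (intro always_eventually allI)
    fix N
    have m: "f - s N \<in> points V1" "g - t N \<in> points V2"
      using s t f g by (auto intro: V1.diff_mem V2.diff_mem)
    have "\<beta> f g - \<beta> (s N) (t N) = \<beta> (f - s N) g + \<beta> (s N) (g - t N)"
      using s(1) t f g by (simp add: diff_left diff_right)
    then have "nrm W (\<beta> f g - \<beta> (s N) (t N)) \<le> nrm W (\<beta> (f - s N) g) + nrm W (\<beta> (s N) (g - t N))"
      using W.nrm_triangle[OF mem[OF m(1) g] mem[OF s(1) m(2)]] by simp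
    also have "\<dots> \<le> K * nrm V1 (f - s N) * nrm V2 g + K * nrm V1 (s N) * nrm V2 (g - t N)"
      by (intro add_mono bound m g s)
    also have "K * nrm V1 (s N) * nrm V2 (g - t N) \<le> K * M * nrm V2 (g - t N)"
      by (intro mult_right_mono mult_left_mono s bound_nonneg V2.nrm_nonneg m)
    finally show "nrm W (\<beta> f g - \<beta> (s N) (t N)) \<le> K * nrm V1 (f - s N) * nrm V2 g + K * M * nrm V2 (g - t N)"
      by simp
  qed
qed auto

text \<open>The product of the partial sums runs over a square of indices, the Cauchy sum over a
  triangle. The norm of what remains is at most K times the same remainder for the majorants, which
  tends to 0 by the Cauchy product theorem for nonnegative real series.\<close>

lemma bilinear_Cauchy_product:
  assumes a: "\<And>k. a k \<in> points V1" "\<And>k. nrm V1 (a k) \<le> \<alpha> k" and sa: "summable \<alpha>"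
    and b: "\<And>k. b k \<in> points V2" "\<And>k. nrm V2 (b k) \<le> \<gamma> k" and sb: "summable \<gamma>"
  shows "(\<lambda>N. nrm W (\<beta> (\<Sum>k<N. a k) (\<Sum>k<N. b k) - (\<Sum>n<N. \<Sum>k\<le>n. \<beta> (a k) (b (n - k))))) \<longlonglongrightarrow> 0"
proof -
  have nn: "0 \<le> \<alpha> k" "0 \<le> \<gamma> k" for k
    using V1.nrm_nonneg[OF a(1)] a(2) V2.nrm_nonneg[OF b(1)] b(2) order_trans by blast+
  let ?S = "\<lambda>N::nat. {..<N} \<times> {..<N}"
  let ?T = "\<lambda>N::nat. {(i,j). i + j < N}"
  have sub: "?T N \<subseteq> ?S N" for N by auto
  then have fin: "finite (?T N)" for N by (rule finite_subset) auto
  \<comment> \<open>The majorants summed over the square minus the triangle.\<close>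
  define R where "R = (\<lambda>N. (\<Sum>k<N. \<alpha> k) * (\<Sum>k<N. \<gamma> k) - (\<Sum>n<N. \<Sum>k\<le>n. \<alpha> k * \<gamma> (n - k)))"
  have m: "\<beta> (a i) (b j) \<in> points W" for i j by (intro mem a b)
  have le: "nrm W (\<beta> (\<Sum>k<N. a k) (\<Sum>k<N. b k) - (\<Sum>n<N. \<Sum>k\<le>n. \<beta> (a k) (b (n - k)))) \<le> K * R N" for N
  proof -
    have 1: "\<beta> (\<Sum>k<N. a k) (\<Sum>k<N. b k) = (\<Sum>(i,j)\<in>?S N. \<beta> (a i) (b j))"
      by (simp add: sum_left sum_right a b V2.sum_mem sum.cartesian_product)
    have "\<beta> (\<Sum>k<N. a k) (\<Sum>k<N. b k) - (\<Sum>n<N. \<Sum>k\<le>n. \<beta> (a k) (b (n - k)))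
      = (\<Sum>(i,j)\<in>?S N - ?T N. \<beta> (a i) (b j))"
      unfolding 1 by (simp add: sum_diff[OF _ sub] sum.triangle_reindex)
    then have "nrm W (\<beta> (\<Sum>k<N. a k) (\<Sum>k<N. b k) - (\<Sum>n<N. \<Sum>k\<le>n. \<beta> (a k) (b (n - k))))
       \<le> (\<Sum>p\<in>?S N - ?T N. nrm W (case p of (i,j) \<Rightarrow> \<beta> (a i) (b j)))"
      using W.nrm_sum[of "?S N - ?T N" "\<lambda>(i,j). \<beta> (a i) (b j)"] m by (simp add: case_prod_unfold)
    also have "\<dots> \<le> (\<Sum>p\<in>?S N - ?T N. K * (case p of (i,j) \<Rightarrow> \<alpha> i * \<gamma> j))"
    proof (rule sum_mono)
      fix p assume "p \<in> ?S N - ?T N"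
      obtain i j where p: "p = (i, j)" by (cases p)
      have "nrm W (\<beta> (a i) (b j)) \<le> K * (nrm V1 (a i) * nrm V2 (b j))"
        using bound[OF a(1) b(1), of i j] by (simp add: mult.assoc)
      also have "\<dots> \<le> K * (\<alpha> i * \<gamma> j)"
        by (intro mult_left_mono mult_mono a b bound_nonneg nn V2.nrm_nonneg)
      finally show "nrm W (case p of (i,j) \<Rightarrow> \<beta> (a i) (b j)) \<le> K * (case p of (i,j) \<Rightarrow> \<alpha> i * \<gamma> j)"
        by (simp add: p)
    qed
    also have "\<dots> = K * ((\<Sum>(i,j)\<in>?S N. \<alpha> i * \<gamma> j) - (\<Sum>(i,j)\<in>?T N. \<alpha> i * \<gamma> j))"
      unfolding sum_distrib_left[symmetric] by (simp add: sum_diff[OF _ sub])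
    also have "\<dots> = K * R N"
      unfolding R_def by (simp add: sum_product sum.cartesian_product sum.triangle_reindex)
    finally show ?thesis .
  qed
  have "(\<lambda>N. \<Sum>k<N. \<alpha> k) \<longlonglongrightarrow> suminf \<alpha>" "(\<lambda>N. \<Sum>k<N. \<gamma> k) \<longlonglongrightarrow> suminf \<gamma>"
    using sa sb by (auto intro: summable_LIMSEQ)
  moreover have "(\<lambda>N. \<Sum>n<N. \<Sum>k\<le>n. \<alpha> k * \<gamma> (n - k)) \<longlonglongrightarrow> suminf \<alpha> * suminf \<gamma>"
    using Cauchy_product_sums[of \<alpha> \<gamma>] sa sb nn by (simp add: sums_def abs_of_nonneg)
  ultimately have "R \<longlonglongrightarrow> suminf \<alpha> * suminf \<gamma> - suminf \<alpha> * suminf \<gamma>"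
    unfolding R_def by (intro tendsto_diff tendsto_mult)
  then have "(\<lambda>N. K * R N) \<longlonglongrightarrow> K * 0"
    by (intro tendsto_mult) auto
  then have lim: "(\<lambda>N. K * R N) \<longlonglongrightarrow> 0" by simp
  show ?thesis
    by (rule tendsto_sandwich[OF _ _ tendsto_const lim])
      (intro always_eventually allI W.nrm_nonneg W.diff_mem mem V1.sum_mem V2.sum_mem W.sum_mem a b,
       intro always_eventually allI le)
qed

text \<open>The factors read disjoint blocks of the list, so changing one entry changes exactly one
  factor: the left one for positions below k, the right one otherwise.\<close>

lemma multilinear_prod:
  assumes V: "normed_space_on V"
    and A: "bounded_multilinear V V1 k C A" and B: "bounded_multilinear V V2 m D B"
  shows "bounded_multilinear V W (k + m) (K * C * D) (\<lambda>xs. \<beta> (A (take k xs)) (B (drop k xs)))"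
  unfolding bounded_multilinear_def
proof (intro conjI allI impI ballI)
  interpret V: normed_space_on V by fact
  have CD: "0 \<le> C" "0 \<le> D" using A B by (simp_all add: bounded_multilinear_def)
  show "0 \<le> K * C * D" using CD bound_nonneg by simp
  fix xs assume xs: "set xs \<subseteq> points V \<and> length xs = k + m"
  have ys: "set (take k ys) \<subseteq> points V \<and> length (take k ys) = k" "set (drop k ys) \<subseteq> points V \<and> length (drop k ys) = m"
    if "set ys \<subseteq> points V \<and> length ys = k + m" for ys
    using that set_take_subset[of k ys] set_drop_subset[of k ys] by auto
  have t: "set (take k xs) \<subseteq> points V \<and> length (take k xs) = k"
    and d: "set (drop k xs) \<subseteq> points V \<and> length (drop k xs) = m"
    by (rule ys[OF xs])+
  have mm: "A (take k ys) \<in> points V1" "B (drop k ys) \<in> points V2"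
    if "set ys \<subseteq> points V \<and> length ys = k + m" for ys
    using ys[OF that] A B by (simp_all add: bounded_multilinear_def)
  show "\<beta> (A (take k xs)) (B (drop k xs)) \<in> points W"
    by (intro mem mm xs)
  have "nrm W (\<beta> (A (take k xs)) (B (drop k xs))) \<le> K * (nrm V1 (A (take k xs)) * nrm V2 (B (drop k xs)))"
    using bound[OF mm[OF xs]] by (simp add: mult.assoc)
  also have "\<dots> \<le> K * ((C * prod_list (map (nrm V) (take k xs))) * (D * prod_list (map (nrm V) (drop k xs))))"
  proof (intro mult_left_mono mult_mono bound_nonneg)
    show "nrm V1 (A (take k xs)) \<le> C * prod_list (map (nrm V) (take k xs))"
      "nrm V2 (B (drop k xs)) \<le> D * prod_list (map (nrm V) (drop k xs))"
      using A B t d by (simp_all add: bounded_multilinear_def)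
    show "0 \<le> C * prod_list (map (nrm V) (take k xs))"
      using t CD by (intro mult_nonneg_nonneg prod_list_nonneg) (auto intro!: V.nrm_nonneg)
    show "0 \<le> nrm V2 (B (drop k xs))" by (intro V2.nrm_nonneg mm xs)
  qed
  also have "\<dots> = K * C * D * prod_list (map (nrm V) (take k xs @ drop k xs))"
    by (simp only: map_append prod_list.append ac_simps)
  finally show "nrm W (\<beta> (A (take k xs)) (B (drop k xs))) \<le> K * C * D * prod_list (map (nrm V) xs)"
    by simp
  fix i assume i: "i < k + m"
  have upd: "set (xs[i := z]) \<subseteq> points V \<and> length (xs[i := z]) = k + m" if "z \<in> points V" for z
    using xs that set_update_subset_insert[of xs i z] by auto
  consider "i < k" | j where "i = k + j" "j < m"
    using i by (metis add_less_cancel_left le_Suc_ex not_le)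
  note cases = this
  have lo: "take k (xs[i := z]) = (take k xs)[i := z]" "drop k (xs[i := z]) = drop k xs" if "i < k" for z
    using that by (simp_all add: take_update_swap)
  have hi: "take k (xs[i := z]) = take k xs" "drop k (xs[i := z]) = (drop k xs)[j := z]" if "i = k + j" for j z
    using that by (simp_all add: drop_update_swap)
  show "\<beta> (A (take k (xs[i := x + y]))) (B (drop k (xs[i := x + y]))) =
      \<beta> (A (take k (xs[i := x]))) (B (drop k (xs[i := x]))) + \<beta> (A (take k (xs[i := y]))) (B (drop k (xs[i := y])))"
    if x: "x \<in> points V" and y: "y \<in> points V" for x y
    using cases
  proof cases
    case 1
    have "A ((take k xs)[i := x + y]) = A ((take k xs)[i := x]) + A ((take k xs)[i := y])"
      using A t 1 x y by (simp add: bounded_multilinear_def)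
    then show ?thesis
      using mm[OF upd[OF x]] mm[OF upd[OF y]] by (simp add: lo 1 add_left)
  next
    case (2 j)
    have "B ((drop k xs)[j := x + y]) = B ((drop k xs)[j := x]) + B ((drop k xs)[j := y])"
      using B d 2 x y by (simp add: bounded_multilinear_def)
    then show ?thesis
      using mm[OF upd[OF x]] mm[OF upd[OF y]] by (simp only: hi[OF 2(1)] add_right)
  qed
  show "\<beta> (A (take k (xs[i := nscale V c x]))) (B (drop k (xs[i := nscale V c x]))) =
      nscale W c (\<beta> (A (take k (xs[i := x]))) (B (drop k (xs[i := x]))))"
    if x: "x \<in> points V" for c x
    using cases
  proof cases
    case 1
    have "A ((take k xs)[i := nscale V c x]) = nscale V1 c (A ((take k xs)[i := x]))"
      using A t 1 x by (simp add: bounded_multilinear_def)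
    then show ?thesis
      using mm[OF upd[OF x]] by (simp add: lo 1 scale_left)
  next
    case (2 j)
    have "B ((drop k xs)[j := nscale V c x]) = nscale V2 c (B ((drop k xs)[j := x]))"
      using B d 2 x by (simp add: bounded_multilinear_def)
    then show ?thesis
      using mm[OF upd[OF x]] by (simp only: hi[OF 2(1)] scale_right)
  qed
qed

text \<open>The terms of degree n are the products of degrees k and n - k. The limit is reached in
  two stages: products of partial sums approach the product of the values, and they approach the
  Cauchy sums as well.\<close>

lemma analytic_bilinear:
  assumes V: "normed_space_on V"
    and f: "nspace_analytic V V1 U f" and g: "nspace_analytic V V2 U g"
  shows "nspace_analytic V W U (\<lambda>x. \<beta> (f x) (g x))"
proof -
  interpret V: normed_space_on V by fact
  interpret F: two_spaces V V1 by unfold_locales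
  interpret G: two_spaces V V2 by unfold_locales
  interpret VW: two_spaces V W by unfold_locales
  show ?thesis
  proof (rule VW.analyticI)
    show "openin (ntop V) U" by (rule analyticD[OF f])
    show "(\<lambda>x. \<beta> (f x) (g x)) ` U \<subseteq> points W"
      using analyticD(2)[OF f] analyticD(2)[OF g] by (auto intro!: mem)
    fix a assume a: "a \<in> U"
    obtain r A C where ps0: "power_series_on V V1 f a r A C"
      and rU: "\<forall>h\<in>points V. nrm V h < r \<longrightarrow> a + h \<in> U"
      using F.analyticE[OF f a] by (elim exE conjE) (rule that)
    obtain s B D where qs0: "power_series_on V V2 g a s B D"
      using G.analyticE[OF g a] by (elim exE conjE) (rule that)
    define t where "t = min r s"
    have t: "t > 0" "t \<le> r" "t \<le> s" using power_series_onD(1)[OF ps0] power_series_onD(1)[OF qs0] by (auto simp: t_def)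
    have ps: "power_series_on V V1 f a t A C" using power_series_on_mono[OF ps0 t(1,2)] .
    have qs: "power_series_on V V2 g a t B D" using power_series_on_mono[OF qs0 t(1,3)] .
    note CD = power_series_on_nonneg[OF ps] power_series_on_nonneg[OF qs]
    \<comment> \<open>Symmetry of the multilinear maps is not part of the notion of a power series,
      so the first k entries can go to one factor and the rest to the other.\<close>
    define P where "P = (\<lambda>n xs. \<Sum>k\<le>n. \<beta> (A k (take k xs)) (B (n - k) (drop k xs)))"
    define E where "E = (\<lambda>n. \<Sum>k\<le>n. K * C k * D (n - k))"
    have "power_series_on V W (\<lambda>x. \<beta> (f x) (g x)) a t P E"
      unfolding power_series_on_def
    proof (intro conjI allI ballI impI t)
      show "bounded_multilinear V W n (E n) (P n)" for n
        unfolding E_def P_def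
      proof (rule VW.multilinear_sum)
        fix k assume k: "k \<in> {..n}"
        show "bounded_multilinear V W n (K * C k * D (n - k)) (\<lambda>xs. \<beta> (A k (take k xs)) (B (n - k) (drop k xs)))"
          using multilinear_prod[OF V power_series_onD(2)[OF ps, of k] power_series_onD(2)[OF qs, of "n - k"]] k
          by simp
      qed simp
      have "summable (\<lambda>n. \<Sum>k\<le>n. (C k * t ^ k) * (D (n - k) * t ^ (n - k)))"
        using power_series_onD(3)[OF ps] power_series_onD(3)[OF qs] CD t
        by (intro summable_Cauchy_product) (simp_all add: abs_mult)
      then have "summable (\<lambda>n. K * (\<Sum>k\<le>n. (C k * t ^ k) * (D (n - k) * t ^ (n - k))))"
        by (rule summable_mult)
      moreover have "K * (\<Sum>k\<le>n. (C k * t ^ k) * (D (n - k) * t ^ (n - k))) = E n * t ^ n" for n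
        unfolding E_def sum_distrib_left sum_distrib_right
        by (intro sum.cong refl) (auto simp: algebra_simps simp flip: power_add)
      ultimately show "summable (\<lambda>n. E n * t ^ n)" by simp
      fix h assume h: "h \<in> points V" "nrm V h < t"
      have fg: "f (a + h) \<in> points V1" "g (a + h) \<in> points V2"
        using analyticD(2)[OF f] analyticD(2)[OF g] rU h t by auto
      define u where "u = (\<lambda>n. A n (replicate n h))"
      define v where "v = (\<lambda>n. B n (replicate n h))"
      have m: "u n \<in> points V1" "v n \<in> points V2" for n
        unfolding u_def v_def
        using multilinear_replicate_mem[OF power_series_onD(2)[OF ps] h(1)]
          multilinear_replicate_mem[OF power_series_onD(2)[OF qs] h(1)] by simp_all
      have ht: "nrm V h ^ n \<le> t ^ n" for n using h V.nrm_nonneg by (intro power_mono) auto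
      have bu: "nrm V1 (u n) \<le> C n * t ^ n" for n
        unfolding u_def using multilinear_replicate_bound[OF power_series_onD(2)[OF ps] h(1), of n]
          mult_left_mono[OF ht CD(1), of n] by (rule order_trans)
      have bv: "nrm V2 (v n) \<le> D n * t ^ n" for n
        unfolding v_def using multilinear_replicate_bound[OF power_series_onD(2)[OF qs] h(1), of n]
          mult_left_mono[OF ht CD(2), of n] by (rule order_trans)
      have P: "P n (replicate n h) = (\<Sum>k\<le>n. \<beta> (u k) (v (n - k)))" for n
        unfolding P_def u_def v_def by (intro sum.cong refl) (simp add: take_replicate min_absorb1)
      \<comment> \<open>The uniform bound on the partial sums that \<open>bilinear_tendsto\<close>
        asks for.\<close>
      have su: "nrm V1 (\<Sum>n<N. u n) \<le> (\<Sum>n. C n * t ^ n)" for N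
      proof -
        have "nrm V1 (\<Sum>n<N. u n) \<le> (\<Sum>n<N. nrm V1 (u n))" by (intro V1.nrm_sum m)
        also have "\<dots> \<le> (\<Sum>n<N. C n * t ^ n)" by (intro sum_mono bu)
        also have "\<dots> \<le> (\<Sum>n. C n * t ^ n)"
          using CD t by (intro sum_le_suminf power_series_onD(3)[OF ps]) auto
        finally show ?thesis .
      qed
      have l1: "(\<lambda>N. nrm W (\<beta> (f (a + h)) (g (a + h)) - \<beta> (\<Sum>n<N. u n) (\<Sum>n<N. v n))) \<longlonglongrightarrow> 0"
      proof (rule bilinear_tendsto[OF _ su])
        show "(\<lambda>N. nrm V1 (f (a + h) - (\<Sum>n<N. u n))) \<longlonglongrightarrow> 0" "(\<lambda>N. nrm V2 (g (a + h) - (\<Sum>n<N. v n))) \<longlonglongrightarrow> 0"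
          using power_series_onD(4)[OF ps h] power_series_onD(4)[OF qs h] by (simp_all add: u_def v_def)
      qed (intro V1.sum_mem V2.sum_mem m fg)+
      have l2: "(\<lambda>N. nrm W (\<beta> (\<Sum>n<N. u n) (\<Sum>n<N. v n) - (\<Sum>n<N. \<Sum>k\<le>n. \<beta> (u k) (v (n - k))))) \<longlonglongrightarrow> 0"
        by (rule bilinear_Cauchy_product[OF m(1) bu _ m(2) bv]) (intro power_series_onD(3)[OF ps] power_series_onD(3)[OF qs])+
      have mW: "\<beta> (f (a + h)) (g (a + h)) \<in> points W" "\<beta> (\<Sum>n<N. u n) (\<Sum>n<N. v n) \<in> points W"
        "(\<Sum>n<N. \<Sum>k\<le>n. \<beta> (u k) (v (n - k))) \<in> points W" for N
        by (intro mem W.sum_mem V1.sum_mem V2.sum_mem m fg)+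
      show "(\<lambda>N. nrm W (\<beta> (f (a + h)) (g (a + h)) - (\<Sum>n<N. P n (replicate n h)))) \<longlonglongrightarrow> 0"
        unfolding P
      proof (rule tendsto_sandwich[OF _ _ tendsto_const tendsto_add_zero[OF l1 l2]])
        show "\<forall>\<^sub>F N in sequentially. 0 \<le> nrm W (\<beta> (f (a + h)) (g (a + h)) - (\<Sum>n<N. \<Sum>k\<le>n. \<beta> (u k) (v (n - k))))"
          by (intro always_eventually allI W.nrm_nonneg W.diff_mem mW)
        show "\<forall>\<^sub>F N in sequentially. nrm W (\<beta> (f (a + h)) (g (a + h)) - (\<Sum>n<N. \<Sum>k\<le>n. \<beta> (u k) (v (n - k))))
          \<le> nrm W (\<beta> (f (a + h)) (g (a + h)) - \<beta> (\<Sum>n<N. u n) (\<Sum>n<N. v n))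
            + nrm W (\<beta> (\<Sum>n<N. u n) (\<Sum>n<N. v n) - (\<Sum>n<N. \<Sum>k\<le>n. \<beta> (u k) (v (n - k))))"
          by (intro always_eventually allI W.nrm_diff_triangle mW)
      qed
    qed
    then show "\<exists>r A C. power_series_on V W (\<lambda>x. \<beta> (f x) (g x)) a r A C" by (intro exI)
  qed
qed

end


lemma (in two_spaces) multilinear_compose:
  assumes A: "bounded_multilinear V W n C A"
    and W': "normed_space_on W'" and L: "linear_map_on W W' L"
    and K: "0 \<le> K" "\<And>x. x \<in> points W \<Longrightarrow> nrm W' (L x) \<le> K * nrm W x"
  shows "bounded_multilinear V W' n (K * C) (\<lambda>xs. L (A xs))"
  unfolding bounded_multilinear_def
proof (intro conjI allI impI ballI)
  interpret W': normed_space_on W' by fact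
  have Lm: "L x \<in> points W'" if "x \<in> points W" for x
    using L that by (auto simp: linear_map_on_def)
  have La: "L (x + y) = L x + L y" if "x \<in> points W" "y \<in> points W" for x y
    using L that by (auto simp: linear_map_on_def)
  have Ls: "L (nscale W c x) = nscale W' c (L x)" if "x \<in> points W" for x c
    using L that by (auto simp: linear_map_on_def)
  show "0 \<le> K * C" using A K by (simp add: bounded_multilinear_def)
  fix xs assume xs: "set xs \<subseteq> points V \<and> length xs = n"
  then have m: "A xs \<in> points W" using A by (simp add: bounded_multilinear_def)
  show "L (A xs) \<in> points W'" by (intro Lm m)
  have "nrm W' (L (A xs)) \<le> K * nrm W (A xs)" by (rule K(2)[OF m])
  also have "\<dots> \<le> K * (C * prod_list (map (nrm V) xs))"
    using A xs by (intro mult_left_mono K) (simp add: bounded_multilinear_def)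
  finally show "nrm W' (L (A xs)) \<le> K * C * prod_list (map (nrm V) xs)" by (simp add: mult.assoc)
  have upd: "A (xs[i := z]) \<in> points W" if "z \<in> points V" for i z
  proof -
    have "set (xs[i := z]) \<subseteq> points V" "length (xs[i := z]) = n"
      using xs that set_update_subset_insert[of xs i z] by auto
    then show ?thesis by (rule multilinear_mem[OF A])
  qed
  show "L (A (xs[i := x + y])) = L (A (xs[i := x])) + L (A (xs[i := y]))"
    if "i < n" "x \<in> points V" "y \<in> points V" for i x y
    using A xs that by (simp add: bounded_multilinear_def upd La[symmetric])
  show "L (A (xs[i := nscale V c x])) = nscale W' c (L (A (xs[i := x])))"
    if "i < n" "x \<in> points V" for i c x
    using A xs that by (simp add: bounded_multilinear_def upd Ls[symmetric])
qed

text \<open>A bounded linear map is applied to the series term by term, and the residual norms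
  shrink with it. Evaluations, embeddings and projections that follow an analytic map are all
  handled in this way.\<close>

lemma (in two_spaces) analytic_compose_linear:
  assumes f: "nspace_analytic V W U f"
    and W': "normed_space_on W'" and L: "linear_map_on W W' L"
    and K: "\<And>x. x \<in> points W \<Longrightarrow> nrm W' (L x) \<le> K * nrm W x"
  shows "nspace_analytic V W' U (\<lambda>x. L (f x))"
proof -
  interpret W': normed_space_on W' by fact
  interpret VW': two_spaces V W' by unfold_locales
  have Lm: "L x \<in> points W'" if "x \<in> points W" for x
    using L that by (auto simp: linear_map_on_def)
  have La: "L (x + y) = L x + L y" if "x \<in> points W" "y \<in> points W" for x y
    using L that by (auto simp: linear_map_on_def)
  have L0: "L 0 = 0" using La[OF W.zero_mem W.zero_mem] by simp
  have Ld: "L (x - y) = L x - L y" if "x \<in> points W" "y \<in> points W" for x y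
    using La[of "x - y" y] that W.diff_mem by simp
  have Lsum: "L (sum p I) = (\<Sum>i\<in>I. L (p i))" if "\<And>i. p i \<in> points W" for p :: "nat \<Rightarrow> 'w" and I
    by (induction I rule: infinite_finite_induct) (simp_all add: L0 La that W.sum_mem)
  have K': "nrm W' (L x) \<le> \<bar>K\<bar> * nrm W x" if "x \<in> points W" for x
    using K[OF that] W.nrm_nonneg[OF that] by (meson abs_ge_self mult_right_mono order_trans)
  show ?thesis
  proof (rule VW'.analyticI)
    show "openin (ntop V) U" by (rule analyticD[OF f])
    show "(\<lambda>x. L (f x)) ` U \<subseteq> points W'" using analyticD(2)[OF f] Lm by auto
    fix a assume a: "a \<in> U"
    obtain r A C where ps: "power_series_on V W f a r A C"
      and rU: "\<forall>h\<in>points V. nrm V h < r \<longrightarrow> a + h \<in> U"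
      using analyticE[OF f a] by (elim exE conjE) (rule that)
    have "power_series_on V W' (\<lambda>x. L (f x)) a r (\<lambda>n xs. L (A n xs)) (\<lambda>n. \<bar>K\<bar> * C n)"
      unfolding power_series_on_def
    proof (intro conjI allI ballI impI power_series_onD(1)[OF ps])
      show "bounded_multilinear V W' n (\<bar>K\<bar> * C n) (\<lambda>xs. L (A n xs))" for n
        by (rule multilinear_compose[OF power_series_onD(2)[OF ps] W' L _ K']) auto
      show "summable (\<lambda>n. \<bar>K\<bar> * C n * r ^ n)"
        unfolding mult.assoc by (intro summable_mult power_series_onD(3)[OF ps])
      fix h assume h: "h \<in> points V" "nrm V h < r"
      have fm: "f (a + h) \<in> points W" using analyticD(2)[OF f] rU h by auto
      have m: "A n (replicate n h) \<in> points W" for n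
        using multilinear_replicate_mem[OF power_series_onD(2)[OF ps] h(1)] .
      have d: "f (a + h) - (\<Sum>n<N. A n (replicate n h)) \<in> points W" for N
        by (intro W.diff_mem W.sum_mem fm m)
      have e: "L (f (a + h)) - (\<Sum>n<N. L (A n (replicate n h))) = L (f (a + h) - (\<Sum>n<N. A n (replicate n h)))" for N
        by (simp add: Lsum m Ld fm W.sum_mem)
      have lim: "(\<lambda>N. \<bar>K\<bar> * nrm W (f (a + h) - (\<Sum>n<N. A n (replicate n h)))) \<longlonglongrightarrow> 0"
        by (rule tendsto_mult_right_zero[OF power_series_onD(4)[OF ps h]])
      show "(\<lambda>N. nrm W' (L (f (a + h)) - (\<Sum>n<N. L (A n (replicate n h))))) \<longlonglongrightarrow> 0"
        unfolding e
        by (rule tendsto_sandwich[OF _ _ tendsto_const lim])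
          (intro always_eventually allI W'.nrm_nonneg Lm d, intro always_eventually allI K' d)
    qed
    then show "\<exists>r A C. power_series_on V W' (\<lambda>x. L (f x)) a r A C" by (intro exI)
  qed
qed

section \<open>Inversion of power series\<close>

text \<open>The formal inverse of the series \<open>A 0 + A 1 + \<dots>\<close>, where \<open>g0\<close> plays the role of \<open>(A 0)\<^sup>-\<^sup>1\<close>.\<close>

fun inverse_coeff :: "('w::ab_group_add \<Rightarrow> 'w \<Rightarrow> 'w) \<Rightarrow> (nat \<Rightarrow> 'v list \<Rightarrow> 'w) \<Rightarrow> 'w \<Rightarrow> nat \<Rightarrow> 'v list \<Rightarrow> 'w" where
  "inverse_coeff \<beta> A g0 0 xs = g0"
| "inverse_coeff \<beta> A g0 (Suc n) xs =
     - \<beta> g0 (\<Sum>k\<le>n. \<beta> (A (Suc k) (take (Suc k) xs)) (inverse_coeff \<beta> A g0 (n - k) (drop (Suc k) xs)))"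

text \<open>The majorant of \<open>inverse_coeff\<close> in an algebra with submultiplicative norm:
  C bounds the multilinear maps and K the norm of \<open>g0\<close>.\<close>

fun inverse_bound :: "(nat \<Rightarrow> real) \<Rightarrow> real \<Rightarrow> nat \<Rightarrow> real" where
  "inverse_bound C K 0 = K"
| "inverse_bound C K (Suc n) = K * (\<Sum>k\<le>n. C (Suc k) * inverse_bound C K (n - k))"

lemma inverse_bound_nonneg: "\<lbrakk>\<And>n. 0 \<le> C n; 0 \<le> K\<rbrakk> \<Longrightarrow> 0 \<le> inverse_bound C K n"
  by (induction n rule: less_induct) (case_tac x; auto intro!: sum_nonneg mult_nonneg_nonneg)

text \<open>With X the sum of the tail, the partial sums satisfy
  \<open>Y (Suc N) \<le> K + K * X * Y N\<close>. Since \<open>K * X \<le> 1/2\<close>, the bound 2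
  * K reproduces itself.\<close>

lemma inverse_bound_summable:
  assumes C: "\<And>n. 0 \<le> C n" and K: "0 \<le> K" and r: "0 \<le> r"
    and sm: "summable (\<lambda>n. C (Suc n) * r ^ Suc n)" and half: "K * (\<Sum>n. C (Suc n) * r ^ Suc n) \<le> 1/2"
  shows "summable (\<lambda>n. inverse_bound C K n * r ^ n)"
proof (rule summableI_nonneg_bounded)
  define x where "x = (\<lambda>n. C (Suc n) * r ^ Suc n)"
  define y where "y = (\<lambda>n. inverse_bound C K n * r ^ n)"
  have smx: "summable x" using sm by (simp only: x_def)
  have x: "x n \<ge> 0" and y: "y n \<ge> 0" for n
    using C K r inverse_bound_nonneg[of C K] by (simp_all add: x_def y_def)
  have rec: "y (Suc n) = K * (\<Sum>k\<le>n. x k * y (n - k))" for n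
    unfolding x_def y_def inverse_bound.simps sum_distrib_left sum_distrib_right
    by (intro sum.cong refl) (auto simp: algebra_simps simp flip: power_add power_Suc)
  have bd: "(\<Sum>n<N. y n) \<le> 2 * K" for N
  proof (induction N)
    case (Suc N)
    have "(\<Sum>n<Suc N. y n) = K + K * (\<Sum>n<N. \<Sum>k\<le>n. x k * y (n - k))"
      unfolding sum.lessThan_Suc_shift rec sum_distrib_left by (simp add: y_def)
    also have "(\<Sum>n<N. \<Sum>k\<le>n. x k * y (n - k)) = (\<Sum>(i,j)\<in>{(i,j). i + j < N}. x i * y j)"
      by (rule sum.triangle_reindex[symmetric])
    \<comment> \<open>Enlarging the triangle to the square separates the two sums, so that the
      induction hypothesis applies to the second.\<close>
    also have "\<dots> \<le> (\<Sum>(i,j)\<in>{..<N} \<times> {..<N}. x i * y j)"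
      using x y by (intro sum_mono2) auto
    also have "\<dots> = (\<Sum>n<N. x n) * (\<Sum>n<N. y n)"
      by (simp add: sum_product sum.cartesian_product)
    also have "\<dots> \<le> (\<Sum>n. x n) * (2 * K)"
      using smx x y Suc by (intro mult_mono sum_le_suminf sum_nonneg suminf_nonneg) auto
    also have "K + K * ((\<Sum>n. x n) * (2 * K)) = K + (K * (\<Sum>n. x n)) * (2 * K)" by simp
    also have "\<dots> \<le> K + 1/2 * (2 * K)"
      using half K by (intro add_left_mono mult_right_mono) (auto simp: x_def)
    finally show ?case using K by (simp add: mult_left_mono)
  qed (use K in simp)
  show "0 \<le> inverse_bound C K n * r ^ n" for n using y[of n] by (simp add: y_def)
  show "(\<Sum>n<N. inverse_bound C K n * r ^ n) \<le> 2 * K" for N using bd[of N] by (simp add: y_def)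
qed

text \<open>The constant 1 expresses submultiplicativity. Inversion is stated through a resolvent
  identity with explicit bracketing and so uses just this much of an algebra.\<close>

locale normed_algebra_on = bilinear_on W W W \<beta> 1
  for W :: "('k::real_normed_field, 'w::ab_group_add) nspace" and \<beta> :: "'w \<Rightarrow> 'w \<Rightarrow> 'w"
begin

lemma linear_left_mult_neg: "x \<in> points W \<Longrightarrow> linear_map_on W W (\<lambda>y. - \<beta> x y)"
  by (auto simp: linear_map_on_def add_right scale_right mem V1.uminus_mem V1.smult_mem V1.smult_smult
      simp flip: V1.smult_minus_one)

lemma bound': "\<lbrakk>x \<in> points W; y \<in> points W\<rbrakk> \<Longrightarrow> nrm W (\<beta> x y) \<le> nrm W x * nrm W y"
  using bound by simp

lemma inverse_coeff_multilinear:
  assumes V: "normed_space_on V" and A: "\<And>n. bounded_multilinear V W n (C n) (A n)" and g0: "g0 \<in> points W"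
  shows "bounded_multilinear V W n (inverse_bound C (nrm W g0) n) (inverse_coeff \<beta> A g0 n)"
proof (induction n rule: less_induct)
  case (less n)
  interpret V: normed_space_on V by fact
  interpret VW: two_spaces V W by unfold_locales
  show ?case
  proof (cases n)
    case 0
    then show ?thesis using g0 V1.nrm_nonneg by (simp add: bounded_multilinear_def)
  next
    case (Suc m)
    have "bounded_multilinear V W n (\<Sum>k\<le>m. C (Suc k) * inverse_bound C (nrm W g0) (m - k))
        (\<lambda>xs. \<Sum>k\<le>m. \<beta> (A (Suc k) (take (Suc k) xs)) (inverse_coeff \<beta> A g0 (m - k) (drop (Suc k) xs)))"
    proof (rule VW.multilinear_sum)
      fix k assume "k \<in> {..m}"
      then show "bounded_multilinear V W n (C (Suc k) * inverse_bound C (nrm W g0) (m - k))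
        (\<lambda>xs. \<beta> (A (Suc k) (take (Suc k) xs)) (inverse_coeff \<beta> A g0 (m - k) (drop (Suc k) xs)))"
        using multilinear_prod[OF V A[of "Suc k"] less.IH[of "m - k"]] Suc by simp
    qed simp
    then have "bounded_multilinear V W n (nrm W g0 * (\<Sum>k\<le>m. C (Suc k) * inverse_bound C (nrm W g0) (m - k)))
        (\<lambda>xs. - \<beta> g0 (\<Sum>k\<le>m. \<beta> (A (Suc k) (take (Suc k) xs)) (inverse_coeff \<beta> A g0 (m - k) (drop (Suc k) xs))))"
      by (rule VW.multilinear_compose[OF _ V1.normed_space_on_axioms linear_left_mult_neg[OF g0]])
        (simp_all add: V1.nrm_nonneg g0 V1.nrm_minus mem bound')
    then show ?thesis by (simp add: Suc)
  qed
qed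

text \<open>The resolvent identity holds for inverses and equally for generalized inverses, where
  products of f and g are only projections. The partial sums of the formal inverse satisfy the same
  identity up to a truncated Cauchy product. The error R therefore obeys
  \<open>|R| \<le> K |d| |R| + o(1)\<close> with d = f x - f a, and on a ball where
  \<open>K |d| \<le> 1/2\<close> the first term can be absorbed.\<close>

lemma analytic_pseudo_inverse:
  assumes V: "normed_space_on V" and f: "nspace_analytic V W U f" and g: "\<And>x. x \<in> U \<Longrightarrow> g x \<in> points W"
    and resolvent: "\<And>a x. \<lbrakk>a \<in> U; x \<in> U\<rbrakk> \<Longrightarrow> g x = g a - \<beta> (g a) (\<beta> (f x - f a) (g x))"
  shows "nspace_analytic V W U g"
proof -
  interpret V: normed_space_on V by fact
  interpret VW: two_spaces V W by unfold_locales
  show ?thesis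
  proof (rule VW.analyticI)
    show "openin (ntop V) U" by (rule analyticD[OF f])
    show "g ` U \<subseteq> points W" using g by auto
    fix a assume a: "a \<in> U"
    obtain r0 A C where ps0: "power_series_on V W f a r0 A C"
      and rU: "\<forall>h\<in>points V. nrm V h < r0 \<longrightarrow> a + h \<in> U"
      using VW.analyticE[OF f a] by (elim exE conjE) (rule that)
    define K where "K = nrm W (g a)"
    have K: "K \<ge> 0" using V1.nrm_nonneg g a by (simp add: K_def)
    have C: "0 \<le> C n" for n by (rule power_series_on_nonneg[OF ps0])
    have r0: "r0 > 0" by (rule power_series_onD(1)[OF ps0])
    define X where "X = (\<lambda>r. \<Sum>n. C (Suc n) * r ^ Suc n)"
    have "X r0 \<ge> 0"
      using r0 C VW.power_series_tail_bound(1)[OF ps0, of 1] unfolding X_def by (intro suminf_nonneg) auto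
    then have KX: "K * X r0 \<ge> 0" using K by simp
    \<comment> \<open>Chosen so that the tail at radius \<open>t * r0\<close> satisfies
      \<open>K * X r \<le> 1/2\<close>.\<close>
    define t where "t = 1 / (2 * (K * X r0 + 1))"
    have t: "0 < t" "t \<le> 1" using KX by (auto simp: t_def field_simps)
    define r where "r = t * r0"
    have r: "0 < r" "r \<le> r0" using t r0 by (auto simp: r_def mult_le_cancel_right1)
    have ps: "power_series_on V W f a r A C" by (rule power_series_on_mono[OF ps0 r])
    have smr: "summable (\<lambda>n. C (Suc n) * r ^ Suc n)"
      using VW.power_series_tail_bound(1)[OF ps, of 1] by simp
    have "X r \<le> t * X r0"
      unfolding X_def r_def using t by (intro VW.power_series_tail_bound(2)[OF ps0]) auto
    then have "K * X r \<le> t * (K * X r0)"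
      using K by (metis mult.left_commute mult_left_mono)
    also have "\<dots> \<le> 1/2" using KX by (simp add: t_def field_simps)
    finally have half: "K * X r \<le> 1/2" .
    let ?I = "inverse_coeff \<beta> A (g a)"
    let ?D = "inverse_bound C K"
    have mI: "bounded_multilinear V W n (?D n) (?I n)" for n
      unfolding K_def by (rule inverse_coeff_multilinear[OF V power_series_onD(2)[OF ps] g[OF a]])
    have smD: "summable (\<lambda>n. ?D n * r ^ n)"
      using C K r smr half by (intro inverse_bound_summable) (auto simp: X_def)
    have D: "?D n \<ge> 0" for n by (rule inverse_bound_nonneg[OF C K])
    have "power_series_on V W g a r ?I ?D"
      unfolding power_series_on_def
    proof (intro conjI allI ballI impI r mI smD)
      fix h assume h: "h \<in> points V" "nrm V h < r"
      define x where "x = a + h"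
      have x: "x \<in> U" using rU h r by (simp add: x_def)
      have fx: "f x \<in> points W" "f a \<in> points W" and gx: "g x \<in> points W" "g a \<in> points W"
        using analyticD(2)[OF f] g x a by auto
      define d where "d = f x - f a"
      have d: "d \<in> points W" using fx by (simp add: d_def V1.diff_mem)
      have fa: "f a = A 0 []"
        by (rule VW.power_series_increment(2)[OF ps _ _ h]) (use fx in \<open>simp_all add: x_def\<close>)
      have nd: "nrm W d \<le> X r"
      proof -
        have "nrm W d \<le> (\<Sum>n. C (Suc n) * nrm V h ^ Suc n)"
          using VW.power_series_increment(1)[OF ps _ _ h] fx by (simp add: d_def x_def)
        also have "\<dots> \<le> X r"
          unfolding X_def
        proof (rule suminf_le)
          show le: "C (Suc n) * nrm V h ^ Suc n \<le> C (Suc n) * r ^ Suc n" for n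
            using h V.nrm_nonneg[OF h(1)] C by (intro mult_left_mono power_mono) auto
          show "summable (\<lambda>n. C (Suc n) * r ^ Suc n)" by (rule smr)
          show "summable (\<lambda>n. C (Suc n) * nrm V h ^ Suc n)"
            by (rule summable_comparison_test'[OF smr, where N = 0])
              (use le V.nrm_nonneg[OF h(1)] C in \<open>auto simp del: power_Suc simp: abs_of_nonneg\<close>)
        qed
        finally show ?thesis .
      qed
      have Kd: "K * nrm W d \<le> 1/2" using mult_left_mono[OF nd K] half by simp
      \<comment> \<open>The series of the increment d: the constant term \<open>f a\<close> is
        removed.\<close>
      define u where "u = (\<lambda>n. if n = 0 then 0 else A n (replicate n h))"
      define v where "v = (\<lambda>n. ?I n (replicate n h))"
      have ht: "nrm V h ^ n \<le> r ^ n" for n using h V.nrm_nonneg by (intro power_mono) auto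
      have u: "u n \<in> points W" for n
        using multilinear_replicate_mem[OF power_series_onD(2)[OF ps] h(1)] by (simp add: u_def V1.zero_mem)
      have v: "v n \<in> points W" for n
        using multilinear_replicate_mem[OF mI h(1)] by (simp add: v_def)
      have bu: "nrm W (u n) \<le> C n * r ^ n" for n
        using multilinear_replicate_bound[OF power_series_onD(2)[OF ps] h(1), of n]
          mult_left_mono[OF ht C, of n n] C r by (simp add: u_def)
      have bv: "nrm W (v n) \<le> ?D n * r ^ n" for n
        unfolding v_def using multilinear_replicate_bound[OF mI h(1), of n]
          mult_left_mono[OF ht D, of n n] by (rule order_trans)
      define dN where "dN = (\<lambda>N. \<Sum>n<N. u n)"
      define S where "S = (\<lambda>N. \<Sum>n<N. v n)"
      define T where "T = (\<lambda>N. \<Sum>n<N. \<Sum>k\<le>n. \<beta> (u k) (v (n - k)))"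
      have dN: "dN N \<in> points W" and S: "S N \<in> points W" and T: "T N \<in> points W" for N
        unfolding dN_def S_def T_def by (intro V1.sum_mem mem u v)+
      define M where "M = (\<Sum>n. ?D n * r ^ n)"
      have SM: "nrm W (S N) \<le> M" for N
      proof -
        have "nrm W (S N) \<le> (\<Sum>n<N. nrm W (v n))" unfolding S_def by (intro V1.nrm_sum v)
        also have "\<dots> \<le> (\<Sum>n<N. ?D n * r ^ n)" by (intro sum_mono bv)
        also have "\<dots> \<le> M"
          unfolding M_def using D r by (intro sum_le_suminf smD) auto
        finally show ?thesis .
      qed
      have dNlim: "(\<lambda>N. nrm W (d - dN N)) \<longlonglongrightarrow> 0"
      proof (rule LIMSEQ_imp_Suc)
        have "d - dN (Suc N) = f (a + h) - (\<Sum>n<Suc N. A n (replicate n h))" for N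
          unfolding dN_def sum.lessThan_Suc_shift by (simp add: d_def x_def u_def fa)
        then show "(\<lambda>N. nrm W (d - dN (Suc N))) \<longlonglongrightarrow> 0"
          using LIMSEQ_Suc[OF power_series_onD(4)[OF ps h]] by simp
      qed
      have Tlim: "(\<lambda>N. nrm W (\<beta> (dN N) (S N) - T N)) \<longlonglongrightarrow> 0"
        unfolding dN_def S_def T_def
        by (rule bilinear_Cauchy_product[OF u bu _ v bv]) (intro power_series_onD(3)[OF ps] smD)+
      \<comment> \<open>As \<open>u 0 = 0\<close>, the sum \<open>T (Suc N)\<close> contains
        \<open>v\<close> only up to degree N - 1, which is exactly what the recursion needs to
        produce the degrees up to N.\<close>
      have Srec: "S (Suc N) = g a - \<beta> (g a) (T (Suc N))" for N
      proof -
        have "T (Suc N) = (\<Sum>n<N. \<Sum>k\<le>n. \<beta> (u (Suc k)) (v (n - k)))"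
          unfolding T_def sum.lessThan_Suc_shift sum.atMost_Suc_shift
          using v by (simp add: u_def)
        moreover have "v (Suc n) = - \<beta> (g a) (\<Sum>k\<le>n. \<beta> (u (Suc k)) (v (n - k)))" for n
          unfolding v_def u_def inverse_coeff.simps
          by (intro arg_cong[where f = "\<lambda>z. - \<beta> (g a) z"] sum.cong refl)
            (simp add: take_replicate min_absorb1 drop_replicate del: replicate_Suc)
        ultimately show ?thesis
          unfolding S_def sum.lessThan_Suc_shift
          using u v by (simp add: sum_right gx V1.sum_mem mem sum_negf) (simp add: v_def)
      qed
      \<comment> \<open>The factor 2 is the price of moving half of \<open>nrm W R\<close> to the
        left-hand side.\<close>
      define B where "B = (\<lambda>N. 2 * K * (nrm W (d - dN N) * M + nrm W (\<beta> (dN N) (S N) - T N)))"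
      have Blim: "B \<longlonglongrightarrow> 0"
        unfolding B_def using dNlim Tlim by (auto intro!: tendsto_eq_intros)
      have le: "nrm W (g x - S (Suc N)) \<le> B (Suc N)" for N
      proof -
        let ?N = "Suc N"
        define R where "R = g x - S ?N"
        have R: "R \<in> points W" using gx S by (simp add: R_def V1.diff_mem)
        have "R = (g a - \<beta> (g a) (\<beta> d (g x))) - (g a - \<beta> (g a) (T ?N))"
          by (simp only: R_def Srec[of N] d_def resolvent[OF a x, symmetric])
        also have "\<dots> = - \<beta> (g a) (\<beta> d (g x) - T ?N)"
          using gx d T mem[OF d gx(1)] by (simp add: diff_right)
        finally have "R = - \<beta> (g a) (\<beta> d (g x) - T ?N)" .
        then have "nrm W R \<le> K * nrm W (\<beta> d (g x) - T ?N)"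
          using bound'[OF gx(2), of "\<beta> d (g x) - T ?N"] gx d T mem[OF d gx(1)]
          by (simp add: K_def V1.nrm_minus mem V1.diff_mem)
        \<comment> \<open>Three errors: the one to be absorbed, the truncation of d, and the defect
          of the Cauchy product.\<close>
        also have "\<beta> d (g x) - T ?N = \<beta> d R + (\<beta> (d - dN ?N) (S ?N) + (\<beta> (dN ?N) (S ?N) - T ?N))"
          using d gx S dN by (simp add: R_def diff_right diff_left)
        also have "nrm W \<dots> \<le> nrm W (\<beta> d R) + (nrm W (\<beta> (d - dN ?N) (S ?N)) + nrm W (\<beta> (dN ?N) (S ?N) - T ?N))"
          by (intro order_trans[OF V1.nrm_triangle] add_mono order_refl V1.nrm_triangle)
            (intro mem V1.add_mem V1.diff_mem d R dN S T)+
        also have "\<dots> \<le> nrm W d * nrm W R + (nrm W (d - dN ?N) * M + nrm W (\<beta> (dN ?N) (S ?N) - T ?N))"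
        proof (intro add_mono order_refl bound' d R)
          have "nrm W (\<beta> (d - dN ?N) (S ?N)) \<le> nrm W (d - dN ?N) * nrm W (S ?N)"
            by (intro bound' V1.diff_mem d dN S)
          also have "\<dots> \<le> nrm W (d - dN ?N) * M"
            by (intro mult_left_mono SM V1.nrm_nonneg V1.diff_mem d dN)
          finally show "nrm W (\<beta> (d - dN ?N) (S ?N)) \<le> nrm W (d - dN ?N) * M" .
        qed
        finally have "nrm W R \<le> K * (nrm W d * nrm W R + (nrm W (d - dN ?N) * M + nrm W (\<beta> (dN ?N) (S ?N) - T ?N)))"
          using K by (simp add: mult_left_mono)
        also have "\<dots> = (K * nrm W d) * nrm W R + K * (nrm W (d - dN ?N) * M + nrm W (\<beta> (dN ?N) (S ?N) - T ?N))"
          by (simp add: algebra_simps)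
        also have "(K * nrm W d) * nrm W R \<le> 1/2 * nrm W R"
          by (intro mult_right_mono Kd V1.nrm_nonneg R)
        finally show ?thesis by (simp add: B_def R_def)
      qed
      show "(\<lambda>N. nrm W (g (a + h) - (\<Sum>n<N. ?I n (replicate n h)))) \<longlonglongrightarrow> 0"
      proof (rule LIMSEQ_imp_Suc, rule tendsto_sandwich[OF _ _ tendsto_const LIMSEQ_Suc[OF Blim]])
        show "\<forall>\<^sub>F N in sequentially. nrm W (g (a + h) - (\<Sum>n<Suc N. ?I n (replicate n h))) \<le> B (Suc N)"
          using le unfolding S_def v_def x_def by (intro always_eventually allI)
        show "\<forall>\<^sub>F N in sequentially. 0 \<le> nrm W (g (a + h) - (\<Sum>n<Suc N. ?I n (replicate n h)))"
          using gx S unfolding S_def v_def x_def by (intro always_eventually allI V1.nrm_nonneg V1.diff_mem)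
      qed
    qed
    then show "\<exists>r A C. power_series_on V W g a r A C" by (intro exI)
  qed
qed

end

lemma points_prod [simp]: "points (prod_nspace V W) = points V \<times> points W"
  by (simp add: prod_nspace_def)

lemma nscale_prod [simp]: "nscale (prod_nspace V W) c (x, y) = (nscale V c x, nscale W c y)"
  by (simp add: prod_nspace_def)

lemma nrm_prod [simp]: "nrm (prod_nspace V W) (x, y) = max (nrm V x) (nrm W y)"
  by (simp add: prod_nspace_def)

text \<open>The pair is the sum of f and g after the embeddings of the two factors, so sums and
  linear images suffice.\<close>

lemma analytic_Pair:
  assumes V: "normed_space_on V" and W: "normed_space_on W" and Z: "normed_space_on Z"
    and f: "nspace_analytic V W U f" and g: "nspace_analytic V Z U g"
  shows "nspace_analytic V (prod_nspace W Z) U (\<lambda>x. (f x, g x))"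
proof -
  interpret V: normed_space_on V by fact
  interpret W: normed_space_on W by fact
  interpret Z: normed_space_on Z by fact
  interpret P: normed_space_on "prod_nspace W Z" by (rule normed_prod_nspace) fact+
  interpret VW: two_spaces V W by unfold_locales
  interpret VZ: two_spaces V Z by unfold_locales
  interpret VP: two_spaces V "prod_nspace W Z" by unfold_locales
  have 1: "nspace_analytic V (prod_nspace W Z) U (\<lambda>x. (f x, 0))"
    by (rule VW.analytic_compose_linear[OF f P.normed_space_on_axioms, of "\<lambda>y. (y, 0)" 1])
      (auto simp: linear_map_on_def Z.zero_mem W.nrm_nonneg)
  have 2: "nspace_analytic V (prod_nspace W Z) U (\<lambda>x. (0, g x))"
    by (rule VZ.analytic_compose_linear[OF g P.normed_space_on_axioms, of "\<lambda>y. (0, y)" 1])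
      (auto simp: linear_map_on_def W.zero_mem Z.nrm_nonneg)
  show ?thesis
    by (rule VP.analytic_cong[OF VP.analytic_add[OF 1 2]]) simp
qed

section \<open>Spaces of operators\<close>

context two_spaces begin

lemma opnorm_bdd:
  assumes "\<forall>x\<in>points V. nrm W (T x) \<le> C * nrm V x"
  shows "bdd_above ((\<lambda>x. nrm W (T x)) ` {x \<in> points V. nrm V x \<le> 1})"
proof (rule bdd_aboveI2)
  fix x assume x: "x \<in> {x \<in> points V. nrm V x \<le> 1}"
  then have "nrm W (T x) \<le> C * nrm V x" using assms by simp
  also have "\<dots> \<le> \<bar>C\<bar> * 1" using x V.nrm_nonneg by (intro mult_mono) auto
  finally show "nrm W (T x) \<le> \<bar>C\<bar>" by simp
qed

lemma opnorm_least:
  assumes "0 \<le> C" "\<And>x. x \<in> points V \<Longrightarrow> nrm W (T x) \<le> C * nrm V x"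
  shows "opnorm V W T \<le> C"
  unfolding opnorm_def
proof (rule cSUP_least)
  show "{x \<in> points V. nrm V x \<le> 1} \<noteq> {}" using V.zero_mem by force
  fix x assume x: "x \<in> {x \<in> points V. nrm V x \<le> 1}"
  then have "nrm W (T x) \<le> C * nrm V x" using assms by simp
  also have "\<dots> \<le> C * 1" using x assms by (intro mult_left_mono) auto
  finally show "nrm W (T x) \<le> C" by simp
qed

lemma opnorm_nonneg:
  assumes "linear_map_on V W T" "\<forall>x\<in>points V. nrm W (T x) \<le> C * nrm V x"
  shows "0 \<le> opnorm V W T"
proof -
  have "T 0 \<in> points W" using assms(1) V.zero_mem by (auto simp: linear_map_on_def)
  then have "0 \<le> nrm W (T 0)" by (rule W.nrm_nonneg)
  also have "\<dots> \<le> opnorm V W T"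
    unfolding opnorm_def using V.zero_mem by (intro cSUP_upper opnorm_bdd[OF assms(2)]) auto
  finally show ?thesis .
qed

lemma opnorm_bound:
  assumes T: "linear_map_on V W T" "\<forall>x\<in>points V. nrm W (T x) \<le> C * nrm V x" and x: "x \<in> points V"
  shows "nrm W (T x) \<le> opnorm V W T * nrm V x"
proof (cases "x = 0")
  case True
  then show ?thesis using T(2) V.zero_mem by fastforce
next
  case False
  then have pos: "nrm V x > 0" using V.nrm_eq_0[OF x] V.nrm_nonneg[OF x] by simp
  \<comment> \<open>The operator norm is a supremum over the unit ball, so x is normalized by a real
    scalar viewed in the field.\<close>
  define c :: 'k where "c = of_real (1 / nrm V x)"
  have nc: "norm c = 1 / nrm V x" unfolding c_def norm_of_real using pos by simp
  have "nrm W (T (nscale V c x)) \<le> opnorm V W T"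
    unfolding opnorm_def
    using x pos by (intro cSUP_upper opnorm_bdd[OF T(2)]) (simp add: V.smult_mem V.nrm_smult nc)
  moreover have "T (nscale V c x) = nscale W c (T x)" "T x \<in> points W"
    using T(1) x by (auto simp: linear_map_on_def)
  ultimately show ?thesis using pos by (simp add: W.nrm_smult nc field_simps)
qed

lemma opnorm_cong: "(\<And>x. x \<in> points V \<Longrightarrow> T x = S x) \<Longrightarrow> opnorm V W T = opnorm V W S"
  unfolding opnorm_def by (intro SUP_cong) auto

lemma bounded_opsI:
  assumes "\<And>x. x \<notin> points V \<Longrightarrow> T x = 0" "\<And>x. x \<in> points V \<Longrightarrow> T x \<in> points W"
    "\<And>x y. \<lbrakk>x \<in> points V; y \<in> points V\<rbrakk> \<Longrightarrow> T (x + y) = T x + T y"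
    "\<And>c x. x \<in> points V \<Longrightarrow> T (nscale V c x) = nscale W c (T x)"
    "\<And>x. x \<in> points V \<Longrightarrow> nrm W (T x) \<le> C * nrm V x"
  shows "T \<in> points (bounded_ops V W)"
  using assms by (auto simp: bounded_ops_def linear_map_on_def intro!: exI[of _ C])

lemma bounded_opsD:
  assumes "T \<in> points (bounded_ops V W)"
  shows "x \<notin> points V \<Longrightarrow> T x = 0" "x \<in> points V \<Longrightarrow> T x \<in> points W"
    "\<lbrakk>x \<in> points V; y \<in> points V\<rbrakk> \<Longrightarrow> T (x + y) = T x + T y"
    "x \<in> points V \<Longrightarrow> T (nscale V c x) = nscale W c (T x)"
    "x \<in> points V \<Longrightarrow> nrm W (T x) \<le> nrm (bounded_ops V W) T * nrm V x"
    "linear_map_on V W T"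
proof -
  have T: "linear_map_on V W T" "\<forall>x. x \<notin> points V \<longrightarrow> T x = 0" "\<exists>C. \<forall>x\<in>points V. nrm W (T x) \<le> C * nrm V x"
    using assms by (auto simp: bounded_ops_def)
  then show "x \<notin> points V \<Longrightarrow> T x = 0" "x \<in> points V \<Longrightarrow> T x \<in> points W"
    "\<lbrakk>x \<in> points V; y \<in> points V\<rbrakk> \<Longrightarrow> T (x + y) = T x + T y"
    "x \<in> points V \<Longrightarrow> T (nscale V c x) = nscale W c (T x)" "linear_map_on V W T"
    by (auto simp: linear_map_on_def)
  show "x \<in> points V \<Longrightarrow> nrm W (T x) \<le> nrm (bounded_ops V W) T * nrm V x"
    using opnorm_bound[OF T(1)] T(3) by (auto simp: bounded_ops_def)
qed

lemma nrm_bounded_ops_least: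
  "\<lbrakk>0 \<le> C; \<And>x. x \<in> points V \<Longrightarrow> nrm W (T x) \<le> C * nrm V x\<rbrakk> \<Longrightarrow> nrm (bounded_ops V W) T \<le> C"
  by (simp add: bounded_ops_def opnorm_least)

lemma nrm_bounded_ops_nonneg: "T \<in> points (bounded_ops V W) \<Longrightarrow> 0 \<le> nrm (bounded_ops V W) T"
  by (auto simp: bounded_ops_def intro: opnorm_nonneg)

lemma nscale_bounded_ops: "nscale (bounded_ops V W) c T = (\<lambda>x. nscale W c (T x))"
  by (simp add: bounded_ops_def)

lemma normed_bounded_ops: "normed_space_on (bounded_ops V W)"
proof
  let ?B = "bounded_ops V W"
  show zero: "0 \<in> points ?B"
    by (rule bounded_opsI[where C = 0]) (auto simp: W.zero_mem)
  show add: "S + T \<in> points ?B" if "S \<in> points ?B" "T \<in> points ?B" for S T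
  proof (rule bounded_opsI[where C = "nrm ?B S + nrm ?B T"])
    fix x assume x: "x \<in> points V"
    show "nrm W ((S + T) x) \<le> (nrm ?B S + nrm ?B T) * nrm V x"
      using W.nrm_triangle[OF bounded_opsD(2)[OF that(1) x] bounded_opsD(2)[OF that(2) x]]
        bounded_opsD(5)[OF that(1) x] bounded_opsD(5)[OF that(2) x]
      by (simp add: distrib_right)
  qed (use that in \<open>auto simp: bounded_opsD W.add_mem W.smult_add_right\<close>)
  show smul: "nscale ?B c T \<in> points ?B" if "T \<in> points ?B" for c T
    unfolding nscale_bounded_ops
  proof (rule bounded_opsI[where C = "norm c * nrm ?B T"])
    fix x assume x: "x \<in> points V"
    show "nrm W (nscale W c (T x)) \<le> norm c * nrm ?B T * nrm V x"
      using bounded_opsD(2,5)[OF that x] by (simp add: W.nrm_smult mult_left_mono mult.assoc)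
  qed (use that in \<open>auto simp: bounded_opsD W.smult_mem W.smult_add_right W.smult_smult mult.commute\<close>)
  fix S T and c d :: 'k assume T: "T \<in> points ?B"
  have Tm: "T x \<in> points W" for x
    using bounded_opsD(1,2)[OF T] W.zero_mem by (cases "x \<in> points V") auto
  show "nscale ?B (c + d) T = nscale ?B c T + nscale ?B d T"
    "nscale ?B c (nscale ?B d T) = nscale ?B (c * d) T" "nscale ?B 1 T = T"
    by (auto simp: nscale_bounded_ops fun_eq_iff W.smult_add_left W.smult_smult W.smult_one Tm)
  show "0 \<le> nrm ?B T" by (rule nrm_bounded_ops_nonneg[OF T])
  show "nrm ?B T = 0 \<longleftrightarrow> T = 0"
  proof
    assume z: "nrm ?B T = 0"
    have "T x = 0" for x
    proof (cases "x \<in> points V")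
      case True
      then show ?thesis
        using bounded_opsD(5)[OF T True] z W.nrm_nonneg[OF Tm] W.nrm_eq_0[OF Tm] by (metis mult_zero_left order_antisym)
    qed (simp add: bounded_opsD[OF T])
    then show "T = 0" by (simp add: fun_eq_iff)
  next
    assume "T = 0"
    then have "nrm ?B T \<le> 0" by (intro nrm_bounded_ops_least) auto
    then show "nrm ?B T = 0" using nrm_bounded_ops_nonneg[OF T] by simp
  qed
  show "nrm ?B (nscale ?B c T) = norm c * nrm ?B T"
  proof (rule order_antisym)
    have le: "nrm ?B (nscale ?B c T) \<le> norm c * nrm ?B T" if "T \<in> points ?B" for c T
      unfolding nscale_bounded_ops
      using bounded_opsD(2,5)[OF that] nrm_bounded_ops_nonneg[OF that]
      by (intro nrm_bounded_ops_least) (auto simp: W.nrm_smult mult_left_mono mult.assoc)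
    show "nrm ?B (nscale ?B c T) \<le> norm c * nrm ?B T" by (rule le[OF T])
    show "norm c * nrm ?B T \<le> nrm ?B (nscale ?B c T)"
    proof (cases "c = 0")
      case True
      then show ?thesis using nrm_bounded_ops_nonneg[OF smul[OF T]] by simp
    next
      case False
      \<comment> \<open>The lower bound is the upper bound applied to scaling by
        \<open>inverse c\<close>.\<close>
      have "nscale ?B (inverse c) (nscale ?B c T) = T"
        using False by (auto simp: nscale_bounded_ops fun_eq_iff W.smult_smult W.smult_one Tm)
      then have "nrm ?B T \<le> inverse (norm c) * nrm ?B (nscale ?B c T)"
        using le[OF smul[OF T], of "inverse c" c] by (simp only: norm_inverse)
      then show ?thesis using False by (simp add: field_simps)
    qed
  qed
  assume S: "S \<in> points ?B"
  have Sm: "S x \<in> points W" for x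
    using bounded_opsD(1,2)[OF S] W.zero_mem by (cases "x \<in> points V") auto
  show "nscale ?B c (S + T) = nscale ?B c S + nscale ?B c T"
    by (auto simp: nscale_bounded_ops fun_eq_iff W.smult_add_right Tm Sm)
  show "nrm ?B (S + T) \<le> nrm ?B S + nrm ?B T"
  proof (rule nrm_bounded_ops_least)
    show "0 \<le> nrm ?B S + nrm ?B T" using nrm_bounded_ops_nonneg S T by simp
    fix x assume x: "x \<in> points V"
    show "nrm W ((S + T) x) \<le> (nrm ?B S + nrm ?B T) * nrm V x"
      using W.nrm_triangle[OF Sm Tm, of x x] bounded_opsD(5)[OF S x] bounded_opsD(5)[OF T x]
      by (simp add: distrib_right)
  qed
qed

text \<open>Pointwise limits exist by completeness of W and inherit linearity from uniqueness of
  limits; the Cauchy estimate is uniform on the unit ball and so passes to the limit in operator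
  norm.\<close>

lemma banach_bounded_ops:
  assumes W: "banach_space_on W" shows "banach_space_on (bounded_ops V W)"
proof -
  let ?B = "bounded_ops V W"
  interpret B: normed_space_on ?B by (rule normed_bounded_ops)
  have "\<exists>T\<in>points ?B. (\<lambda>n. nrm ?B (\<sigma> n - T)) \<longlonglongrightarrow> 0"
    if \<sigma>: "range \<sigma> \<subseteq> points ?B" and C: "\<forall>e>0. \<exists>N. \<forall>m\<ge>N. \<forall>n\<ge>N. nrm ?B (\<sigma> m - \<sigma> n) < e" for \<sigma>
  proof -
    have s: "\<sigma> n \<in> points ?B" for n using \<sigma> by auto
    have sx: "\<sigma> n x \<in> points W" if "x \<in> points V" for n x by (rule bounded_opsD(2)[OF s that])
    have dx: "nrm W (\<sigma> m x - \<sigma> n x) \<le> nrm ?B (\<sigma> m - \<sigma> n) * nrm V x" if "x \<in> points V" for m n x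
      using bounded_opsD(5)[OF B.diff_mem[OF s s] that] by simp
    have "\<exists>y\<in>points W. (\<lambda>n. nrm W (\<sigma> n x - y)) \<longlonglongrightarrow> 0" if x: "x \<in> points V" for x
    proof (rule mp[OF spec[OF conjunct2[OF W[unfolded banach_space_on_iff W.mcomplete_iff]]]], intro conjI allI impI)
      show "range (\<lambda>n. \<sigma> n x) \<subseteq> points W" using sx[OF x] by auto
      fix e :: real assume e: "e > 0"
      have px: "0 \<le> nrm V x" by (rule V.nrm_nonneg[OF x])
      \<comment> \<open>The summand 1 covers x = 0 and makes the resulting estimate strict.\<close>
      then have "e / (nrm V x + 1) > 0" using e by simp
      then obtain N where N: "\<forall>m\<ge>N. \<forall>n\<ge>N. nrm ?B (\<sigma> m - \<sigma> n) < e / (nrm V x + 1)" using C by presburger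
      have "nrm W (\<sigma> m x - \<sigma> n x) < e" if "m \<ge> N" "n \<ge> N" for m n
      proof -
        have "nrm W (\<sigma> m x - \<sigma> n x) \<le> e / (nrm V x + 1) * nrm V x"
          using dx[OF x, of m n] mult_right_mono[OF less_imp_le[OF N[rule_format, OF that]] px] by linarith
        also have "\<dots> < e" using e px by (simp add: field_simps)
        finally show ?thesis .
      qed
      then show "\<exists>N. \<forall>m\<ge>N. \<forall>n\<ge>N. nrm W (\<sigma> m x - \<sigma> n x) < e" by blast
    qed
    then obtain T0 where T0: "\<And>x. x \<in> points V \<Longrightarrow> T0 x \<in> points W"
      "\<And>x. x \<in> points V \<Longrightarrow> (\<lambda>n. nrm W (\<sigma> n x - T0 x)) \<longlonglongrightarrow> 0"
      by metis
    define T where "T = (\<lambda>x. if x \<in> points V then T0 x else 0)"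
    have T: "x \<in> points V \<Longrightarrow> T x \<in> points W" "x \<in> points V \<Longrightarrow> (\<lambda>n. nrm W (\<sigma> n x - T x)) \<longlonglongrightarrow> 0" for x
      using T0 by (auto simp: T_def)
    have uniq: "y = z" if yz: "y \<in> points W" "z \<in> points W" "\<And>n. p n \<in> points W"
      and l: "(\<lambda>n. nrm W (p n - y)) \<longlonglongrightarrow> 0" "(\<lambda>n. nrm W (p n - z)) \<longlonglongrightarrow> 0" for y z and p :: "nat \<Rightarrow> 'w"
    proof -
      have "nrm W (y - z) \<le> nrm W (p n - y) + nrm W (p n - z)" for n
        using W.nrm_diff_triangle[OF yz(1) yz(3)[of n] yz(2)] W.nrm_diff_commute[OF yz(1) yz(3)] by simp
      then have "nrm W (y - z) \<le> 0"
        using tendsto_add[OF l] by (intro LIMSEQ_le_const) auto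
      then have "nrm W (y - z) = 0" using W.nrm_nonneg[OF W.diff_mem[OF yz(1,2)]] by simp
      then show ?thesis using W.nrm_eq_0[OF W.diff_mem[OF yz(1,2)]] by simp
    qed
    have Tadd: "T (x + y) = T x + T y" if x: "x \<in> points V" and y: "y \<in> points V" for x y
    proof (rule uniq[where p = "\<lambda>n. \<sigma> n (x + y)"])
      show "(\<lambda>n. nrm W (\<sigma> n (x + y) - (T x + T y))) \<longlonglongrightarrow> 0"
      proof (rule tendsto_sandwich[OF _ _ tendsto_const tendsto_add_zero[OF T(2)[OF x] T(2)[OF y]]])
        show "\<forall>\<^sub>F n in sequentially. nrm W (\<sigma> n (x + y) - (T x + T y)) \<le> nrm W (\<sigma> n x - T x) + nrm W (\<sigma> n y - T y)"
          unfolding bounded_opsD(3)[OF s x y] add_diff_add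
          by (intro always_eventually allI W.nrm_triangle W.diff_mem sx T x y)
        show "\<forall>\<^sub>F n in sequentially. 0 \<le> nrm W (\<sigma> n (x + y) - (T x + T y))"
          by (intro always_eventually allI W.nrm_nonneg W.diff_mem W.add_mem sx V.add_mem T x y)
      qed
    qed (intro T sx V.add_mem W.add_mem x y)+
    have Tsc: "T (nscale V c x) = nscale W c (T x)" if x: "x \<in> points V" for c x
    proof (rule uniq[where p = "\<lambda>n. \<sigma> n (nscale V c x)"])
      have "\<sigma> n (nscale V c x) - nscale W c (T x) = nscale W c (\<sigma> n x - T x)" for n
        using bounded_opsD(4)[OF s x] W.smult_add_right[OF W.diff_mem[OF sx[OF x] T(1)[OF x]] T(1)[OF x], of c]
        by (simp add: eq_diff_eq[symmetric])
      then have "nrm W (\<sigma> n (nscale V c x) - nscale W c (T x)) = norm c * nrm W (\<sigma> n x - T x)" for n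
        using W.nrm_smult[OF W.diff_mem[OF sx[OF x] T(1)[OF x]]] by simp
      then show "(\<lambda>n. nrm W (\<sigma> n (nscale V c x) - nscale W c (T x))) \<longlonglongrightarrow> 0"
        using tendsto_mult_right_zero[OF T(2)[OF x]] by simp
    qed (intro T sx V.smult_mem W.smult_mem x)+
    \<comment> \<open>Let m tend to infinity in the Cauchy estimate between
      \<open>\<sigma> m\<close> and \<open>\<sigma> n\<close>.\<close>
    have lim_bound: "nrm W (\<sigma> n x - T x) \<le> e * nrm V x"
      if x: "x \<in> points V" and N: "\<forall>m\<ge>N. \<forall>n\<ge>N. nrm ?B (\<sigma> m - \<sigma> n) < e" "n \<ge> N" for n x e N
    proof -
      have "nrm W (\<sigma> n x - T x) \<le> e * nrm V x + nrm W (\<sigma> m x - T x)" if "m \<ge> N" for m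
        using W.nrm_diff_triangle[OF sx[OF x, of n] sx[OF x, of m] T(1)[OF x]] dx[OF x, of n m]
          mult_right_mono[OF less_imp_le[OF N(1)[rule_format, OF N(2) that]] V.nrm_nonneg[OF x]] by linarith
      then have "nrm W (\<sigma> n x - T x) \<le> e * nrm V x + 0"
        using T(2)[OF x] by (intro LIMSEQ_le_const[OF tendsto_add[OF tendsto_const]]) auto
      then show ?thesis by simp
    qed
    obtain N1 where N1: "\<forall>m\<ge>N1. \<forall>n\<ge>N1. nrm ?B (\<sigma> m - \<sigma> n) < 1" using C zero_less_one by metis
    have "T \<in> points ?B"
    proof (rule bounded_opsI[where C = "nrm ?B (\<sigma> N1) + 1"])
      fix x assume x: "x \<in> points V"
      have "nrm W (T x) \<le> nrm W (\<sigma> N1 x) + nrm W (T x - \<sigma> N1 x)"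
        using W.nrm_triangle[OF sx[OF x, of N1] W.diff_mem[OF T(1)[OF x] sx[OF x, of N1]]] by simp
      also have "nrm W (T x - \<sigma> N1 x) = nrm W (\<sigma> N1 x - T x)"
        by (intro W.nrm_diff_commute sx T x)
      finally show "nrm W (T x) \<le> (nrm ?B (\<sigma> N1) + 1) * nrm V x"
        using lim_bound[OF x N1 order_refl] bounded_opsD(5)[OF s x, of N1] by (simp add: distrib_right)
    qed (use T Tadd Tsc in \<open>auto simp: T_def\<close>)
    moreover have "(\<lambda>n. nrm ?B (\<sigma> n - T)) \<longlonglongrightarrow> 0"
    proof (rule LIMSEQ_I)
      fix e :: real assume e: "e > 0"
      then have "e / 2 > 0" by simp
      then obtain N where N: "\<forall>m\<ge>N. \<forall>n\<ge>N. nrm ?B (\<sigma> m - \<sigma> n) < e / 2" using C by presburger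
      have "nrm ?B (\<sigma> n - T) \<le> e / 2" if "n \<ge> N" for n
        using lim_bound[OF _ N that] e by (intro nrm_bounded_ops_least) auto
      moreover have "nrm ?B (\<sigma> n - T) \<ge> 0" for n
        by (intro B.nrm_nonneg B.diff_mem s \<open>T \<in> points ?B\<close>)
      ultimately show "\<exists>N. \<forall>n\<ge>N. norm (nrm ?B (\<sigma> n - T) - 0) < e"
        using e by (intro exI[of _ N]) fastforce
    qed
    ultimately show ?thesis by blast
  qed
  note key = this
  show ?thesis
    unfolding banach_space_on_iff B.mcomplete_iff
    by (intro conjI allI impI B.normed_space_on_axioms) (elim conjE, rule key)
qed

end

section \<open>Affine maps between normed spaces\<close>

text \<open>The affine subspaces of this proof are full carriers. Translating a carrier by one of
  its points gives it back, so every base point has the same direction space.\<close>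

lemma direction_points: "normed_space_on V \<Longrightarrow> a \<in> points V \<Longrightarrow> direction V (points V) a = V"
proof -
  assume V: "normed_space_on V" and a: "a \<in> points V"
  interpret normed_space_on V by fact
  have "(\<lambda>x. x - a) ` points V = points V"
    using a by (auto simp: diff_mem image_iff intro!: bexI[of _ "_ + a"] add_mem)
  then show ?thesis by (simp add: direction_def)
qed

context two_spaces begin

text \<open>Taken at the base point 0, since the linear part of an affine map is the same at all
  base points; the value 0 outside makes it a member of \<open>bounded_ops\<close>.\<close>

definition linear_part :: "('v \<Rightarrow> 'w) \<Rightarrow> 'v \<Rightarrow> 'w" where
  "linear_part S = (\<lambda>v. if v \<in> points V then S v - S 0 else 0)"

text \<open>An affine map is its value at 0 plus its linear part, and it is continuous exactly if
  the linear part is bounded. In particular the set of points does not change with the base point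
  a.\<close>

lemma points_affine_maps:
  assumes a: "a \<in> points V"
  shows "S \<in> points (affine_maps V (points V) W a) \<longleftrightarrow>
    (\<forall>x. x \<notin> points V \<longrightarrow> S x = 0) \<and> S 0 \<in> points W \<and> linear_part S \<in> points (bounded_ops V W)"
proof (intro iffI conjI)
  assume S: "S \<in> points (affine_maps V (points V) W a)"
  have aff: "affine_map_on V (points V) W S" and cont: "continuous_map (subtopology (ntop V) (points V)) (ntop W) S"
    using S by (auto simp: affine_maps_def)
  show "\<forall>x. x \<notin> points V \<longrightarrow> S x = 0" using S by (auto simp: affine_maps_def)
  show "S 0 \<in> points W" using aff V.zero_mem by (auto simp: affine_map_on_def)
  have Sm: "S x \<in> points W" if "x \<in> points V" for x using aff that by (auto simp: affine_map_on_def)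
  have "linear_map_on (direction V (points V) 0) W (\<lambda>v. S (0 + v) - S 0)"
    using aff V.zero_mem by (auto simp only: affine_map_on_def)
  then have lin: "linear_map_on V W (\<lambda>v. S v - S 0)"
    by (simp add: direction_points V.normed_space_on_axioms V.zero_mem)
  have op: "openin (ntop V) {x \<in> points V. S x \<in> {y \<in> points W. nrm W (y - S 0) < 1}}"
    using openin_continuous_map_preimage[OF cont W.openin_ball[OF Sm[OF V.zero_mem], of 1]]
      V.topspace_ntop by (simp add: subtopology_topspace[of "ntop V", simplified])
  have z: "0 \<in> {x \<in> points V. S x \<in> {y \<in> points W. nrm W (y - S 0) < 1}}"
    using V.zero_mem Sm by simp
  obtain r where r: "r > 0" "\<And>y. \<lbrakk>y \<in> points V; nrm V y < r\<rbrakk> \<Longrightarrow> nrm W (S y - S 0) < 1"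
    using bspec[OF conjunct2[OF op[unfolded V.openin_ntop]] z] by auto
  \<comment> \<open>A nonzero vector is scaled to norm r/2, strictly inside the ball on which the
    increment is below 1; this yields the constant 2/r.\<close>
  show "linear_part S \<in> points (bounded_ops V W)"
  proof (rule bounded_opsI[where C = "2 / r"])
    fix x assume x: "x \<in> points V"
    show "linear_part S x \<in> points W"
      using x Sm V.zero_mem by (simp add: linear_part_def W.diff_mem)
    show "linear_part S (x + y) = linear_part S x + linear_part S y" if "y \<in> points V" for y
      using lin x that by (simp add: linear_part_def linear_map_on_def V.add_mem)
    show sc: "linear_part S (nscale V c x) = nscale W c (linear_part S x)" for c
      using lin x by (simp add: linear_part_def linear_map_on_def V.smult_mem)
    show "nrm W (linear_part S x) \<le> 2 / r * nrm V x"
    proof (cases "x = 0")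
      case True
      then show ?thesis using V.zero_mem by (simp add: linear_part_def)
    next
      case False
      then have pos: "nrm V x > 0" using V.nrm_eq_0[OF x] V.nrm_nonneg[OF x] by simp
      define c :: 'k where "c = of_real (r / (2 * nrm V x))"
      have nc: "norm c = r / (2 * nrm V x)" unfolding c_def norm_of_real using pos r by simp
      have cx: "nscale V c x \<in> points V" using x by (rule V.smult_mem)
      have "nrm V (nscale V c x) < r" using pos r x by (simp add: V.nrm_smult nc)
      then have "nrm W (linear_part S (nscale V c x)) < 1" using r(2)[OF cx] cx by (simp add: linear_part_def)
      then have "norm c * nrm W (linear_part S x) < 1"
        using x Sm V.zero_mem unfolding sc by (simp add: linear_part_def W.nrm_smult W.diff_mem)
      then show ?thesis using pos r by (simp add: nc field_simps)
    qed
  qed (simp add: linear_part_def)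
next
  assume S: "(\<forall>x. x \<notin> points V \<longrightarrow> S x = 0) \<and> S 0 \<in> points W \<and> linear_part S \<in> points (bounded_ops V W)"
  define L where "L = linear_part S"
  have L: "L \<in> points (bounded_ops V W)" and S0: "S 0 \<in> points W" using S by (auto simp: L_def)
  have SL: "S v = L v + S 0" if "v \<in> points V" for v using that by (simp add: L_def linear_part_def)
  have Sm: "S v \<in> points W" if "v \<in> points V" for v
    using SL[OF that] bounded_opsD(2)[OF L that] S0 by (simp add: W.add_mem)
  have SLd: "S (b + v) - S b = L v" if "b \<in> points V" "v \<in> points V" for b v
    using that by (simp add: SL V.add_mem bounded_opsD(3)[OF L])
  have aff: "affine_map_on V (points V) W S"
    unfolding affine_map_on_def
  proof (intro conjI ballI)
    show "S ` points V \<subseteq> points W" using Sm by auto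
    fix b assume b: "b \<in> points V"
    show "linear_map_on (direction V (points V) b) W (\<lambda>v. S (b + v) - S b)"
      unfolding direction_points[OF V.normed_space_on_axioms b]
      using bounded_opsD(6)[OF L] by (auto simp: linear_map_on_def SLd b V.add_mem V.smult_mem)
  qed
  have "continuous_map (subtopology (ntop V) (points V)) (ntop W) S"
    unfolding continuous_map_def V.topspace_ntop
  proof (intro conjI allI impI)
    show "S \<in> topspace (subtopology (ntop V) (points V)) \<rightarrow> topspace (ntop W)" using Sm by auto
    fix U assume U: "openin (ntop W) U"
    have "openin (ntop V) {x \<in> points V. S x \<in> U}"
      unfolding V.openin_ntop
    proof (intro conjI ballI)
      fix x assume "x \<in> {x \<in> points V. S x \<in> U}"
      then have x: "x \<in> points V" "S x \<in> U" by auto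
      then obtain e where e: "e > 0" "\<forall>y\<in>points W. nrm W (y - S x) < e \<longrightarrow> y \<in> U"
        using U by (auto simp: W.openin_ntop)
      \<comment> \<open>A Lipschitz constant of S, made positive so that \<open>e / k\<close> is a
        radius.\<close>
      define k where "k = nrm (bounded_ops V W) L + 1"
      have k: "k > 0" using nrm_bounded_ops_nonneg[OF L] by (simp add: k_def)
      have "S y \<in> U" if y: "y \<in> points V" "nrm V (y - x) < e / k" for y
      proof -
        have d: "y - x \<in> points V" using x y by (simp add: V.diff_mem)
        have "nrm W (S y - S x) = nrm W (L (y - x))" using SLd[OF x(1) d] by simp
        also have "\<dots> \<le> k * nrm V (y - x)"
          using bounded_opsD(5)[OF L d] V.nrm_nonneg[OF d] by (simp add: k_def distrib_right)
        also have "\<dots> < e" using y(2) k by (simp add: field_simps)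
        finally show ?thesis using e Sm[OF y(1)] by blast
      qed
      then show "\<exists>r>0. \<forall>y\<in>points V. nrm V (y - x) < r \<longrightarrow> y \<in> {x \<in> points V. S x \<in> U}"
        using e k by (intro exI[of _ "e / k"]) auto
    qed auto
    then show "openin (subtopology (ntop V) (points V)) {x \<in> topspace (subtopology (ntop V) (points V)). S x \<in> U}"
      by (simp add: openin_subtopology_self subtopology_topspace[of "ntop V", simplified])
  qed
  then show "S \<in> points (affine_maps V (points V) W a)"
    using S aff by (simp add: affine_maps_def)
qed

text \<open>The first summand of the norm does not see the base point, because increments of S from
  a and from 0 agree.\<close>

lemma nrm_affine_maps:
  assumes a: "a \<in> points V" and S: "S \<in> points (affine_maps V (points V) W a)"
  shows "nrm (affine_maps V (points V) W a) S = nrm (bounded_ops V W) (linear_part S) + nrm W (S a)"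
proof -
  have L: "linear_part S \<in> points (bounded_ops V W)" using S points_affine_maps[OF a] by blast
  have "S (a + v) - S a = linear_part S v" if "v \<in> points V" for v
    using bounded_opsD(3)[OF L a that] that a by (simp add: linear_part_def V.add_mem algebra_simps)
  then have "opnorm V W (\<lambda>v. S (a + v) - S a) = opnorm V W (linear_part S)"
    by (rule opnorm_cong)
  then show ?thesis
    by (simp add: affine_maps_def direction_points[OF V.normed_space_on_axioms a] bounded_ops_def)
qed

lemma linear_part_zero: "linear_part 0 = 0"
  by (auto simp: linear_part_def fun_eq_iff)

lemma linear_part_add: "linear_part (S + T) = linear_part S + linear_part T"
  by (auto simp: linear_part_def fun_eq_iff)

lemma normed_affine_maps:
  assumes a: "a \<in> points V"
  shows "normed_space_on (affine_maps V (points V) W a)"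
proof
  let ?Z = "affine_maps V (points V) W a"
  let ?B = "bounded_ops V W"
  interpret B: normed_space_on ?B by (rule normed_bounded_ops)
  have sc: "nscale ?Z c S = (\<lambda>x. nscale W c (S x))" for c S by (simp add: affine_maps_def)
  have mem: "S x \<in> points W" if "S \<in> points ?Z" for S x
  proof (cases "x \<in> points V")
    case True
    then have "S x = linear_part S x + S 0" by (simp add: linear_part_def)
    then show ?thesis using that True bounded_opsD(2)[of "linear_part S" x]
      unfolding points_affine_maps[OF a] by (simp add: W.add_mem)
  next
    case False
    then show ?thesis using that W.zero_mem unfolding points_affine_maps[OF a] by simp
  qed
  have lsc: "linear_part (nscale ?Z c S) = nscale ?B c (linear_part S)" if "S \<in> points ?Z" for c S
  proof -
    have "nscale W c (S v) - nscale W c (S 0) = nscale W c (S v - S 0)" for v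
      using W.smult_add_right[OF W.diff_mem[OF mem[OF that] mem[OF that]] mem[OF that], of c v 0 0] by simp
    then show ?thesis unfolding linear_part_def sc nscale_bounded_ops by (auto simp: fun_eq_iff)
  qed
  show zero: "0 \<in> points ?Z"
    unfolding points_affine_maps[OF a] by (simp add: linear_part_zero B.zero_mem W.zero_mem)
  show add: "S + T \<in> points ?Z" if "S \<in> points ?Z" "T \<in> points ?Z" for S T
    using that unfolding points_affine_maps[OF a] by (simp add: linear_part_add B.add_mem W.add_mem)
  show smul: "nscale ?Z c S \<in> points ?Z" if "S \<in> points ?Z" for c S
    using that lsc[OF that, of c] B.smult_mem[of "linear_part S" c] unfolding points_affine_maps[OF a]
    by (simp add: sc W.smult_mem)
  fix S T and c d :: 'k assume T: "T \<in> points ?Z"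
  note Tm = mem[OF T]
  have TL: "linear_part T \<in> points ?B" using T points_affine_maps[OF a] by blast
  show "nscale ?Z (c + d) T = nscale ?Z c T + nscale ?Z d T"
    "nscale ?Z c (nscale ?Z d T) = nscale ?Z (c * d) T" "nscale ?Z 1 T = T"
    by (auto simp: sc fun_eq_iff W.smult_add_left W.smult_smult W.smult_one Tm)
  show "0 \<le> nrm ?Z T" using nrm_affine_maps[OF a T] B.nrm_nonneg[OF TL] W.nrm_nonneg[OF Tm] by simp
  show "nrm ?Z T = 0 \<longleftrightarrow> T = 0"
  proof
    assume "nrm ?Z T = 0"
    then have "nrm ?B (linear_part T) = 0" "nrm W (T a) = 0"
      using nrm_affine_maps[OF a T] B.nrm_nonneg[OF TL] W.nrm_nonneg[OF Tm, of a] by simp_all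
    then have z: "linear_part T = 0" "T a = 0" using B.nrm_eq_0[OF TL] W.nrm_eq_0[OF Tm] by simp_all
    \<comment> \<open>A vanishing linear part makes T constant, and \<open>T a = 0\<close> then
      makes it zero.\<close>
    have "T x = T 0" if "x \<in> points V" for x
      using fun_cong[OF z(1), of x] that by (simp add: linear_part_def)
    then have "T x = 0" if "x \<in> points V" for x using that z(2) a by metis
    then show "T = 0" using T unfolding points_affine_maps[OF a] by (auto simp: fun_eq_iff)
  next
    assume "T = 0"
    then show "nrm ?Z T = 0" using nrm_affine_maps[OF a T] by (simp add: linear_part_zero)
  qed
  show "nrm ?Z (nscale ?Z c T) = norm c * nrm ?Z T"
    unfolding nrm_affine_maps[OF a T] nrm_affine_maps[OF a smul[OF T]] lsc[OF T]
    by (simp add: sc B.nrm_smult TL W.nrm_smult Tm distrib_left)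
  assume S: "S \<in> points ?Z"
  note Sm = mem[OF S]
  have SL: "linear_part S \<in> points ?B" using S points_affine_maps[OF a] by blast
  show "nscale ?Z c (S + T) = nscale ?Z c S + nscale ?Z c T"
    by (auto simp: sc fun_eq_iff W.smult_add_right Tm Sm)
  show "nrm ?Z (S + T) \<le> nrm ?Z S + nrm ?Z T"
    unfolding nrm_affine_maps[OF a T] nrm_affine_maps[OF a S] nrm_affine_maps[OF a add[OF S T]] linear_part_add
    using B.nrm_triangle[OF SL TL] W.nrm_triangle[OF Sm Tm, of a a] by simp
qed

end

section \<open>Complementary subspaces\<close>

text \<open>The open mapping theorem for the sum map \<open>E \<times> F \<rightarrow> X\<close>: by Baire some set where \<open>P\<close> is bounded
  is dense in a ball, and successive approximation together with closedness bounds \<open>P\<close> there.\<close>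

lemma bounded_projection:
  fixes P :: "'a::banach \<Rightarrow> 'a"
  assumes lin: "linear P" and E: "closed E" and F: "closed F"
    and PE: "\<And>x. P x \<in> E" and PF: "\<And>x. x - P x \<in> F"
    and uniq: "\<And>x e. \<lbrakk>e \<in> E; x - e \<in> F\<rbrakk> \<Longrightarrow> P x = e"
  shows "\<exists>C. \<forall>x. norm (P x) \<le> C * norm x"
proof -
  interpret P: linear P by fact
  define A where "A = (\<lambda>n::nat. {x. norm (P x) \<le> real n})"
  have "\<exists>n. euclidean interior_of closure (A n) \<noteq> {}"
  proof (rule ccontr)
    assume "\<not> ?thesis"
    then have e: "\<And>T. T \<in> range (\<lambda>n. closure (A n)) \<Longrightarrow>
        closedin Met_TC.mtopology T \<and> Met_TC.mtopology interior_of T = {}" by auto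
    have "Met_TC.mtopology interior_of \<Union> (range (\<lambda>n. closure (A n))) = {}"
      by (rule Met_TC.metric_Baire_category_alt[OF _ _ e]) (auto simp: complete_UNIV)
    moreover have "\<Union> (range (\<lambda>n. closure (A n))) = UNIV"
    proof -
      have "x \<in> (\<Union>n. closure (A n))" for x
        using real_arch_simple[of "norm (P x)"] closure_subset by (fastforce simp: A_def)
      then show ?thesis by blast
    qed
    ultimately have "(euclidean :: 'a topology) interior_of UNIV = {}" by simp
    then show False using interior_of_topspace[of "euclidean :: 'a topology"] by simp
  qed
  then obtain n x0 T where "open T" "x0 \<in> T" "T \<subseteq> closure (A n)"
    by (auto simp: interior_of_def)
  then obtain \<delta> where \<delta>: "\<delta> > 0" "ball x0 \<delta> \<subseteq> closure (A n)"
    by (meson openE order_trans)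
  \<comment> \<open>Density near \<open>x0\<close> is moved to 0 by taking differences of two points
    of \<open>A n\<close>, which doubles the bound.\<close>
  define M where "M = 2 * real n"
  have approx: "\<exists>y. norm (z - y) < e \<and> norm (P y) \<le> M" if z: "norm z < \<delta>" and e: "e > 0" for z e
  proof -
    have "x0 + z \<in> closure (A n)" "x0 \<in> closure (A n)"
      using \<delta> z by (auto intro!: subsetD[OF \<delta>(2)] simp: dist_norm)
    then obtain y1 y2 where y: "y1 \<in> A n" "dist y1 (x0 + z) < e / 2" "y2 \<in> A n" "dist y2 x0 < e / 2"
      using e unfolding closure_approachable by (meson half_gt_zero)
    have "norm (z - (y1 - y2)) = norm ((x0 + z - y1) - (x0 - y2))" by (simp add: algebra_simps)
    also have "\<dots> \<le> norm (x0 + z - y1) + norm (x0 - y2)" by (rule norm_triangle_ineq4)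
    also have "\<dots> < e" using y by (simp add: dist_norm norm_minus_commute)
    finally have "norm (z - (y1 - y2)) < e" .
    moreover have "norm (P (y1 - y2)) \<le> M"
      using y norm_triangle_ineq4[of "P y1" "P y2"] by (simp add: P.diff A_def M_def)
    ultimately show ?thesis by blast
  qed
  \<comment> \<open>The bound M belongs to vectors scaled to norm \<open>\<delta> / 2\<close>;
    scaling back to z multiplies it by \<open>2 * norm z / \<delta>\<close>.\<close>
  define K where "K = 2 * M / \<delta>"
  have K: "K \<ge> 0" using \<delta> by (simp add: K_def M_def)
  have "\<exists>y. norm (z - y) \<le> norm z / 2 \<and> norm (P y) \<le> K * norm z" for z
  proof (cases "z = 0")
    case False
    \<comment> \<open>With norm \<open>\<delta> / 2\<close> after scaling, an approximation within
      \<open>\<delta> / 4\<close> leaves half of z as remainder.\<close>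
    define s where "s = \<delta> / (2 * norm z)"
    have s: "s > 0" using False \<delta> by (simp add: s_def)
    have sz: "s * norm z = \<delta> / 2" using False by (simp add: s_def)
    have "norm (s *\<^sub>R z) < \<delta>" using s sz \<delta> by simp
    then obtain y' where y': "norm (s *\<^sub>R z - y') < \<delta> / 4" "norm (P y') \<le> M"
      using approx[of "s *\<^sub>R z" "\<delta> / 4"] \<delta> by auto
    define y where "y = inverse s *\<^sub>R y'"
    have "s *\<^sub>R z - y' = s *\<^sub>R (z - y)" using s by (simp add: y_def algebra_simps)
    then have "s * norm (z - y) < \<delta> / 4" using y'(1) s by simp
    also have "\<dots> = s * (norm z / 2)" using sz by simp
    finally have "norm (z - y) \<le> norm z / 2" using s by simp
    moreover have "norm (P y) = inverse s * norm (P y')" using s by (simp add: y_def P.scale)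
    then have "norm (P y) \<le> inverse s * M" using y'(2) s by (simp add: mult_left_mono)
    then have "norm (P y) \<le> K * norm z" using False \<delta> by (simp add: s_def K_def field_simps)
    ultimately show ?thesis by blast
  qed (auto intro!: exI[of _ 0] simp: P.zero)
  then obtain Y where Y: "\<And>z. norm (z - Y z) \<le> norm z / 2" "\<And>z. norm (P (Y z)) \<le> K * norm z"
    by metis
  have "norm (P x) \<le> (2 * K) * norm x" for x
  proof -
    \<comment> \<open>The remainder after k corrections; it halves at each step, so the projections
      of the corrections are dominated by a geometric series.\<close>
    define z where "z = rec_nat x (\<lambda>_ z. z - Y z)"
    have z0: "z 0 = x" and zS: "z (Suc k) = z k - Y (z k)" for k by (simp_all add: z_def)
    have nz: "norm (z k) \<le> norm x * (1/2) ^ k" for k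
    proof (induction k)
      case (Suc k)
      have "norm (z (Suc k)) \<le> norm (z k) / 2" unfolding zS by (rule Y)
      then show ?case using Suc by simp
    qed (simp add: z0)
    define p where "p = (\<lambda>k. P (Y (z k)))"
    have np: "norm (p k) \<le> K * norm x * (1/2) ^ k" for k
    proof -
      have "norm (p k) \<le> K * norm (z k)" unfolding p_def by (rule Y)
      also have "\<dots> \<le> K * (norm x * (1/2) ^ k)" by (intro mult_left_mono nz K)
      finally show ?thesis by simp
    qed
    have smg: "summable (\<lambda>k. K * norm x * (1/2) ^ k)" by (intro summable_mult summable_geometric) simp
    then have smp: "summable p" using np by (rule summable_comparison_test'[where N = 0])
    have snp: "summable (\<lambda>k. norm (p k))"
      by (rule summable_comparison_test'[OF smg, where N = 0]) (use np in simp)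
    have sumY: "(\<Sum>k<N. Y (z k)) = x - z N" for N by (induction N) (simp_all add: z0 zS)
    have sump: "(\<Sum>k<N. p k) = P (x - z N)" for N by (simp add: p_def P.sum[symmetric] sumY)
    define e where "e = suminf p"
    have lim: "(\<lambda>N. P (x - z N)) \<longlonglongrightarrow> e"
      using summable_LIMSEQ[OF smp] by (simp add: sump e_def)
    have "(\<lambda>N. norm x * (1/2) ^ N) \<longlonglongrightarrow> 0"
      by (intro tendsto_mult_right_zero LIMSEQ_power_zero) simp
    then have zlim: "z \<longlonglongrightarrow> 0"
      by (rule Lim_null_comparison[OF always_eventually[OF allI[OF nz]]])
    \<comment> \<open>Continuity of P is not yet available; closedness of E and F carries both
      memberships to the limit, and uniqueness of the decomposition identifies e with
      \<open>P x\<close>.\<close>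
    have "e \<in> E" by (rule closed_sequentially[OF E PE lim])
    moreover have "(\<lambda>N. (x - z N) - P (x - z N)) \<longlonglongrightarrow> (x - 0) - e"
      by (intro tendsto_diff tendsto_const zlim lim)
    then have "x - e \<in> F" using closed_sequentially[OF F PF] by force
    ultimately have "P x = e" by (rule uniq)
    have "norm e \<le> (\<Sum>k. norm (p k))" unfolding e_def by (rule summable_norm[OF snp])
    also have "\<dots> \<le> (\<Sum>k. K * norm x * (1/2) ^ k)" by (intro suminf_le np snp smg)
    also have "\<dots> = 2 * K * norm x" by (subst suminf_mult) (simp_all add: suminf_geometric)
    finally show ?thesis using \<open>P x = e\<close> by simp
  qed
  then show ?thesis by blast
qed

section \<open>Closed subspaces, bounded operators and projections\<close>

context banach_scaling begin

abbreviation sub :: "'a set \<Rightarrow> ('k, 'a) nspace" where "sub E \<equiv> subspace_nspace scale E"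
abbreviation OP :: "'a set \<Rightarrow> 'a set \<Rightarrow> ('k, 'a \<Rightarrow> 'a) nspace" where "OP E F \<equiv> op_space scale E F"
abbreviation BL :: "('k, 'a \<Rightarrow> 'a) nspace" where "BL \<equiv> op_space scale UNIV UNIV"

lemma sub_simps [simp]: "points (sub E) = E" "nscale (sub E) = scale" "nrm (sub E) = norm"
  by (simp_all add: subspace_nspace_def)

lemma normed_sub: "subspace E \<Longrightarrow> normed_space_on (sub E)"
  by unfold_locales
    (auto simp: subspace_0 subspace_add subspace_scale scale_right_distrib scale_left_distrib norm_scale norm_triangle_ineq)

lemma two_sub: "\<lbrakk>subspace E; subspace F\<rbrakk> \<Longrightarrow> two_spaces (sub E) (sub F)"
  by (simp add: two_spaces_def normed_sub)

lemma normed_op: "\<lbrakk>subspace E; subspace F\<rbrakk> \<Longrightarrow> normed_space_on (OP E F)"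
  unfolding op_space_def by (rule two_spaces.normed_bounded_ops[OF two_sub])

lemma normed_BL: "normed_space_on BL"
  by (rule normed_op) (rule subspace_UNIV)+

lemma banach_sub:
  assumes "closed_subspace scale F" shows "banach_space_on (sub F)"
proof -
  have F: "subspace F" "closed F" using assms by (auto simp: closed_subspace_def)
  interpret F: normed_space_on "sub F" by (rule normed_sub[OF F(1)])
  have "\<exists>x\<in>points (sub F). (\<lambda>n. nrm (sub F) (\<sigma> n - x)) \<longlonglongrightarrow> 0"
    if "range \<sigma> \<subseteq> points (sub F)" "\<forall>e>0. \<exists>N. \<forall>m\<ge>N. \<forall>n\<ge>N. nrm (sub F) (\<sigma> m - \<sigma> n) < e" for \<sigma>
  proof -
    have "Cauchy \<sigma>" using that(2) by (simp add: Cauchy_iff)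
    then obtain x where x: "\<sigma> \<longlonglongrightarrow> x" using Cauchy_convergent convergent_def by blast
    moreover have "x \<in> F" using closed_sequentially[OF F(2) _ x] that(1) by auto
    ultimately show ?thesis by (auto simp: LIM_zero_iff tendsto_norm_zero intro!: bexI[of _ x])
  qed
  note key = this
  show ?thesis
    unfolding banach_space_on_iff F.mcomplete_iff
    by (intro conjI allI impI F.normed_space_on_axioms) (elim conjE, rule key)
qed

lemma banach_op: "\<lbrakk>subspace E; closed_subspace scale F\<rbrakk> \<Longrightarrow> banach_space_on (OP E F)"
  unfolding op_space_def
  by (rule two_spaces.banach_bounded_ops[OF two_sub]) (auto simp: closed_subspace_def intro: banach_sub)

lemma opI:
  assumes "subspace E" "subspace F" "\<And>x. x \<notin> E \<Longrightarrow> T x = 0" "\<And>x. x \<in> E \<Longrightarrow> T x \<in> F"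
    "\<And>x y. \<lbrakk>x \<in> E; y \<in> E\<rbrakk> \<Longrightarrow> T (x + y) = T x + T y"
    "\<And>c x. x \<in> E \<Longrightarrow> T (scale c x) = scale c (T x)"
    "\<And>x. x \<in> E \<Longrightarrow> norm (T x) \<le> C * norm x"
  shows "T \<in> points (OP E F)"
  unfolding op_space_def
  by (rule two_spaces.bounded_opsI[OF two_sub, where C = C]) (use assms in auto)

lemma opD:
  assumes "subspace E" "subspace F" "T \<in> points (OP E F)"
  shows "x \<notin> E \<Longrightarrow> T x = 0" "x \<in> E \<Longrightarrow> T x \<in> F"
    "\<lbrakk>x \<in> E; y \<in> E\<rbrakk> \<Longrightarrow> T (x + y) = T x + T y"
    "x \<in> E \<Longrightarrow> T (scale c x) = scale c (T x)"
    "x \<in> E \<Longrightarrow> norm (T x) \<le> nrm (OP E F) T * norm x"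
    "T x \<in> F"
proof -
  have "T \<in> points (bounded_ops (sub E) (sub F))" using assms(3) by (simp add: op_space_def)
  note b = two_spaces.bounded_opsD[OF two_sub[OF assms(1,2)] this, unfolded sub_simps, folded op_space_def]
  show "x \<notin> E \<Longrightarrow> T x = 0" "x \<in> E \<Longrightarrow> T x \<in> F"
    "\<lbrakk>x \<in> E; y \<in> E\<rbrakk> \<Longrightarrow> T (x + y) = T x + T y"
    "x \<in> E \<Longrightarrow> T (scale c x) = scale c (T x)"
    "x \<in> E \<Longrightarrow> norm (T x) \<le> nrm (OP E F) T * norm x"
    by (fact b)+
  show "T x \<in> F" using b(1,2)[of x] subspace_0[OF assms(2)] by (cases "x \<in> E") auto
qed

lemma nrm_op_least:
  "\<lbrakk>subspace E; subspace F; 0 \<le> C; \<And>x. x \<in> E \<Longrightarrow> norm (T x) \<le> C * norm x\<rbrakk> \<Longrightarrow> nrm (OP E F) T \<le> C"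
  unfolding op_space_def using two_spaces.nrm_bounded_ops_least[OF two_sub, of E F C T] by simp

lemma nscale_op [simp]: "nscale (OP E F) c T = (\<lambda>x. scale c (T x))"
  by (simp add: op_space_def bounded_ops_def)

lemma nrm_op_nonneg: "\<lbrakk>subspace E; subspace F; T \<in> points (OP E F)\<rbrakk> \<Longrightarrow> 0 \<le> nrm (OP E F) T"
  by (intro normed_space_on.nrm_nonneg normed_op)

lemma BLI:
  assumes "\<And>x y. T (x + y) = T x + T y" "\<And>c x. T (scale c x) = scale c (T x)" "\<And>x. norm (T x) \<le> C * norm x"
  shows "T \<in> points BL"
  by (rule opI[where C = C]) (use assms in \<open>auto simp: subspace_UNIV\<close>)

lemma BLD:
  assumes "T \<in> points BL"
  shows "T (x + y) = T x + T y" "T (scale c x) = scale c (T x)" "norm (T x) \<le> nrm BL T * norm x"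
    "T 0 = 0" "T (x - y) = T x - T y" "T (- x) = - T x"
proof -
  show add: "T (x + y) = T x + T y" for x y using opD(3)[OF subspace_UNIV subspace_UNIV assms] by simp
  show "T (scale c x) = scale c (T x)" "norm (T x) \<le> nrm BL T * norm x"
    using opD(4,5)[OF subspace_UNIV subspace_UNIV assms] by simp_all
  show z: "T 0 = 0" using add[of 0 0] by simp
  show d: "T (x - y) = T x - T y" for x y using add[of "x - y" y] by simp
  show "T (- x) = - T x" using d[of 0 x] z by simp
qed

lemma BL_nonneg: "T \<in> points BL \<Longrightarrow> 0 \<le> nrm BL T"
  by (intro nrm_op_nonneg subspace_UNIV)

lemma BL_least: "\<lbrakk>0 \<le> C; \<And>x. norm (T x) \<le> C * norm x\<rbrakk> \<Longrightarrow> nrm BL T \<le> C"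
  by (intro nrm_op_least subspace_UNIV)

lemma BL_bounded_linear:
  assumes "T \<in> points BL" shows "bounded_linear T"
proof (rule bounded_linear_intro)
  show "T (x + y) = T x + T y" for x y by (rule BLD[OF assms])
  show "T (r *\<^sub>R x) = r *\<^sub>R T x" for r x
    using BLD(2)[OF assms, of "of_real r" x] by (simp add: scale_of_real)
  show "norm (T x) \<le> norm x * nrm BL T" for x using BLD(3)[OF assms, of x] by (simp add: mult.commute)
qed

lemma linearI_scale:
  assumes "\<And>x y. T (x + y) = T x + T y" "\<And>c x. T (scale c x) = scale c (T x)"
  shows "linear T"
  using assms(1) assms(2)[of "of_real _"] by (intro linearI) (simp_all add: scale_of_real)

lemma BL_id: "id \<in> points BL"
  by (rule BLI[where C = 1]) auto

lemma BL_comp: "\<lbrakk>S \<in> points BL; T \<in> points BL\<rbrakk> \<Longrightarrow> S \<circ> T \<in> points BL"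
proof (rule BLI[where C = "nrm BL S * nrm BL T"])
  assume S: "S \<in> points BL" and T: "T \<in> points BL"
  fix x
  have "norm (S (T x)) \<le> nrm BL S * norm (T x)" by (rule BLD[OF S])
  also have "\<dots> \<le> nrm BL S * (nrm BL T * norm x)" by (intro mult_left_mono BLD[OF T] BL_nonneg S)
  finally show "norm ((S \<circ> T) x) \<le> nrm BL S * nrm BL T * norm x" by (simp add: mult.assoc)
qed (simp_all add: BLD)

lemma algebra_BL: "normed_algebra_on BL (\<circ>)"
proof -
  interpret B: normed_space_on BL by (rule normed_BL)
  show ?thesis
  proof
    fix S T assume S: "S \<in> points BL" and T: "T \<in> points BL"
    show "S \<circ> T \<in> points BL" by (rule BL_comp[OF S T])
    show "nrm BL (S \<circ> T) \<le> 1 * nrm BL S * nrm BL T"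
    proof (rule BL_least)
      fix x
      have "norm (S (T x)) \<le> nrm BL S * norm (T x)" by (rule BLD[OF S])
      also have "\<dots> \<le> nrm BL S * (nrm BL T * norm x)" by (intro mult_left_mono BLD[OF T] BL_nonneg S)
      finally show "norm ((S \<circ> T) x) \<le> 1 * nrm BL S * nrm BL T * norm x" by (simp add: mult.assoc)
    qed (simp add: BL_nonneg S T)
  qed (auto simp: fun_eq_iff BLD)
qed

text \<open>Complementarity in symmetric form: \<open>complements\<close> asks for closedness of one
  of the two subspaces and receives it for the other from membership in the Grassmannian.\<close>

definition cpl :: "'a set \<Rightarrow> 'a set \<Rightarrow> bool" where
  "cpl E F \<longleftrightarrow> closed_subspace scale E \<and> closed_subspace scale F \<and> E \<inter> F = {0} \<and>
     {e + f | e f. e \<in> E \<and> f \<in> F} = UNIV"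

lemma cpl_sym: "cpl E F \<Longrightarrow> cpl F E"
proof -
  have "{e + f | e f. e \<in> E \<and> f \<in> F} = {f + e | f e. f \<in> F \<and> e \<in> E}"
    by (auto simp: add.commute) (metis add.commute)+
  then show "cpl E F \<Longrightarrow> cpl F E" unfolding cpl_def by (simp add: Int_commute)
qed

lemma cplD:
  assumes "cpl E F"
  shows "subspace E" "subspace F" "closed E" "closed F" "x \<in> E \<Longrightarrow> x \<in> F \<Longrightarrow> x = 0"
    "closed_subspace scale E" "closed_subspace scale F"
  using assms by (auto simp: cpl_def closed_subspace_def)

definition proj :: "'a set \<Rightarrow> 'a set \<Rightarrow> 'a \<Rightarrow> 'a" where
  "proj E F x = (THE e. e \<in> E \<and> x - e \<in> F)"

lemma proj_eq:
  assumes "cpl E F" "e \<in> E" "x - e \<in> F" shows "proj E F x = e"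
  unfolding proj_def
proof (rule the_equality)
  fix e' assume e': "e' \<in> E \<and> x - e' \<in> F"
  have "e' - e \<in> E" using e' assms cplD(1) subspace_diff by blast
  moreover have "(x - e) - (x - e') \<in> F" using e' assms cplD(2) subspace_diff by blast
  ultimately have "e' - e = 0" using cplD(5)[OF assms(1), of "e' - e"] by simp
  then show "e' = e" by simp
qed (use assms in simp)

lemma proj_mem:
  assumes "cpl E F" shows "proj E F x \<in> E" "x - proj E F x \<in> F"
proof -
  have "x \<in> {e + f | e f. e \<in> E \<and> f \<in> F}" using assms by (simp add: cpl_def)
  then obtain e f where ef: "x = e + f" "e \<in> E" "f \<in> F" by blast
  then have "proj E F x = e" by (intro proj_eq[OF assms]) auto
  then show "proj E F x \<in> E" "x - proj E F x \<in> F" using ef by auto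
qed

lemma proj_ident: "\<lbrakk>cpl E F; x \<in> E\<rbrakk> \<Longrightarrow> proj E F x = x"
  by (rule proj_eq) (auto dest: cplD(2) simp: subspace_0)

lemma proj_null: "\<lbrakk>cpl E F; x \<in> F\<rbrakk> \<Longrightarrow> proj E F x = 0"
  by (rule proj_eq) (auto dest: cplD(1) simp: subspace_0)

lemma proj_swap: "cpl E F \<Longrightarrow> proj F E x = x - proj E F x"
  by (rule proj_eq) (auto simp: cpl_sym proj_mem)

lemma proj_BL:
  assumes "cpl E F" shows "proj E F \<in> points BL"
proof -
  note c = cplD(1,2)[OF assms]
  have add: "proj E F (x + y) = proj E F x + proj E F y" for x y
  proof (rule proj_eq[OF assms])
    show "proj E F x + proj E F y \<in> E" by (intro subspace_add c proj_mem assms)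
    have "(x - proj E F x) + (y - proj E F y) \<in> F" by (intro subspace_add c proj_mem assms)
    then show "x + y - (proj E F x + proj E F y) \<in> F" by (simp add: algebra_simps)
  qed
  have sc: "proj E F (scale k x) = scale k (proj E F x)" for k x
  proof (rule proj_eq[OF assms])
    show "scale k (proj E F x) \<in> E" by (intro subspace_scale c proj_mem assms)
    have "scale k (x - proj E F x) \<in> F" by (intro subspace_scale c proj_mem assms)
    then show "scale k x - scale k (proj E F x) \<in> F" by (simp add: scale_right_diff_distrib)
  qed
  obtain C where "\<forall>x. norm (proj E F x) \<le> C * norm x"
    using bounded_projection[OF linearI_scale[OF add sc] cplD(3)[OF assms] cplD(4)[OF assms]
        proj_mem(1)[OF assms] proj_mem(2)[OF assms] proj_eq[OF assms]] by blast
  then show ?thesis by (intro BLI[where C = C] add sc) simp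
qed

text \<open>The automorphism \<open>u\<^sub>T\<close> of the introduction, for \<open>T \<in> L(E,F)\<close>.\<close>

definition shear :: "'a set \<Rightarrow> 'a set \<Rightarrow> ('a \<Rightarrow> 'a) \<Rightarrow> 'a \<Rightarrow> 'a" where
  "shear E F T x = x + T (proj E F x)"

lemma ext_BL:
  assumes EF: "cpl E F" and T: "T \<in> points (OP E F)"
  shows "(\<lambda>x. T (proj E F x)) \<in> points BL"
    and "norm (T (proj E F x)) \<le> nrm (OP E F) T * nrm BL (proj E F) * norm x"
proof -
  note p = proj_BL[OF EF]
  note t = opD[OF cplD(1,2)[OF EF] T]
  note m = proj_mem(1)[OF EF]
  show b: "norm (T (proj E F x)) \<le> nrm (OP E F) T * nrm BL (proj E F) * norm x" for x
  proof -
    have "norm (T (proj E F x)) \<le> nrm (OP E F) T * norm (proj E F x)" by (rule t(5)[OF m])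
    also have "\<dots> \<le> nrm (OP E F) T * (nrm BL (proj E F) * norm x)"
      by (intro mult_left_mono BLD[OF p] nrm_op_nonneg cplD[OF EF] T)
    finally show ?thesis by (simp add: mult.assoc)
  qed
  show "(\<lambda>x. T (proj E F x)) \<in> points BL"
    by (rule BLI[OF _ _ b]) (simp_all add: BLD[OF p] t m)
qed

lemma shear_BL:
  assumes EF: "cpl E F" and T: "T \<in> points (OP E F)"
  shows "shear E F T \<in> points BL" "shear E F (- T) \<in> points BL"
proof -
  interpret B: normed_space_on BL by (rule normed_BL)
  have "id + (\<lambda>x. T (proj E F x)) \<in> points BL" "id - (\<lambda>x. T (proj E F x)) \<in> points BL"
    by (intro B.add_mem B.diff_mem BL_id ext_BL[OF EF T])+
  moreover have "shear E F T = id + (\<lambda>x. T (proj E F x))" "shear E F (- T) = id - (\<lambda>x. T (proj E F x))"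
    by (auto simp: fun_eq_iff shear_def)
  ultimately show "shear E F T \<in> points BL" "shear E F (- T) \<in> points BL" by simp_all
qed

text \<open>T takes values in F, where the projection onto E vanishes. So
  \<open>T \<circ> proj E F\<close> has square zero, and changing its sign inverts the
  shear.\<close>

lemma shear_inverse:
  assumes EF: "cpl E F" and T: "T \<in> points (OP E F)"
  shows "shear E F T (shear E F (- T) x) = x" "shear E F (- T) (shear E F T x) = x"
  using opD(6)[OF cplD(1,2)[OF EF] T, of "proj E F x"]
  by (simp_all add: shear_def BLD[OF proj_BL[OF EF]] proj_null[OF EF])

lemma shear_image: "cpl E F \<Longrightarrow> shear E F T ` E = graph_map E T"
  by (auto simp: shear_def graph_map_def proj_ident)

lemma shear_0 [simp]: "shear E F 0 = id"
  by (auto simp: shear_def fun_eq_iff)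

section \<open>Automorphisms and the graph charts\<close>

text \<open>An automorphism together with its inverse as a named function; in a family the inverse
  then is a function of the parameter that can itself be shown analytic.\<close>

definition unit_pair :: "('a \<Rightarrow> 'a) \<Rightarrow> ('a \<Rightarrow> 'a) \<Rightarrow> bool" where
  "unit_pair g g' \<longleftrightarrow> g \<in> points BL \<and> g' \<in> points BL \<and> (\<forall>x. g (g' x) = x) \<and> (\<forall>x. g' (g x) = x)"

lemma unit_pair_sym: "unit_pair g g' \<Longrightarrow> unit_pair g' g" by (auto simp: unit_pair_def)

lemma unit_pair_comp: "\<lbrakk>unit_pair g g'; unit_pair h h'\<rbrakk> \<Longrightarrow> unit_pair (g \<circ> h) (h' \<circ> g')"
  by (auto simp: unit_pair_def intro: BL_comp)

lemma unit_pair_shear: "\<lbrakk>cpl E F; T \<in> points (OP E F)\<rbrakk> \<Longrightarrow> unit_pair (shear E F T) (shear E F (- T))"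
  by (simp add: unit_pair_def shear_BL shear_inverse)

text \<open>As a preimage the set inherits closedness from E by continuity of the inverse.\<close>

lemma unit_pair_image_eq: "unit_pair g g' \<Longrightarrow> g ` E = g' -` E"
proof (intro equalityI subsetI)
  fix x assume g: "unit_pair g g'" and "x \<in> g' -` E"
  then have "g' x \<in> E" "x = g (g' x)" by (simp_all add: unit_pair_def)
  then show "x \<in> g ` E" by blast
qed (auto simp: unit_pair_def)

lemma unit_pair_closed_subspace:
  assumes g: "unit_pair g g'" and E: "closed_subspace scale E"
  shows "closed_subspace scale (g ` E)"
proof -
  have g': "g' \<in> points BL" using g by (simp add: unit_pair_def)
  have E: "subspace E" "closed E" using E by (auto simp: closed_subspace_def)
  have "closed (g' -` E)"
    using continuous_closed_vimage[OF E(2)] linear_continuous_at[OF BL_bounded_linear[OF g']] by blast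
  moreover have "subspace (g' -` E)"
    using E(1) by (auto simp: subspace_def BLD[OF g'])
  ultimately show ?thesis unfolding unit_pair_image_eq[OF g] closed_subspace_def by simp
qed

lemma unit_pair_cpl:
  assumes g: "unit_pair g g'" and EF: "cpl E F" shows "cpl (g ` E) (g ` F)"
  unfolding cpl_def
proof (intro conjI unit_pair_closed_subspace[OF g] cplD(6,7)[OF EF])
  have gB: "g \<in> points BL" using g by (simp add: unit_pair_def)
  have inj: "inj g" using g by (metis injI unit_pair_def)
  show "g ` E \<inter> g ` F = {0}"
    using EF image_Int[OF inj, of E F] by (simp add: cpl_def BLD(4)[OF gB])
  have "x \<in> {e + f | e f. e \<in> g ` E \<and> f \<in> g ` F}" for x
  proof -
    have "x = g (proj E F (g' x)) + g (g' x - proj E F (g' x))"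
      using g by (simp add: BLD(1)[OF gB, symmetric] unit_pair_def)
    then show ?thesis using proj_mem[OF EF, of "g' x"] by blast
  qed
  then show "{e + f | e f. e \<in> g ` E \<and> f \<in> g ` F} = UNIV" by blast
qed

lemma shear_fixes: "\<lbrakk>cpl E F; T \<in> points (OP E F)\<rbrakk> \<Longrightarrow> shear E F T ` F = F"
proof -
  assume EF: "cpl E F" and T: "T \<in> points (OP E F)"
  have "T 0 = 0" using opD(3)[OF cplD(1,2)[OF EF] T, of 0 0] subspace_0[OF cplD(1)[OF EF]] by simp
  then show ?thesis by (auto simp: shear_def proj_null[OF EF])
qed

lemma graph_cpl: "\<lbrakk>cpl E F; T \<in> points (OP E F)\<rbrakk> \<Longrightarrow> cpl (graph_map E T) F"
  using unit_pair_cpl[OF unit_pair_shear, of E F T E F] by (simp add: shear_image shear_fixes)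

text \<open>\<open>slope E F\<close> is \<open>p\<^bsub>E,F\<^esub>\<close>.\<close>

definition slope :: "'a set \<Rightarrow> 'a set \<Rightarrow> 'a set \<Rightarrow> 'a \<Rightarrow> 'a" where
  "slope E F E' = (\<lambda>x. if x \<in> E then proj E' F x - x else 0)"

lemma slope_op:
  assumes EF: "cpl E F" and E': "cpl E' F"
  shows "slope E F E' \<in> points (OP E F)"
proof -
  note p = proj_BL[OF E']
  note s = cplD(1,2)[OF EF]
  have F: "proj E' F x - x \<in> F" for x
    using subspace_neg[OF s(2) proj_mem(2)[OF E', of x]] by simp
  show ?thesis
  proof (rule opI[OF s, where C = "nrm BL (proj E' F) + 1"])
    fix x assume x: "x \<in> E"
    show "norm (slope E F E' x) \<le> (nrm BL (proj E' F) + 1) * norm x"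
      using norm_triangle_ineq4[of "proj E' F x" x] BLD(3)[OF p, of x] x by (simp add: slope_def distrib_right)
  qed (auto simp: slope_def F BLD[OF p] subspace_add s subspace_scale scale_right_diff_distrib)
qed

text \<open>Adding the slope to x in E gives \<open>proj E' F x\<close>. Restricted to E this
  projection is onto E', because a point of E' and its component in E differ by an element of
  F.\<close>

lemma graph_slope:
  assumes EF: "cpl E F" and E': "cpl E' F"
  shows "graph_map E (slope E F E') = E'"
proof -
  have "graph_map E (slope E F E') = proj E' F ` E"
    by (auto simp: graph_map_def slope_def image_iff)
  also have "\<dots> = E'"
  proof (intro equalityI subsetI)
    fix y assume y: "y \<in> E'"
    have "proj E' F (proj E F y) = proj E' F (y - (y - proj E F y))" by simp
    also have "\<dots> = proj E' F y - proj E' F (y - proj E F y)" by (rule BLD[OF proj_BL[OF E']])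
    also have "\<dots> = y" by (simp add: proj_ident[OF E' y] proj_null[OF E' proj_mem(2)[OF EF]])
    finally have "y = proj E' F (proj E F y)" by simp
    then show "y \<in> proj E' F ` E" using proj_mem(1)[OF EF] by blast
  qed (auto simp: proj_mem[OF E'])
  finally show ?thesis .
qed

text \<open>For x in E the decomposition along the graph and F is x = (x + T x) - T x.\<close>

lemma slope_graph:
  assumes EF: "cpl E F" and T: "T \<in> points (OP E F)"
  shows "slope E F (graph_map E T) = T"
proof
  fix x
  note t = opD[OF cplD(1,2)[OF EF] T]
  show "slope E F (graph_map E T) x = T x"
  proof (cases "x \<in> E")
    case True
    have "- T x \<in> F" using t(6) subspace_neg cplD(2)[OF EF] by blast
    then have "proj (graph_map E T) F x = x + T x"
      using True by (intro proj_eq graph_cpl[OF EF T]) (auto simp: graph_map_def)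
    then show ?thesis using True by (simp add: slope_def)
  qed (simp add: slope_def t)
qed

end

section \<open>Analytic families of automorphisms acting on subspaces\<close>

context banach_scaling begin

text \<open>Inverses satisfy the resolvent identity
  \<open>g' x = g' a - g' a (g x - g a) g' x\<close>.\<close>

lemma analytic_inverse:
  assumes V: "normed_space_on V" and g: "nspace_analytic V BL U g"
    and u: "\<And>x. x \<in> U \<Longrightarrow> unit_pair (g x) (g' x)"
  shows "nspace_analytic V BL U g'"
proof -
  interpret B: normed_algebra_on BL "(\<circ>)" by (rule algebra_BL)
  show ?thesis
  proof (rule B.analytic_pseudo_inverse[OF V g])
    show "g' x \<in> points BL" if "x \<in> U" for x using u[OF that] by (simp add: unit_pair_def)
    fix a x assume "a \<in> U" "x \<in> U"
    then have a: "unit_pair (g a) (g' a)" and x: "unit_pair (g x) (g' x)" by (simp_all add: u)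
    show "g' x = g' a - (g' a \<circ> ((g x - g a) \<circ> g' x))"
    proof
      fix y
      have "g' a (g x (g' x y) - g a (g' x y)) = g' a (g x (g' x y)) - g' a (g a (g' x y))"
        using a by (intro BLD) (simp add: unit_pair_def)
      then show "g' x y = (g' a - (g' a \<circ> ((g x - g a) \<circ> g' x))) y"
        using a x by (simp add: unit_pair_def)
    qed
  qed
qed

lemma analytic_comp:
  assumes V: "normed_space_on V" and f: "nspace_analytic V BL U f" and g: "nspace_analytic V BL U g"
  shows "nspace_analytic V BL U (\<lambda>x. f x \<circ> g x)"
proof -
  interpret B: normed_algebra_on BL "(\<circ>)" by (rule algebra_BL)
  show ?thesis by (rule B.analytic_bilinear[OF V f g])
qed

lemma analytic_const_BL:
  assumes "normed_space_on V" "openin (ntop V) U" "T \<in> points BL"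
  shows "nspace_analytic V BL U (\<lambda>_. T)"
  using assms normed_BL by (intro two_spaces.analytic_const) (auto simp: two_spaces_def)

text \<open>The shear is the identity plus a bounded linear function of its operator.\<close>

lemma analytic_shear:
  assumes V: "normed_space_on V" and EF: "cpl E F" and f: "nspace_analytic V (OP E F) U f"
  shows "nspace_analytic V BL U (\<lambda>x. shear E F (f x))"
proof -
  note s = cplD(1,2)[OF EF]
  interpret V: normed_space_on V by fact
  interpret O: normed_space_on "OP E F" by (rule normed_op[OF s])
  interpret B: normed_space_on BL by (rule normed_BL)
  interpret VO: two_spaces V "OP E F" by unfold_locales
  interpret VB: two_spaces V BL by unfold_locales
  have "nspace_analytic V BL U (\<lambda>x. (\<lambda>y. f x (proj E F y)))"
  proof (rule VO.analytic_compose_linear[OF f normed_BL, where K = "nrm BL (proj E F)"])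
    show "linear_map_on (OP E F) BL (\<lambda>T y. T (proj E F y))"
      using ext_BL[OF EF] by (auto simp: linear_map_on_def fun_eq_iff)
    show "nrm BL (\<lambda>y. T (proj E F y)) \<le> nrm BL (proj E F) * nrm (OP E F) T" if "T \<in> points (OP E F)" for T
      using ext_BL(2)[OF EF that] nrm_op_nonneg[OF s that] BL_nonneg[OF proj_BL[OF EF]]
      by (intro BL_least) (simp_all add: mult.commute)
  qed
  then have "nspace_analytic V BL U (\<lambda>x. id + (\<lambda>y. f x (proj E F y)))"
    by (intro VB.analytic_add analytic_const_BL V BL_id analyticD(1)[OF f])
  then show ?thesis
    by (rule VB.analytic_cong) (simp add: shear_def fun_eq_iff)
qed

text \<open>The extension of the inverse of \<open>p\<^sub>1 g : F0 \<rightarrow> F1\<close> to \<open>X\<close>.\<close>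

definition transfer :: "'a set \<Rightarrow> 'a set \<Rightarrow> 'a set \<Rightarrow> ('a \<Rightarrow> 'a) \<Rightarrow> ('a \<Rightarrow> 'a) \<Rightarrow> 'a \<Rightarrow> 'a" where
  "transfer F0 F1 E1 g g' = g' \<circ> (proj (g ` F0) E1 \<circ> proj F1 E1)"

text \<open>Projecting along \<open>E1\<close> from \<open>F1\<close> to \<open>g\<close>
  F0\<open>and from\<close>g \<open>F0\<close> to \<open>F1\<close> are inverse to each other, as
  both projections have the same kernel. Hence k and f are generalized inverses in the algebra: f
  after k is the projection onto \<open>F1\<close>, and k after f the one onto
  \<open>F0\<close>.\<close>

lemma transfer:
  assumes u: "unit_pair g g'" and c0: "cpl F0 E0" and c1: "cpl F1 E1" and c: "cpl (g ` F0) E1"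
  defines "k \<equiv> transfer F0 F1 E1 g g'" and "f \<equiv> proj F1 E1 \<circ> (g \<circ> proj F0 E0)"
  shows "k \<in> points BL" "k y \<in> F0" "g (k y) = proj (g ` F0) E1 (proj F1 E1 y)"
    "f (k y) = proj F1 E1 y" "k (f z) = proj F0 E0 z" "k (proj F1 E1 y) = k y"
proof -
  have g: "g \<in> points BL" "g' \<in> points BL" "\<And>x. g (g' x) = x" "\<And>x. g' (g x) = x"
    using u by (auto simp: unit_pair_def)
  show "k \<in> points BL" unfolding k_def transfer_def by (intro BL_comp g proj_BL c c1)
  have "proj (g ` F0) E1 (proj F1 E1 y) \<in> g ` F0" for y by (rule proj_mem[OF c])
  then have "k y \<in> g' ` g ` F0" for y unfolding k_def transfer_def by simp
  then show kF: "k y \<in> F0" for y by (simp add: image_image g)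
  show gk: "g (k y) = proj (g ` F0) E1 (proj F1 E1 y)" for y by (simp add: k_def transfer_def g)
  have p1: "proj F1 E1 (v - w) = proj F1 E1 v - proj F1 E1 w" for v w by (rule BLD[OF proj_BL[OF c1]])
  have p: "proj (g ` F0) E1 (v - w) = proj (g ` F0) E1 v - proj (g ` F0) E1 w" for v w by (rule BLD[OF proj_BL[OF c]])
  have idem: "proj F1 E1 (proj F1 E1 v) = proj F1 E1 v" for v by (rule proj_ident[OF c1 proj_mem(1)[OF c1]])
  show "f (k y) = proj F1 E1 y" for y
    using proj_null[OF c1 proj_mem(2)[OF c, of "proj F1 E1 y"]]
    by (simp add: f_def proj_ident[OF c0 kF] gk p1 idem)
  have "proj (g ` F0) E1 (proj F1 E1 v) = v" if "v \<in> g ` F0" for v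
    using proj_null[OF c proj_mem(2)[OF c1, of v]] by (simp add: p proj_ident[OF c that])
  then show "k (f z) = proj F0 E0 z" for z
    using proj_mem(1)[OF c0] by (simp add: k_def transfer_def f_def idem g)
  show "k (proj F1 E1 y) = k y" for y by (simp add: k_def transfer_def idem)
qed

lemma cpl_iff_bij:
  assumes u: "unit_pair g g'" and c0: "cpl F0 E0" and c1: "cpl F1 E1"
  shows "cpl (g ` F0) E1 \<longleftrightarrow> bij_betw (\<lambda>z. proj F1 E1 (g z)) F0 F1"
proof
  assume c: "cpl (g ` F0) E1"
  note t = transfer[OF u c0 c1 c]
  show "bij_betw (\<lambda>z. proj F1 E1 (g z)) F0 F1"
  proof (rule bij_betw_byWitness[where f' = "transfer F0 F1 E1 g g'"])
    show "\<forall>z\<in>F0. transfer F0 F1 E1 g g' (proj F1 E1 (g z)) = z"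
    proof
      fix z assume "z \<in> F0"
      then show "transfer F0 F1 E1 g g' (proj F1 E1 (g z)) = z"
        using t(5)[of z] by (simp add: proj_ident[OF c0])
    qed
    show "\<forall>y\<in>F1. proj F1 E1 (g (transfer F0 F1 E1 g g' y)) = y"
      using t(2,4) by (simp add: proj_ident[OF c0] proj_ident[OF c1])
  qed (use t(2) proj_mem(1)[OF c1] in auto)
next
  assume b: "bij_betw (\<lambda>z. proj F1 E1 (g z)) F0 F1"
  have gB: "g \<in> points BL" using u by (simp add: unit_pair_def)
  have z0: "0 \<in> F0" "0 \<in> E1" "0 \<in> F1" using cplD(1,2)[OF c0] cplD(1,2)[OF c1] by (auto simp: subspace_0)
  show "cpl (g ` F0) E1"
    unfolding cpl_def
  proof (intro conjI unit_pair_closed_subspace[OF u cplD(6)[OF c0]] cplD(7)[OF c1])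
    have "z = 0" if "z \<in> F0" "g z \<in> E1" for z
    proof -
      have "proj F1 E1 (g z) = proj F1 E1 (g 0)"
        using that(2) z0 by (simp add: proj_null[OF c1] BLD(4)[OF gB])
      then show ?thesis using inj_onD[OF bij_betw_imp_inj_on[OF b] _ that(1) z0(1)] by simp
    qed
    then show "g ` F0 \<inter> E1 = {0}" using z0 BLD(4)[OF gB] by (auto simp: image_iff intro!: bexI[of _ 0])
    have "y \<in> {e + f | e f. e \<in> g ` F0 \<and> f \<in> E1}" for y
    proof -
      have "proj F1 E1 y \<in> (\<lambda>z. proj F1 E1 (g z)) ` F0"
        unfolding bij_betw_imp_surj_on[OF b] by (rule proj_mem[OF c1])
      then obtain z where z: "z \<in> F0" "proj F1 E1 (g z) = proj F1 E1 y" by auto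
      have "proj F1 E1 (y - g z) = 0" using z BLD(5)[OF proj_BL[OF c1]] by simp
      then have "y - g z \<in> E1" using proj_mem(2)[OF c1, of "y - g z"] by simp
      moreover have "y = g z + (y - g z)" by simp
      ultimately show ?thesis using z(1) by blast
    qed
    then show "{e + f | e f. e \<in> g ` F0 \<and> f \<in> E1} = UNIV" by blast
  qed
qed

text \<open>Preimages of y are fixed points of the contraction \<open>w \<mapsto> y - N w\<close>.
  The fixed point is found in the complete space X and lies in F because y and the values of N
  do.\<close>

lemma small_perturbation_bij:
  assumes N: "N \<in> points BL" "0 \<le> c" "c < 1" "\<And>x. norm (N x) \<le> c * norm x" and F: "subspace F" "\<And>x. N x \<in> F"
  shows "bij_betw (\<lambda>z. z + N z) F F"
proof (rule bij_betwI')
  fix x y assume "x \<in> F" "y \<in> F"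
  show "x + N x = y + N y \<longleftrightarrow> x = y"
  proof
    assume e: "x + N x = y + N y"
    have "(x + N x) - (y + N y) = 0" using e by simp
    then have "x - y = - N (x - y)"
      unfolding add_diff_add BLD(5)[OF N(1)] by (simp only: eq_neg_iff_add_eq_0)
    then have "norm (x - y) \<le> c * norm (x - y)" using N(4)[of "x - y"] by (metis norm_minus_cancel)
    then have "norm (x - y) = 0" using N(3) by (smt (verit) mult_less_cancel_right2 norm_ge_zero)
    then show "x = y" by simp
  qed simp
next
  fix x assume "x \<in> F" then show "x + N x \<in> F" using F by (intro subspace_add) auto
next
  fix y assume y: "y \<in> F"
  have "\<exists>!w. (y - N w) = w"
  proof (rule banach_fix_type[OF N(2,3)], intro allI)
    fix v w
    have "dist (y - N v) (y - N w) = norm (N (w - v))"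
      using BLD(5)[OF N(1), of w v] by (simp add: dist_norm)
    also have "\<dots> \<le> c * dist v w" using N(4)[of "w - v"] by (simp add: dist_norm norm_minus_commute)
    finally show "dist (y - N v) (y - N w) \<le> c * dist v w" .
  qed
  then obtain w where w: "y - N w = w" by blast
  have "w \<in> F" using subspace_diff[OF F(1) y F(2)[of w]] w by simp
  moreover have "y = w + N w" using w by (metis diff_add_cancel)
  ultimately show "\<exists>x\<in>F. y = x + N x" by blast
qed

text \<open>By \<open>cpl_iff_bij\<close> the condition is bijectivity of a compression of g x. Near
  a this compression factors into the one at a and I + N with N small on \<open>F0\<close>.\<close>

theorem openin_cpl_image:
  assumes V: "normed_space_on V" and g: "nspace_analytic V BL U g"
    and u: "\<And>x. x \<in> U \<Longrightarrow> unit_pair (g x) (g' x)"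
    and c0: "cpl F0 E0" and c1: "cpl F1 E1"
  shows "openin (ntop V) {x \<in> U. cpl (g x ` F0) E1}"
proof -
  interpret V: normed_space_on V by fact
  interpret B: normed_space_on BL by (rule normed_BL)
  interpret VB: two_spaces V BL by unfold_locales
  note opU = analyticD(1)[OF g]
  define f where "f = (\<lambda>x. proj F1 E1 \<circ> (g x \<circ> proj F0 E0))"
  have f: "nspace_analytic V BL U f"
    unfolding f_def by (intro analytic_comp V g analytic_const_BL opU proj_BL c0 c1)
  show ?thesis
    unfolding V.openin_ntop
  proof (intro conjI ballI)
    show "{x \<in> U. cpl (g x ` F0) E1} \<subseteq> points V" using opU by (auto simp: V.openin_ntop)
    fix a assume "a \<in> {x \<in> U. cpl (g x ` F0) E1}"
    then have a: "a \<in> U" "cpl (g a ` F0) E1" by auto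
    define k where "k = transfer F0 F1 E1 (g a) (g' a)"
    note t = transfer[OF u[OF a(1)] c0 c1 a(2), folded k_def]
    \<comment> \<open>The summand 1 permits division; closeness within
      \<open>1 / (nrm BL k + 1)\<close> makes the contraction constant of \<open>k \<circ> D\<close>
      less than 1.\<close>
    have kn: "nrm BL k + 1 > 0" using BL_nonneg[OF t(1)] by simp
    then have "1 / (nrm BL k + 1) > 0" by simp
    from VB.analytic_near[OF f a(1) this] obtain d where d: "d > 0"
      "\<forall>y\<in>points V. nrm V (y - a) < d \<longrightarrow> y \<in> U \<and> nrm BL (f y - f a) < 1 / (nrm BL k + 1)" by blast
    have "cpl (g x ` F0) E1" if x: "x \<in> U" and near: "nrm BL (f x - f a) < 1 / (nrm BL k + 1)" for x
    proof -
      have fB: "f x \<in> points BL" "f a \<in> points BL" using analyticD(2)[OF f] x a by auto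
      define D where "D = f x - f a"
      have D: "D \<in> points BL" unfolding D_def by (intro B.diff_mem fB)
      have DF: "D z \<in> F1" for z
        unfolding D_def f_def using proj_mem(1)[OF c1] subspace_diff[OF cplD(1)[OF c1]] by simp
      define N where "N = k \<circ> D"
      have N: "N \<in> points BL" unfolding N_def by (intro BL_comp t D)
      define c where "c = nrm BL k * nrm BL D"
      have c: "0 \<le> c" unfolding c_def using BL_nonneg t(1) D by simp
      have "c \<le> (nrm BL k + 1) * nrm BL D" unfolding c_def using BL_nonneg[OF D] by (intro mult_right_mono) auto
      also have "\<dots> < 1" using near kn by (simp add: D_def field_simps)
      finally have c1': "c < 1" .
      have nN: "norm (N z) \<le> c * norm z" for z
      proof -
        have "norm (N z) \<le> nrm BL k * norm (D z)" unfolding N_def comp_def by (rule BLD[OF t(1)])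
        also have "\<dots> \<le> nrm BL k * (nrm BL D * norm z)" by (intro mult_left_mono BLD[OF D] BL_nonneg t)
        finally show ?thesis by (simp add: c_def mult.assoc)
      qed
      have b1: "bij_betw (\<lambda>z. z + N z) F0 F0"
        by (rule small_perturbation_bij[OF N c c1' nN cplD(1)[OF c0]]) (simp add: N_def t)
      have b2: "bij_betw (\<lambda>z. proj F1 E1 (g a z)) F0 F1"
        using cpl_iff_bij[OF u[OF a(1)] c0 c1] a by blast
      have "proj F1 E1 (g x z) = ((\<lambda>z. proj F1 E1 (g a z)) \<circ> (\<lambda>z. z + N z)) z" if z: "z \<in> F0" for z
      proof -
        have fz: "f y w = proj F1 E1 (g y w)" if "w \<in> F0" for y w by (simp add: f_def proj_ident[OF c0 that])
        have NF: "N z \<in> F0" by (simp add: N_def t)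
        \<comment> \<open>Since k is a right inverse of f a on \<open>F1\<close>, the perturbation D
          is absorbed as \<open>f a \<circ> N\<close>, which gives f x = f a (I + N) on
          \<open>F0\<close>.\<close>
        have "f a (N z) = D z" using t(4)[of "D z"] by (simp add: N_def f_def proj_ident[OF c1 DF])
        then have "f a (z + N z) = f x z" using BLD(1)[OF fB(2)] by (simp add: D_def)
        then show ?thesis using fz[OF z] fz[OF subspace_add[OF cplD(1)[OF c0] z NF]] by simp
      qed
      then have "bij_betw (\<lambda>z. proj F1 E1 (g x z)) F0 F1"
        using bij_betw_trans[OF b1 b2] by (subst bij_betw_cong) auto
      then show ?thesis using cpl_iff_bij[OF u[OF x] c0 c1] by blast
    qed
    then show "\<exists>r>0. \<forall>y\<in>points V. nrm V (y - a) < r \<longrightarrow> y \<in> {x \<in> U. cpl (g x ` F0) E1}"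
      using d by blast
  qed
qed

theorem analytic_slope_image:
  assumes V: "normed_space_on V" and g: "nspace_analytic V BL U g"
    and u: "\<And>x. x \<in> U \<Longrightarrow> unit_pair (g x) (g' x)"
    and c0: "cpl F0 E0" and c1: "cpl F1 E1"
  shows "nspace_analytic V (OP F1 E1) {x \<in> U. cpl (g x ` F0) E1} (\<lambda>x. slope F1 E1 (g x ` F0))"
proof -
  interpret V: normed_space_on V by fact
  interpret A: normed_algebra_on BL "(\<circ>)" by (rule algebra_BL)
  interpret B: normed_space_on BL by (rule normed_BL)
  interpret VB: two_spaces V BL by unfold_locales
  note s1 = cplD(1,2)[OF c1]
  interpret O: normed_space_on "OP F1 E1" by (rule normed_op[OF s1])
  interpret VO: two_spaces V "OP F1 E1" by unfold_locales
  define U' where "U' = {x \<in> U. cpl (g x ` F0) E1}"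
  have op': "openin (ntop V) U'" unfolding U'_def by (rule openin_cpl_image[OF V g u c0 c1])
  have g': "nspace_analytic V BL U' g" by (rule VB.analytic_subset[OF g op']) (auto simp: U'_def)
  define f where "f = (\<lambda>x. proj F1 E1 \<circ> (g x \<circ> proj F0 E0))"
  have f: "nspace_analytic V BL U' f"
    unfolding f_def by (intro analytic_comp V g' analytic_const_BL op' proj_BL c0 c1)
  define k where "k = (\<lambda>x. transfer F0 F1 E1 (g x) (g' x))"
  have t: "k x \<in> points BL" "k x y \<in> F0" "g x (k x y) = proj (g x ` F0) E1 (proj F1 E1 y)"
    "f x (k x y) = proj F1 E1 y" "k x (f x z) = proj F0 E0 z" "k x (proj F1 E1 y) = k x y" if "x \<in> U'" for x y z
  proof -
    have x: "x \<in> U" "cpl (g x ` F0) E1" using that by (auto simp: U'_def)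
    show "k x \<in> points BL" "k x y \<in> F0" "g x (k x y) = proj (g x ` F0) E1 (proj F1 E1 y)"
    "f x (k x y) = proj F1 E1 y" "k x (f x z) = proj F0 E0 z" "k x (proj F1 E1 y) = k x y"
      unfolding k_def f_def by (rule transfer[OF u[OF x(1)] c0 c1 x(2)])+
  qed
  \<comment> \<open>The identity holds since \<open>k a (f x (k x y))\<close> is
    \<open>k a y\<close> by the projection onto \<open>F1\<close>, and
    \<open>k a (f a (k x y))\<close> is \<open>k x y\<close> by the projection onto
    \<open>F0\<close>.\<close>
  have k: "nspace_analytic V BL U' k"
  proof (rule A.analytic_pseudo_inverse[OF V f t(1)])
    fix a x assume ax: "a \<in> U'" "x \<in> U'"
    show "k x = k a - (k a \<circ> ((f x - f a) \<circ> k x))"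
    proof
      fix y
      have "(k a \<circ> ((f x - f a) \<circ> k x)) y = k a (f x (k x y)) - k a (f a (k x y))"
        by (simp add: BLD(5)[OF t(1)[OF ax(1)]])
      also have "\<dots> = k a y - k x y"
        using ax by (simp add: t proj_ident[OF c0 t(2)[OF ax(2)]])
      finally show "k x y = (k a - (k a \<circ> ((f x - f a) \<circ> k x))) y" by simp
    qed
  qed
  \<comment> \<open>Subtracting \<open>proj F1 E1 (M y)\<close> in place of y makes the map linear
    in M with values in \<open>E1\<close> for every M; for M = g x composed with k x the two
    agree.\<close>
  define R where "R = (\<lambda>M y. if y \<in> F1 then M y - proj F1 E1 (M y) else (0::'a))"
  define C where "C = 1 + nrm BL (proj F1 E1)"
  have pB: "proj F1 E1 \<in> points BL" by (rule proj_BL[OF c1])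
  have C: "C \<ge> 0" using BL_nonneg[OF pB] by (simp add: C_def)
  have Rb: "norm (R M y) \<le> (C * nrm BL M) * norm y" if M: "M \<in> points BL" for M y
  proof (cases "y \<in> F1")
    case True
    have "norm (R M y) \<le> norm (M y) + nrm BL (proj F1 E1) * norm (M y)"
      using True norm_triangle_ineq4[of "M y" "proj F1 E1 (M y)"] BLD(3)[OF pB, of "M y"] by (simp add: R_def)
    also have "\<dots> = C * norm (M y)" by (simp add: C_def distrib_right)
    also have "\<dots> \<le> C * (nrm BL M * norm y)" by (intro mult_left_mono BLD[OF M] C)
    finally show ?thesis by (simp add: mult.assoc)
  next
    case False
    then show ?thesis using C BL_nonneg[OF M] by (simp add: R_def)
  qed
  have Rm: "R M \<in> points (OP F1 E1)" if M: "M \<in> points BL" for M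
  proof (rule opI[OF s1 _ _ _ _ Rb[OF M]])
  qed (auto simp: R_def proj_mem[OF c1] BLD[OF M] BLD[OF pB] subspace_add s1 subspace_scale scale_right_diff_distrib)
  have "nspace_analytic V (OP F1 E1) U' (\<lambda>x. R (g x \<circ> k x))"
  proof (rule VB.analytic_compose_linear[OF analytic_comp[OF V g' k] O.normed_space_on_axioms, where K = C])
    show "linear_map_on BL (OP F1 E1) R"
      unfolding linear_map_on_def using Rm
      by (auto simp: R_def fun_eq_iff BLD[OF pB] scale_right_diff_distrib)
    show "nrm (OP F1 E1) (R M) \<le> C * nrm BL M" if "M \<in> points BL" for M
      using Rb[OF that] C BL_nonneg[OF that] by (intro nrm_op_least s1) auto
  qed
  then have "nspace_analytic V (OP F1 E1) U' (\<lambda>x. slope F1 E1 (g x ` F0))"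
  proof (rule VO.analytic_cong)
    fix x assume x: "x \<in> U'"
    show "R (g x \<circ> k x) = slope F1 E1 (g x ` F0)"
    proof
      fix y
      have "proj F1 E1 (g x (k x y)) = y" if "y \<in> F1"
        using t(4)[OF x, of y] by (simp add: f_def proj_ident[OF c0 t(2)[OF x]] proj_ident[OF c1 that])
      then show "R (g x \<circ> k x) y = slope F1 E1 (g x ` F0) y"
        using t(3)[OF x, of y] by (simp add: R_def slope_def proj_ident[OF c1])
    qed
  qed
  then show ?thesis by (simp only: U'_def)
qed

section \<open>The topology of the Grassmannian\<close>

abbreviation Gr :: "'a set set" where "Gr \<equiv> Grassmannian scale"

text \<open>The pairs that index the charts: F determines the domain, and E is the subspace with
  coordinate 0.\<close>

definition gpair :: "'a set \<Rightarrow> 'a set \<Rightarrow> bool" where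
  "gpair E F \<longleftrightarrow> F \<in> Gr \<and> E \<in> complements scale F"

lemma complements_iff: "F \<in> Gr \<Longrightarrow> E \<in> complements scale F \<longleftrightarrow> cpl E F"
  by (auto simp: complements_def cpl_def Grassmannian_def)

lemma gpair_iff: "gpair E F \<longleftrightarrow> cpl E F \<and> F \<in> Gr"
  using complements_iff unfolding gpair_def by blast

lemma gpairD: "gpair E F \<Longrightarrow> cpl E F" "gpair E F \<Longrightarrow> F \<in> Gr"
  by (simp_all add: gpair_iff)

lemma cpl_Gr:
  assumes c: "cpl E F" and F: "F \<in> Gr" shows "E \<in> Gr"
proof -
  have "E \<noteq> {0}"
  proof
    assume "E = {0}"
    then have "F = UNIV" using c by (simp add: cpl_def)
    then show False using F by (simp add: Grassmannian_def)
  qed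
  moreover have "E \<noteq> UNIV"
    using c F by (auto simp: cpl_def Grassmannian_def)
  moreover have "F \<in> complements scale E"
    using cpl_sym[OF c] by (simp add: cpl_def complements_def)
  ultimately show ?thesis
    using cplD(6)[OF c] by (auto simp: Grassmannian_def)
qed

lemma gpair_sym: "gpair E F \<Longrightarrow> gpair F E"
  unfolding gpair_iff using cpl_sym cpl_Gr by blast

lemma Gr_gpair: "F \<in> Gr \<Longrightarrow> \<exists>E. gpair E F"
  unfolding gpair_def by (auto simp: Grassmannian_def)

lemma Gr_gpair': "E \<in> Gr \<Longrightarrow> \<exists>F. gpair E F"
  using Gr_gpair[of E] gpair_sym by auto

lemma zero_op: "cpl E F \<Longrightarrow> 0 \<in> points (OP E F)"
  by (intro normed_space_on.zero_mem normed_op cplD)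

lemma graph_0 [simp]: "graph_map E 0 = E"
  by (simp add: graph_map_def)

lemma openin_points: "normed_space_on V \<Longrightarrow> openin (ntop V) (points V)"
  using openin_topspace[of "ntop V"] by (simp add: normed_space_on.topspace_ntop)

lemma analytic_id:
  assumes "normed_space_on V" "openin (ntop V) U" shows "nspace_analytic V V U (\<lambda>x. x)"
proof -
  interpret normed_space_on V by fact
  interpret two_spaces V V by unfold_locales
  show ?thesis by (rule analytic_linear[OF assms(2), where K = 1]) (auto simp: linear_map_on_def)
qed

lemma analytic_shear_chart:
  assumes EF: "cpl E F"
  shows "nspace_analytic (OP E F) BL (points (OP E F)) (shear E F)"
  using analytic_shear[OF normed_op EF analytic_id[OF normed_op openin_points[OF normed_op]]] cplD[OF EF]
  by simp

text \<open>The topology seen from all charts at once. It is shown to be the generated topology and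
  allows openness to be checked in coordinates.\<close>

definition slope_open :: "'a set set \<Rightarrow> bool" where
  "slope_open S \<longleftrightarrow> S \<subseteq> Gr \<and>
     (\<forall>E F. gpair E F \<longrightarrow> openin (ntop (OP E F)) {T \<in> points (OP E F). graph_map E T \<in> S})"

lemma istopology_slope_open: "istopology slope_open"
  unfolding istopology_def
proof (intro conjI allI impI)
  fix S S' assume S: "slope_open S" "slope_open S'"
  show "slope_open (S \<inter> S')"
    unfolding slope_open_def
  proof (intro conjI allI impI)
    fix E F assume p: "gpair E F"
    have "openin (ntop (OP E F)) ({T \<in> points (OP E F). graph_map E T \<in> S} \<inter> {T \<in> points (OP E F). graph_map E T \<in> S'})"
      using S p by (intro openin_Int) (simp_all add: slope_open_def)
    moreover have "{T \<in> points (OP E F). graph_map E T \<in> S} \<inter> {T \<in> points (OP E F). graph_map E T \<in> S'}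
        = {T \<in> points (OP E F). graph_map E T \<in> S \<inter> S'}" by auto
    ultimately show "openin (ntop (OP E F)) {T \<in> points (OP E F). graph_map E T \<in> S \<inter> S'}" by simp
  qed (use S in \<open>auto simp: slope_open_def\<close>)
next
  fix \<K> assume K: "\<forall>S\<in>\<K>. slope_open S"
  show "slope_open (\<Union>\<K>)"
    unfolding slope_open_def
  proof (intro conjI allI impI)
    fix E F assume p: "gpair E F"
    have "{T \<in> points (OP E F). graph_map E T \<in> \<Union>\<K>} = (\<Union>S\<in>\<K>. {T \<in> points (OP E F). graph_map E T \<in> S})" by auto
    then show "openin (ntop (OP E F)) {T \<in> points (OP E F). graph_map E T \<in> \<Union>\<K>}"
      using K p by (auto simp: slope_open_def intro!: openin_Union)
  qed (use K in \<open>auto simp: slope_open_def\<close>)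
qed

text \<open>A generating set is open in every chart because chart transitions are analytic on open
  domains. Conversely a set open in all charts is a neighbourhood of each of its points E, as a
  chart centred at E shows.\<close>

lemma openin_grassmann:
  "openin (grassmann_topology scale) S \<longleftrightarrow> slope_open S"
proof
  have gen: "slope_open (graph_map E' ` W)" if p': "gpair E' F'" and W: "openin (ntop (OP E' F')) W" for E' F' W
    unfolding slope_open_def
  proof (intro conjI allI impI)
    have c': "cpl E' F'" using p' by (rule gpairD)
    interpret O': normed_space_on "OP E' F'" by (intro normed_op cplD[OF c'])
    have W': "W \<subseteq> points (OP E' F')" using W by (simp add: O'.openin_ntop)
    show "graph_map E' ` W \<subseteq> Gr"
      using W' graph_cpl[OF c'] gpairD(2)[OF p'] cpl_Gr by blast
    fix E F assume p: "gpair E F"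
    have c: "cpl E F" using p by (rule gpairD)
    interpret O: normed_space_on "OP E F" by (intro normed_op cplD[OF c])
    interpret OO: two_spaces "OP E F" "OP E' F'" by unfold_locales
    let ?U = "{T \<in> points (OP E F). cpl (shear E F T ` E) F'}"
    have "openin (ntop (OP E F)) {T \<in> ?U. slope E' F' (shear E F T ` E) \<in> W}"
      by (rule OO.analytic_openin_preimage[OF analytic_slope_image[OF O.normed_space_on_axioms
            analytic_shear_chart[OF c] unit_pair_shear[OF c] c c'] W])
    moreover have "{T \<in> ?U. slope E' F' (shear E F T ` E) \<in> W} = {T \<in> points (OP E F). graph_map E T \<in> graph_map E' ` W}"
    proof -
      have "cpl G F' \<and> slope E' F' G \<in> W \<longleftrightarrow> G \<in> graph_map E' ` W" for G
      proof
        assume "cpl G F' \<and> slope E' F' G \<in> W"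
        then show "G \<in> graph_map E' ` W"
          using graph_slope[OF c', of G] by (intro image_eqI[of _ _ "slope E' F' G"]) auto
      next
        assume "G \<in> graph_map E' ` W"
        then obtain T where T: "T \<in> W" "G = graph_map E' T" by blast
        then have "T \<in> points (OP E' F')" using W' by auto
        then show "cpl G F' \<and> slope E' F' G \<in> W"
          using T by (simp add: slope_graph[OF c'] graph_cpl[OF c'])
      qed
      then show ?thesis by (auto simp: shear_image[OF c])
    qed
    ultimately show "openin (ntop (OP E F)) {T \<in> points (OP E F). graph_map E T \<in> graph_map E' ` W}" by simp
  qed
  assume "openin (grassmann_topology scale) S"
  then have "generate_topology_on {graph_map E ` W | E F W. F \<in> Gr \<and> E \<in> complements scale F \<and> openin (ntop (OP E F)) W} S"
    unfolding grassmann_topology_def openin_topology_generated_by_iff .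
  then show "slope_open S"
    by (rule generate_topology_on_coarsest[OF istopology_slope_open, rotated])
      (use gen in \<open>auto simp: gpair_def\<close>)
next
  assume S: "slope_open S"
  show "openin (grassmann_topology scale) S"
  proof (subst openin_subopen, intro ballI)
    fix E assume E: "E \<in> S"
    then have "E \<in> Gr" using S by (auto simp: slope_open_def)
    \<comment> \<open>With E as its own origin, the point E is the graph of 0 in this chart.\<close>
    then obtain F where p: "gpair E F" by (elim exE[OF Gr_gpair']) (rule that)
    let ?W = "{T \<in> points (OP E F). graph_map E T \<in> S}"
    have "openin (ntop (OP E F)) ?W" using S p by (simp add: slope_open_def)
    then have "openin (grassmann_topology scale) (graph_map E ` ?W)"
      unfolding grassmann_topology_def using p
      by (intro topology_generated_by_Basis) (auto simp: gpair_def)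
    moreover have "E \<in> graph_map E ` ?W"
      using E zero_op[OF gpairD(1)[OF p]] by (intro image_eqI[of _ _ 0]) auto
    moreover have "graph_map E ` ?W \<subseteq> S" by auto
    ultimately show "\<exists>T. openin (grassmann_topology scale) T \<and> E \<in> T \<and> T \<subseteq> S" by blast
  qed
qed

lemma topspace_grassmann: "topspace (grassmann_topology scale) = Gr"
proof
  show "topspace (grassmann_topology scale) \<subseteq> Gr"
    using openin_topspace[of "grassmann_topology scale"] by (auto simp only: openin_grassmann slope_open_def)
  have "slope_open Gr"
    unfolding slope_open_def
  proof (intro conjI allI impI order_refl)
    fix E F assume p: "gpair E F"
    have "{T \<in> points (OP E F). graph_map E T \<in> Gr} = points (OP E F)"
      using graph_cpl[OF gpairD(1)[OF p]] gpairD(2)[OF p] cpl_Gr by blast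
    then show "openin (ntop (OP E F)) {T \<in> points (OP E F). graph_map E T \<in> Gr}"
      using openin_points[OF normed_op] cplD(1,2)[OF gpairD(1)[OF p]] by simp
  qed
  then show "Gr \<subseteq> topspace (grassmann_topology scale)"
    using openin_subset openin_grassmann by blast
qed

lemma openin_graph_image:
  assumes p: "gpair E F" and W: "W \<subseteq> points (OP E F)"
  shows "openin (grassmann_topology scale) (graph_map E ` W) \<longleftrightarrow> openin (ntop (OP E F)) W"
proof
  have c: "cpl E F" using p by (rule gpairD)
  assume "openin (grassmann_topology scale) (graph_map E ` W)"
  then have "openin (ntop (OP E F)) {T \<in> points (OP E F). graph_map E T \<in> graph_map E ` W}"
    using p by (simp add: openin_grassmann slope_open_def)
  moreover have "{T \<in> points (OP E F). graph_map E T \<in> graph_map E ` W} = W"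
    using W slope_graph[OF c] by (auto, metis subsetD)
  ultimately show "openin (ntop (OP E F)) W" by simp
next
  assume "openin (ntop (OP E F)) W"
  then show "openin (grassmann_topology scale) (graph_map E ` W)"
    unfolding grassmann_topology_def using p
    by (intro topology_generated_by_Basis) (auto simp: gpair_def)
qed

lemma graph_map_onto:
  assumes c: "cpl E F" shows "graph_map E ` points (OP E F) = {G. cpl G F}"
  using graph_cpl[OF c] graph_slope[OF c] slope_op[OF c] by (auto, metis image_eqI)

lemma openin_complements: "F \<in> Gr \<Longrightarrow> openin (grassmann_topology scale) {G. cpl G F}"
proof -
  assume "F \<in> Gr"
  then obtain E where p: "gpair E F" using Gr_gpair by blast
  then show ?thesis
    using openin_graph_image[OF p order_refl] graph_map_onto[OF gpairD(1)[OF p]]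
      openin_points[OF normed_op] cplD(1,2)[OF gpairD(1)[OF p]] by simp
qed

theorem openin_image_preimage:
  assumes V: "normed_space_on V" and g: "nspace_analytic V BL U g"
    and u: "\<And>x. x \<in> U \<Longrightarrow> unit_pair (g x) (g' x)"
    and c0: "cpl F0 E0" and S: "openin (grassmann_topology scale) S"
  shows "openin (ntop V) {x \<in> U. g x ` F0 \<in> S}"
proof (subst openin_subopen, intro ballI)
  fix x assume x: "x \<in> {x \<in> U. g x ` F0 \<in> S}"
  then have "g x ` F0 \<in> Gr" using S by (auto simp: openin_grassmann slope_open_def)
  then obtain E1 where p: "gpair (g x ` F0) E1" by (elim exE[OF Gr_gpair']) (rule that)
  let ?F1 = "g x ` F0"
  have c1: "cpl ?F1 E1" using p by (rule gpairD)
  interpret V: normed_space_on V by fact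
  interpret O: normed_space_on "OP ?F1 E1" by (intro normed_op cplD[OF c1])
  interpret VO: two_spaces V "OP ?F1 E1" by unfold_locales
  let ?W = "{T \<in> points (OP ?F1 E1). graph_map ?F1 T \<in> S}"
  have W: "openin (ntop (OP ?F1 E1)) ?W" using S p by (simp add: openin_grassmann slope_open_def)
  let ?T = "{y \<in> {y \<in> U. cpl (g y ` F0) E1}. slope ?F1 E1 (g y ` F0) \<in> ?W}"
  have "openin (ntop V) ?T"
    by (rule VO.analytic_openin_preimage[OF analytic_slope_image[OF V g u c0 c1] W])
  moreover have "x \<in> ?T"
    using x c1 slope_op[OF c1 c1] graph_slope[OF c1 c1] by simp
  moreover have "?T \<subseteq> {x \<in> U. g x ` F0 \<in> S}"
    using graph_slope[OF c1] by auto
  ultimately show "\<exists>T. openin (ntop V) T \<and> x \<in> T \<and> T \<subseteq> {x \<in> U. g x ` F0 \<in> S}" by blast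
qed

text \<open>Two points need not lie in a common chart, for instance when their dimensions differ.
  They are separated by graphs of small operators in two charts: a common graph would force the
  component of a point of E1 transversal to E2 to be too small.\<close>

theorem Hausdorff_grassmann: "Hausdorff_space (grassmann_topology scale)"
  unfolding Hausdorff_space_def topspace_grassmann
proof (intro allI impI)
  have sep: "\<exists>U V. openin (grassmann_topology scale) U \<and> openin (grassmann_topology scale) V \<and> E1 \<in> U \<and> E2 \<in> V \<and> disjnt U V"
    if E1: "E1 \<in> Gr" and E2: "E2 \<in> Gr" and x: "x \<in> E1" "x \<notin> E2" for E1 E2 x
  proof -
    obtain F1 F2 where p: "gpair E1 F1" "gpair E2 F2" using Gr_gpair'[OF E1] Gr_gpair'[OF E2] by (elim exE) (rule that)
    note c1 = gpairD(1)[OF p(1)] and c2 = gpairD(1)[OF p(2)]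
    interpret O1: normed_space_on "OP E1 F1" by (intro normed_op cplD[OF c1])
    interpret O2: normed_space_on "OP E2 F2" by (intro normed_op cplD[OF c2])
    \<comment> \<open>The component of x along \<open>F2\<close>, nonzero because x lies outside
      \<open>E2\<close>.\<close>
    define q where "q = x - proj E2 F2 x"
    have q: "q \<noteq> 0" using x(2) proj_mem(1)[OF c2, of x] by (auto simp: q_def)
    define P where "P = nrm BL (proj E2 F2)"
    define Q where "Q = nrm BL (proj F2 E2)"
    have PQ: "P \<ge> 0" "Q \<ge> 0" unfolding P_def Q_def by (intro BL_nonneg proj_BL c2 cpl_sym)+
    \<comment> \<open>If x + T x = z + S z, then q = S z - proj F2 E2 (T x); the two terms
      contribute 2 P and Q, each times e and the norm of x.\<close>
    define M where "M = (Q + 2 * P) * norm x"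
    have M: "M \<ge> 0" using PQ by (simp add: M_def)
    \<comment> \<open>The bound 1 gives \<open>norm (x + T x) \<le> 2 * norm x\<close>, the source
      of the 2 in M; the other bound gives \<open>e * M < norm q\<close>.\<close>
    define e where "e = min 1 (norm q / (2 * (M + 1)))"
    have e: "0 < e" "e \<le> 1" using q M by (auto simp: e_def)
    have "e * M \<le> norm q / (2 * (M + 1)) * M" using M by (intro mult_right_mono) (auto simp: e_def)
    also have "\<dots> = norm q * (M / (2 * (M + 1)))" by simp
    also have "\<dots> < norm q * 1"
      using q M by (intro mult_strict_left_mono) (simp_all add: field_simps)
    also have "\<dots> = norm q" by simp
    finally have eM: "e * M < norm q" .
    define W1 where "W1 = {T \<in> points (OP E1 F1). nrm (OP E1 F1) (T - 0) < e}"
    define W2 where "W2 = {T \<in> points (OP E2 F2). nrm (OP E2 F2) (T - 0) < e}"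
    have op: "openin (ntop (OP E1 F1)) W1" "openin (ntop (OP E2 F2)) W2"
      unfolding W1_def W2_def by (intro O1.openin_ball O2.openin_ball O1.zero_mem O2.zero_mem)+
    have z: "0 \<in> W1" "0 \<in> W2" using e by (auto simp: W1_def W2_def O1.zero_mem O2.zero_mem)
    have "graph_map E1 T \<noteq> graph_map E2 S" if T: "T \<in> W1" and S: "S \<in> W2" for T S
    proof
      assume eq: "graph_map E1 T = graph_map E2 S"
      have Tm: "T \<in> points (OP E1 F1)" "nrm (OP E1 F1) T < e" and Sm: "S \<in> points (OP E2 F2)" "nrm (OP E2 F2) S < e"
        using T S by (auto simp: W1_def W2_def)
      define y where "y = x + T x"
      have "y \<in> graph_map E2 S" unfolding eq[symmetric] using x by (auto simp: graph_map_def y_def)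
      then obtain z where z: "z \<in> E2" "y = z + S z" by (auto simp: graph_map_def)
      have SF: "S z \<in> F2" by (rule opD(6)[OF cplD(1,2)[OF c2] Sm(1)])
      have pB: "proj E2 F2 \<in> points BL" and qB: "proj F2 E2 \<in> points BL" by (intro proj_BL c2 cpl_sym)+
      have py: "proj E2 F2 y = z"
        unfolding z(2) BLD(1)[OF pB] by (simp add: proj_ident[OF c2 z(1)] proj_null[OF c2 SF])
      have "q + proj F2 E2 (T x) = proj F2 E2 y"
        unfolding y_def BLD(1)[OF qB] by (simp add: q_def proj_swap[OF c2])
      also have "\<dots> = S z" unfolding proj_swap[OF c2] py using z by simp
      finally have "q = S z - proj F2 E2 (T x)" by (simp add: eq_diff_eq)
      then have "norm q \<le> norm (S z) + norm (proj F2 E2 (T x))" using norm_triangle_ineq4 by metis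
      moreover have Tx: "norm (T x) \<le> e * norm x"
        using opD(5)[OF cplD(1,2)[OF c1] Tm(1) x(1)] Tm(2) mult_right_mono[of "nrm (OP E1 F1) T" e "norm x"] by simp
      then have "norm (proj F2 E2 (T x)) \<le> Q * (e * norm x)"
        using BLD(3)[OF qB, of "T x"] mult_left_mono[OF Tx PQ(2)] by (simp add: Q_def)
      moreover have "norm (S z) \<le> e * (P * (2 * norm x))"
      proof -
        have "norm (S z) \<le> e * norm z"
          using opD(5)[OF cplD(1,2)[OF c2] Sm(1) z(1)] Sm(2) mult_right_mono[of "nrm (OP E2 F2) S" e "norm z"] by simp
        also have "norm z \<le> P * norm y" using BLD(3)[OF pB, of y] by (simp add: py P_def)
        also have "norm y \<le> 2 * norm x"
          using norm_triangle_ineq[of x "T x"] Tx mult_right_mono[OF e(2), of "norm x"] by (simp add: y_def)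
        finally show ?thesis using e PQ by (simp add: mult_left_mono)
      qed
      ultimately have "norm q \<le> e * M" by (simp add: M_def algebra_simps)
      then show False using eM by simp
    qed
    then have "disjnt (graph_map E1 ` W1) (graph_map E2 ` W2)" by (auto simp: disjnt_def)
    moreover have "openin (grassmann_topology scale) (graph_map E1 ` W1)" "openin (grassmann_topology scale) (graph_map E2 ` W2)"
      using openin_graph_image[OF p(1), of W1] openin_graph_image[OF p(2), of W2] op by (auto simp: W1_def W2_def)
    moreover have "E1 \<in> graph_map E1 ` W1" "E2 \<in> graph_map E2 ` W2"
      using z by (auto intro: image_eqI[of _ _ 0])
    ultimately show ?thesis by blast
  qed
  fix E1 E2 assume *: "E1 \<in> Gr \<and> E2 \<in> Gr \<and> E1 \<noteq> E2"
  \<comment> \<open>Distinct subspaces have a point of one outside the other, but in which order is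
    unknown; the claim is symmetric.\<close>
  show "\<exists>U V. openin (grassmann_topology scale) U \<and> openin (grassmann_topology scale) V \<and> E1 \<in> U \<and> E2 \<in> V \<and> disjnt U V"
  proof (cases "E1 \<subseteq> E2")
    case True
    then obtain x where "x \<in> E2" "x \<notin> E1" using * by blast
    then show ?thesis using sep[of E2 E1 x] * by (metis disjnt_sym)
  next
    case False
    then obtain x where "x \<in> E1" "x \<notin> E2" by blast
    then show ?thesis using sep[of E1 E2 x] * by blast
  qed
qed

end

section \<open>Charts and analytic maps between manifolds\<close>

text \<open>The homeomorphism condition in terms of open subsets of the domain, which keeps subspace
  topologies out of the computations; \<open>chart_ok_homeomorphic\<close> recovers the usual
  form.\<close>

definition chart_ok :: "'p topology \<Rightarrow> ('k::real_normed_field, 'p, 'v::ab_group_add) chart \<Rightarrow> bool" where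
  "chart_ok \<tau> c \<longleftrightarrow> openin \<tau> (chart_dom c) \<and> normed_space_on (chart_model c) \<and>
     openin (ntop (chart_model c)) (chart_map c ` chart_dom c) \<and> inj_on (chart_map c) (chart_dom c) \<and>
     (\<forall>S. S \<subseteq> chart_dom c \<longrightarrow> (openin \<tau> S \<longleftrightarrow> openin (ntop (chart_model c)) (chart_map c ` S)))"

definition atlas_ok :: "('k::real_normed_field, 'p, 'v::ab_group_add) manifold \<Rightarrow> bool" where
  "atlas_ok M \<longleftrightarrow> (\<Union>c\<in>atlas M. chart_dom c) = topspace (mantop M) \<and> (\<forall>c\<in>atlas M. chart_ok (mantop M) c)"

text \<open>An explicit inverse of the chart. Images of chart domains become sets of parameters and
  \<open>chart_inv\<close> becomes the known function \<open>\<psi>\<close>.\<close>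

definition chart_param :: "('k, 'p, 'v) chart \<Rightarrow> 'v set \<Rightarrow> ('v \<Rightarrow> 'p) \<Rightarrow> bool" where
  "chart_param c W \<psi> \<longleftrightarrow> \<psi> ` W = chart_dom c \<and> (\<forall>v\<in>W. chart_map c (\<psi> v) = v)"

lemma chart_okD:
  assumes "chart_ok \<tau> c"
  shows "openin \<tau> (chart_dom c)" "normed_space_on (chart_model c)"
    "openin (ntop (chart_model c)) (chart_map c ` chart_dom c)" "inj_on (chart_map c) (chart_dom c)"
    "S \<subseteq> chart_dom c \<Longrightarrow> openin \<tau> S \<longleftrightarrow> openin (ntop (chart_model c)) (chart_map c ` S)"
  using assms by (simp_all add: chart_ok_def)

lemma chart_paramD:
  assumes "chart_param c W \<psi>"
  shows "chart_map c ` chart_dom c = W" "inj_on (chart_map c) (chart_dom c)"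
    "v \<in> W \<Longrightarrow> chart_map c (\<psi> v) = v" "v \<in> W \<Longrightarrow> \<psi> v \<in> chart_dom c"
    "p \<in> chart_dom c \<Longrightarrow> \<psi> (chart_map c p) = p"
    "chart_map c ` {p \<in> chart_dom c. Q p} = {v \<in> W. Q (\<psi> v)}"
    "v \<in> W \<Longrightarrow> chart_inv c v = \<psi> v"
proof -
  have 1: "\<psi> ` W = chart_dom c" and 2: "\<And>v. v \<in> W \<Longrightarrow> chart_map c (\<psi> v) = v"
    using assms by (auto simp: chart_param_def)
  show "v \<in> W \<Longrightarrow> chart_map c (\<psi> v) = v" by (rule 2)
  show d: "v \<in> W \<Longrightarrow> \<psi> v \<in> chart_dom c" for v using 1 by blast
  show im: "chart_map c ` chart_dom c = W" unfolding 1[symmetric] image_image using 2 by auto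
  have l: "\<psi> (chart_map c p) = p" if "p \<in> chart_dom c" for p
    using that 2 unfolding 1[symmetric] by auto
  then show "p \<in> chart_dom c \<Longrightarrow> \<psi> (chart_map c p) = p" .
  show inj: "inj_on (chart_map c) (chart_dom c)" using l by (rule inj_on_inverseI)
  show "chart_map c ` {p \<in> chart_dom c. Q p} = {v \<in> W. Q (\<psi> v)}"
  proof (intro equalityI subsetI)
    fix v assume "v \<in> {v \<in> W. Q (\<psi> v)}"
    then have "v = chart_map c (\<psi> v)" "\<psi> v \<in> {p \<in> chart_dom c. Q p}" using 2 d by simp_all
    then show "v \<in> chart_map c ` {p \<in> chart_dom c. Q p}" by blast
  qed (use l im in auto)
  show "v \<in> W \<Longrightarrow> chart_inv c v = \<psi> v"
    unfolding chart_inv_def using the_inv_into_f_f[OF inj d] 2 by metis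
qed

lemma chart_ok_paramI:
  assumes p: "chart_param c W \<psi>" and d: "openin \<tau> (chart_dom c)" and n: "normed_space_on (chart_model c)"
    and W: "W = points (chart_model c)"
    and S: "\<And>S. S \<subseteq> chart_dom c \<Longrightarrow> openin \<tau> S \<longleftrightarrow> openin (ntop (chart_model c)) {v \<in> W. \<psi> v \<in> S}"
  shows "chart_ok \<tau> c"
proof -
  have "chart_map c ` S = {v \<in> W. \<psi> v \<in> S}" if "S \<subseteq> chart_dom c" for S
    using chart_paramD(6)[OF p, of "\<lambda>p. p \<in> S"] that by (simp add: Collect_conj_eq inf.absorb2)
  then have "openin \<tau> S \<longleftrightarrow> openin (ntop (chart_model c)) (chart_map c ` S)" if "S \<subseteq> chart_dom c" for S
    using S[OF that] that by simp
  moreover have "openin (ntop (chart_model c)) (chart_map c ` chart_dom c)"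
    unfolding chart_paramD(1)[OF p] W using openin_topspace[of "ntop (chart_model c)"]
    by (simp add: normed_space_on.topspace_ntop[OF n])
  ultimately show ?thesis
    unfolding chart_ok_def using d n chart_paramD(2)[OF p] by blast
qed

lemma chart_ok_homeomorphic:
  assumes c: "chart_ok \<tau> c"
  shows "homeomorphic_map (subtopology \<tau> (chart_dom c))
    (subtopology (ntop (chart_model c)) (chart_map c ` chart_dom c)) (chart_map c)"
proof (rule bijective_open_imp_homeomorphic_map)
  note o = chart_okD[OF c]
  interpret normed_space_on "chart_model c" by (rule o)
  have ts: "topspace (subtopology \<tau> (chart_dom c)) = chart_dom c"
    using openin_subset[OF o(1)] by (auto simp: topspace_subtopology)
  have ti: "topspace (subtopology (ntop (chart_model c)) (chart_map c ` chart_dom c)) = chart_map c ` chart_dom c"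
    using openin_subset[OF o(3)] by (auto simp: topspace_subtopology)
  show "continuous_map (subtopology \<tau> (chart_dom c)) (subtopology (ntop (chart_model c)) (chart_map c ` chart_dom c)) (chart_map c)"
    unfolding continuous_map_def ts ti
  proof (intro conjI allI impI)
    fix U assume "openin (subtopology (ntop (chart_model c)) (chart_map c ` chart_dom c)) U"
    then have U: "openin (ntop (chart_model c)) U" "U \<subseteq> chart_map c ` chart_dom c"
      using openin_open_subtopology[OF o(3)] by auto
    have "chart_map c ` {x \<in> chart_dom c. chart_map c x \<in> U} = U" using U(2) by auto
    then have "openin \<tau> {x \<in> chart_dom c. chart_map c x \<in> U}"
      using U(1) by (subst o(5)) auto
    then show "openin (subtopology \<tau> (chart_dom c)) {x \<in> chart_dom c. chart_map c x \<in> U}"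
      by (simp add: openin_open_subtopology[OF o(1)])
  qed auto
  show "open_map (subtopology \<tau> (chart_dom c)) (subtopology (ntop (chart_model c)) (chart_map c ` chart_dom c)) (chart_map c)"
    unfolding open_map_def openin_open_subtopology[OF o(1)] openin_open_subtopology[OF o(3)]
    using o(5) by auto
  show "chart_map c ` topspace (subtopology \<tau> (chart_dom c)) =
      topspace (subtopology (ntop (chart_model c)) (chart_map c ` chart_dom c))"
    unfolding ts ti ..
  show "inj_on (chart_map c) (topspace (subtopology \<tau> (chart_dom c)))"
    unfolding ts by (rule o)
qed

text \<open>The identity in the middle of the transition map gives it the shape of a map between
  manifolds in coordinates, so that \<open>param_analytic\<close> applies.\<close>

lemma banach_manifoldI:
  assumes "Hausdorff_space (mantop M)" "atlas_ok M" "\<And>c. c \<in> atlas M \<Longrightarrow> banach_space_on (chart_model c)"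
    "\<And>c d. \<lbrakk>c \<in> atlas M; d \<in> atlas M\<rbrakk> \<Longrightarrow> nspace_analytic (chart_model c) (chart_model d)
          (chart_map c ` {p \<in> chart_dom c. p \<in> chart_dom d}) (chart_map d \<circ> (\<lambda>p. p) \<circ> chart_inv c)"
  shows "banach_manifold M"
  unfolding banach_manifold_def
proof (intro conjI ballI)
  have ok: "chart_ok (mantop M) c" if "c \<in> atlas M" for c using assms(2) that by (simp add: atlas_ok_def)
  show "(\<Union>c\<in>atlas M. chart_dom c) = topspace (mantop M)" using assms(2) by (simp add: atlas_ok_def)
  fix c assume c: "c \<in> atlas M"
  show "openin (mantop M) (chart_dom c)" "openin (ntop (chart_model c)) (chart_map c ` chart_dom c)"
    by (rule chart_okD[OF ok[OF c]])+
  show "homeomorphic_map (subtopology (mantop M) (chart_dom c))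
          (subtopology (ntop (chart_model c)) (chart_map c ` chart_dom c)) (chart_map c)"
    by (rule chart_ok_homeomorphic[OF ok[OF c]])
  fix d assume d: "d \<in> atlas M"
  show "nspace_analytic (chart_model c) (chart_model d)
          (chart_map c ` (chart_dom c \<inter> chart_dom d)) (chart_map d \<circ> chart_inv c)"
    using assms(4)[OF c d] by (simp add: Collect_conj_eq comp_def)
qed (use assms in auto)

lemma filter_image: "(\<And>p. p \<in> A \<Longrightarrow> P (h p) \<longleftrightarrow> Q p) \<Longrightarrow> {v \<in> h ` A. P v} = h ` {p \<in> A. Q p}"
  by auto

text \<open>Continuity is automatic, as \<open>nspace_analytic\<close> includes that the domain is open.\<close>

lemma manifold_analyticI:
  assumes M: "atlas_ok M" and N: "atlas_ok N" and S: "openin (mantop M) S" and f: "f ` S \<subseteq> topspace (mantop N)"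
    and an: "\<And>c d. \<lbrakk>c \<in> atlas M; d \<in> atlas N\<rbrakk> \<Longrightarrow> nspace_analytic (chart_model c) (chart_model d)
          (chart_map c ` {p \<in> chart_dom c. p \<in> S \<and> f p \<in> chart_dom d}) (chart_map d \<circ> f \<circ> chart_inv c)"
  shows "manifold_analytic M N S f"
  unfolding manifold_analytic_def
proof (intro conjI ballI S)
  have okM: "chart_ok (mantop M) c" if "c \<in> atlas M" for c using M that by (simp add: atlas_ok_def)
  have okN: "chart_ok (mantop N) d" if "d \<in> atlas N" for d using N that by (simp add: atlas_ok_def)
  have SM: "S \<subseteq> topspace (mantop M)" by (rule openin_subset[OF S])
  \<comment> \<open>Openness is local: one chart around x and one around f x suffice, and there the
    coordinate map has open preimages.\<close>
  have "openin (mantop M) {x \<in> S. f x \<in> U}" if U: "openin (mantop N) U" for U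
  proof (subst openin_subopen, intro ballI)
    fix x assume x: "x \<in> {x \<in> S. f x \<in> U}"
    have "x \<in> topspace (mantop M)" using x SM by auto
    then have "x \<in> (\<Union>c\<in>atlas M. chart_dom c)" using M by (simp add: atlas_ok_def)
    then obtain c where c: "c \<in> atlas M" "x \<in> chart_dom c" by auto
    have "f x \<in> topspace (mantop N)" using x f by auto
    then have "f x \<in> (\<Union>c\<in>atlas N. chart_dom c)" using N by (simp add: atlas_ok_def)
    then obtain d where d: "d \<in> atlas N" "f x \<in> chart_dom d" by auto
    note oc = chart_okD[OF okM[OF c(1)]] and od = chart_okD[OF okN[OF d(1)]]
    interpret T: two_spaces "chart_model c" "chart_model d"
      using oc(2) od(2) by (simp add: two_spaces_def)
    let ?U = "U \<inter> chart_dom d"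
    let ?A = "{p \<in> chart_dom c. p \<in> S \<and> f p \<in> chart_dom d}"
    let ?X = "{p \<in> chart_dom c. p \<in> S \<and> f p \<in> ?U}"
    have "openin (mantop N) ?U" by (intro openin_Int U od)
    then have "openin (ntop (chart_model d)) (chart_map d ` ?U)" by (subst od(5)[symmetric]) auto
    from T.analytic_openin_preimage[OF an[OF c(1) d(1)] this]
    have "openin (ntop (chart_model c)) {v \<in> chart_map c ` ?A. (chart_map d \<circ> f \<circ> chart_inv c) v \<in> chart_map d ` ?U}" .
    moreover have "{v \<in> chart_map c ` ?A. (chart_map d \<circ> f \<circ> chart_inv c) v \<in> chart_map d ` ?U} = chart_map c ` ?X"
    proof -
      have "(chart_map d \<circ> f \<circ> chart_inv c) (chart_map c p) \<in> chart_map d ` ?U \<longleftrightarrow> f p \<in> ?U" if "p \<in> ?A" for p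
      proof -
        have "chart_inv c (chart_map c p) = p"
          unfolding chart_inv_def by (rule the_inv_into_f_f[OF oc(4)]) (use that in simp)
        moreover have "chart_map d (f p) \<in> chart_map d ` ?U \<longleftrightarrow> f p \<in> ?U"
          by (rule inj_on_image_mem_iff[OF od(4)]) (use that in simp_all)
        ultimately show ?thesis by simp
      qed
      then have "{v \<in> chart_map c ` ?A. (chart_map d \<circ> f \<circ> chart_inv c) v \<in> chart_map d ` ?U} =
          chart_map c ` {p \<in> ?A. f p \<in> ?U}"
        by (rule filter_image)
      also have "{p \<in> ?A. f p \<in> ?U} = ?X" by auto
      finally show ?thesis .
    qed
    ultimately have "openin (mantop M) ?X" by (subst oc(5)) auto
    then show "\<exists>T. openin (mantop M) T \<and> x \<in> T \<and> T \<subseteq> {x \<in> S. f x \<in> U}"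
      using x c d by (intro exI[of _ ?X]) auto
  qed
  then show "continuous_map (subtopology (mantop M) S) (mantop N) f"
    unfolding continuous_map_def using f SM
    by (auto simp: topspace_subtopology openin_open_subtopology[OF S] inf.absorb2)
  fix c d assume "c \<in> atlas M" "d \<in> atlas N"
  then show "nspace_analytic (chart_model c) (chart_model d)
      (chart_map c ` {p \<in> chart_dom c \<inter> S. f p \<in> chart_dom d}) (chart_map d \<circ> f \<circ> chart_inv c)"
    using an[of c d] by (simp add: conj_assoc)
qed

text \<open>Reduces a coordinate expression to an explicit function F of the parameter, defined by
  means of \<open>\<psi>\<close> and free of \<open>the_inv_into\<close>.\<close>

lemma param_analytic:
  assumes p: "chart_param c W \<psi>" and n: "normed_space_on (chart_model c)" "normed_space_on V'"
    and an: "nspace_analytic (chart_model c) V' {v \<in> W. Q (\<psi> v)} F"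
    and F: "\<And>v. \<lbrakk>v \<in> W; Q (\<psi> v)\<rbrakk> \<Longrightarrow> F v = k (f (\<psi> v))"
  shows "nspace_analytic (chart_model c) V' (chart_map c ` {p \<in> chart_dom c. Q p}) (k \<circ> f \<circ> chart_inv c)"
proof -
  interpret two_spaces "chart_model c" V' using n by (simp add: two_spaces_def)
  show ?thesis
    unfolding chart_paramD(6)[OF p]
    by (rule analytic_cong[OF an]) (simp add: F chart_paramD(7)[OF p])
qed

text \<open>The product chart maps rectangles to rectangles, so both implications reduce to the
  factors once the rectangles lie in the chart domains.\<close>

lemma chart_ok_prod:
  assumes c: "chart_ok \<tau> c" and d: "chart_ok \<sigma> d"
  shows "chart_ok (prod_topology \<tau> \<sigma>) \<lparr>chart_dom = chart_dom c \<times> chart_dom d,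
    chart_map = map_prod (chart_map c) (chart_map d), chart_model = prod_nspace (chart_model c) (chart_model d)\<rparr>"
proof -
  note oc = chart_okD[OF c] and od = chart_okD[OF d]
  have nt: "ntop (prod_nspace (chart_model c) (chart_model d)) = prod_topology (ntop (chart_model c)) (ntop (chart_model d))"
    by (rule ntop_prod_nspace[OF oc(2) od(2)])
  have inj: "inj_on (map_prod (chart_map c) (chart_map d)) (chart_dom c \<times> chart_dom d)"
    using oc(4) od(4) by (rule map_prod_inj_on)
  have "openin (prod_topology \<tau> \<sigma>) S \<longleftrightarrow>
      openin (prod_topology (ntop (chart_model c)) (ntop (chart_model d))) (map_prod (chart_map c) (chart_map d) ` S)"
    if S: "S \<subseteq> chart_dom c \<times> chart_dom d" for S
  proof
    assume op: "openin (prod_topology \<tau> \<sigma>) S"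
    show "openin (prod_topology (ntop (chart_model c)) (ntop (chart_model d))) (map_prod (chart_map c) (chart_map d) ` S)"
      unfolding openin_prod_topology_alt
    proof (intro allI impI)
      fix v w assume "(v, w) \<in> map_prod (chart_map c) (chart_map d) ` S"
      then obtain x y where xy: "(x, y) \<in> S" "v = chart_map c x" "w = chart_map d y" by auto
      obtain A B where AB: "openin \<tau> A" "openin \<sigma> B" "x \<in> A" "y \<in> B" "A \<times> B \<subseteq> S"
        using op[unfolded openin_prod_topology_alt, rule_format, OF xy(1)] by (elim exE conjE) (rule that)
      \<comment> \<open>The rectangle contains (x, y), so each of its sides lies in the
        corresponding chart domain.\<close>
      have "A \<times> {y} \<subseteq> chart_dom c \<times> chart_dom d" "{x} \<times> B \<subseteq> chart_dom c \<times> chart_dom d"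
        using AB S by blast+
      then have sub: "A \<subseteq> chart_dom c" "B \<subseteq> chart_dom d" by auto
      have "chart_map c ` A \<times> chart_map d ` B \<subseteq> map_prod (chart_map c) (chart_map d) ` S"
        using AB(5) by (auto simp: map_prod_def image_iff split: prod.splits intro!: bexI)
      then show "\<exists>U V. openin (ntop (chart_model c)) U \<and> openin (ntop (chart_model d)) V \<and> v \<in> U \<and> w \<in> V \<and>
          U \<times> V \<subseteq> map_prod (chart_map c) (chart_map d) ` S"
        using AB xy oc(5)[OF sub(1)] od(5)[OF sub(2)]
        by (intro exI[of _ "chart_map c ` A"] exI[of _ "chart_map d ` B"]) simp
    qed
  next
    assume op: "openin (prod_topology (ntop (chart_model c)) (ntop (chart_model d))) (map_prod (chart_map c) (chart_map d) ` S)"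
    show "openin (prod_topology \<tau> \<sigma>) S"
      unfolding openin_prod_topology_alt
    proof (intro allI impI)
      fix x y assume xy: "(x, y) \<in> S"
      then have "(chart_map c x, chart_map d y) \<in> map_prod (chart_map c) (chart_map d) ` S" by force
      then obtain A B where AB: "openin (ntop (chart_model c)) A" "openin (ntop (chart_model d)) B"
        "chart_map c x \<in> A" "chart_map d y \<in> B" "A \<times> B \<subseteq> map_prod (chart_map c) (chart_map d) ` S"
        using op[unfolded openin_prod_topology_alt] by (elim allE impE exE conjE) (assumption, rule that)
      have iA: "chart_map c ` {x \<in> chart_dom c. chart_map c x \<in> A} = A \<inter> chart_map c ` chart_dom c"
        and iB: "chart_map d ` {x \<in> chart_dom d. chart_map d x \<in> B} = B \<inter> chart_map d ` chart_dom d" by auto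
      have A: "openin \<tau> {x \<in> chart_dom c. chart_map c x \<in> A}"
        by (subst oc(5)) (auto simp: iA intro!: openin_Int AB oc)
      have B: "openin \<sigma> {x \<in> chart_dom d. chart_map d x \<in> B}"
        by (subst od(5)) (auto simp: iB intro!: openin_Int AB od)
      have "{x \<in> chart_dom c. chart_map c x \<in> A} \<times> {x \<in> chart_dom d. chart_map d x \<in> B} \<subseteq> S"
      proof clarify
        fix a b assume ab: "a \<in> chart_dom c" "chart_map c a \<in> A" "b \<in> chart_dom d" "chart_map d b \<in> B"
        then have "map_prod (chart_map c) (chart_map d) (a, b) \<in> map_prod (chart_map c) (chart_map d) ` S"
          using AB(5) by auto
        then show "(a, b) \<in> S" using inj_on_image_mem_iff[OF inj _ S, of "(a, b)"] ab by simp
      qed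
      moreover have "x \<in> chart_dom c" "y \<in> chart_dom d" using xy S by auto
      ultimately show "\<exists>U V. openin \<tau> U \<and> openin \<sigma> V \<and> x \<in> U \<and> y \<in> V \<and> U \<times> V \<subseteq> S"
        using A B AB(3,4)
        by (intro exI[of _ "{x \<in> chart_dom c. chart_map c x \<in> A}"] exI[of _ "{x \<in> chart_dom d. chart_map d x \<in> B}"]) simp
    qed
  qed
  then show ?thesis
    unfolding chart_ok_def nt chart.simps
    using inj oc(1,3) od(1,3) normed_prod_nspace[OF oc(2) od(2)]
    by (simp add: openin_prod_Times_iff nt map_prod_surj_on[OF refl refl])
qed

lemma atlas_ok_prod:
  assumes "atlas_ok M" "atlas_ok N" shows "atlas_ok (prod_manifold M N)"
  unfolding atlas_ok_def
proof (intro conjI ballI)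
  have M: "(\<Union>c\<in>atlas M. chart_dom c) = topspace (mantop M)" "\<And>c. c \<in> atlas M \<Longrightarrow> chart_ok (mantop M) c"
    and N: "(\<Union>c\<in>atlas N. chart_dom c) = topspace (mantop N)" "\<And>c. c \<in> atlas N \<Longrightarrow> chart_ok (mantop N) c"
    using assms by (auto simp: atlas_ok_def)
  show "(\<Union>c\<in>atlas (prod_manifold M N). chart_dom c) = topspace (mantop (prod_manifold M N))"
    by (auto simp: prod_manifold_def M(1)[symmetric] N(1)[symmetric]) (metis SigmaI chart.select_convs(1))
  fix e assume "e \<in> atlas (prod_manifold M N)"
  then obtain c d where e: "e = \<lparr>chart_dom = chart_dom c \<times> chart_dom d,
      chart_map = map_prod (chart_map c) (chart_map d),
      chart_model = prod_nspace (chart_model c) (chart_model d)\<rparr>" and cd: "c \<in> atlas M" "d \<in> atlas N"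
    by (auto simp: prod_manifold_def)
  show "chart_ok (mantop (prod_manifold M N)) e"
    unfolding e using chart_ok_prod[OF M(2)[OF cd(1)] N(2)[OF cd(2)]] by (simp add: prod_manifold_def)
qed

lemma chart_param_prod:
  assumes "chart_param c W \<psi>" "chart_param d W' \<psi>'"
  shows "chart_param \<lparr>chart_dom = chart_dom c \<times> chart_dom d,
    chart_map = map_prod (chart_map c) (chart_map d), chart_model = prod_nspace (chart_model c) (chart_model d)\<rparr>
    (W \<times> W') (map_prod \<psi> \<psi>')"
  using assms map_prod_surj_on[of \<psi> W "chart_dom c" \<psi>' W' "chart_dom d"] by (auto simp: chart_param_def)

lemma atlas_affine_manifold:
  assumes "normed_space_on Y"
  shows "atlas (affine_manifold \<tau> h Y (points Y)) =
    {\<lparr>chart_dom = topspace \<tau>, chart_map = (\<lambda>p. h p - a), chart_model = Y\<rparr> | a. a \<in> points Y}"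
  unfolding affine_manifold_def using direction_points[OF assms] by auto

lemma chart_param_translate:
  assumes Y: "normed_space_on Y" and p: "chart_param \<lparr>chart_dom = D, chart_map = h, chart_model = Y\<rparr> (points Y) \<psi>"
    and a: "a \<in> points Y"
  shows "chart_param \<lparr>chart_dom = D, chart_map = (\<lambda>p. h p - a), chart_model = Y\<rparr> (points Y) (\<lambda>v. \<psi> (v + a))"
proof -
  interpret normed_space_on Y by fact
  have "(\<lambda>v. v + a) ` points Y = points Y"
    using a by (auto simp: add_mem image_iff intro!: bexI[of _ "_ - a"] diff_mem)
  then have "(\<lambda>v. \<psi> (v + a)) ` points Y = \<psi> ` points Y"
    by (metis image_image)
  then show ?thesis using p a add_mem by (simp add: chart_param_def)
qed

lemma atlas_ok_affine:
  assumes Y: "normed_space_on Y" and h: "chart_ok \<tau> \<lparr>chart_dom = topspace \<tau>, chart_map = h, chart_model = Y\<rparr>"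
    and im: "h ` topspace \<tau> = points Y"
  shows "atlas_ok (affine_manifold \<tau> h Y (points Y))"
  unfolding atlas_ok_def atlas_affine_manifold[OF Y]
proof (intro conjI ballI)
  interpret normed_space_on Y by fact
  have mt: "mantop (affine_manifold \<tau> h Y (points Y)) = \<tau>" by (simp add: affine_manifold_def)
  note o = chart_okD[OF h, simplified]
  show "\<Union> (chart_dom ` {\<lparr>chart_dom = topspace \<tau>, chart_map = \<lambda>p. h p - a, chart_model = Y\<rparr> |a. a \<in> points Y}) =
      topspace (mantop (affine_manifold \<tau> h Y (points Y)))"
    unfolding mt using zero_mem by auto
  fix c assume "c \<in> {\<lparr>chart_dom = topspace \<tau>, chart_map = \<lambda>p. h p - a, chart_model = Y\<rparr> |a. a \<in> points Y}"
  then obtain a where a: "a \<in> points Y" and c: "c = \<lparr>chart_dom = topspace \<tau>, chart_map = \<lambda>p. h p - a, chart_model = Y\<rparr>"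
    by blast
  have tr: "(\<lambda>p. h p - a) ` S = (\<lambda>x. x - a) ` h ` S" for S by (simp add: image_image)
  have "h ` S \<subseteq> points Y" if "S \<subseteq> topspace \<tau>" for S using that im by blast
  then have op: "openin (ntop Y) ((\<lambda>p. h p - a) ` S) \<longleftrightarrow> openin (ntop Y) (h ` S)" if "S \<subseteq> topspace \<tau>" for S
    unfolding tr by (rule openin_translate[OF a]) (use that in simp)
  show "chart_ok (mantop (affine_manifold \<tau> h Y (points Y))) c"
    unfolding mt c chart_ok_def using o op by (auto simp: inj_on_def)
qed

lemma affine_map_on_cong:
  assumes V: "normed_space_on V" and S: "affine_map_on V (points V) W S" and e: "\<And>x. x \<in> points V \<Longrightarrow> S x = T x"
  shows "affine_map_on V (points V) W T"
proof -
  interpret normed_space_on V by fact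
  show ?thesis
    using S unfolding affine_map_on_def
    by (auto simp: direction_points[OF V] linear_map_on_def e[symmetric] add_mem smult_mem)
qed

context banach_scaling begin

section \<open>The Grassmann manifold and the manifold of complementary pairs\<close>

abbreviation GrM :: "('k, 'a set, 'a \<Rightarrow> 'a) manifold" where "GrM \<equiv> grassmann_manifold scale"

lemma chart_param_grassmann:
  assumes p: "gpair E F"
  shows "chart_param (grassmann_chart scale E F) (points (OP E F)) (graph_map E)"
proof -
  note c = gpairD(1)[OF p]
  have inj: "inj_on (graph_map E) (points (OP E F))" by (rule inj_on_inverseI[OF slope_graph[OF c]])
  have "complements scale F = {G. cpl G F}"
    using complements_iff[OF gpairD(2)[OF p]] by blast
  then show ?thesis
    unfolding chart_param_def grassmann_chart_def chart.simps using graph_map_onto[OF c]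
    by (simp add: the_inv_into_f_f[OF inj])
qed

lemma dom_grassmann: "gpair E F \<Longrightarrow> chart_dom (grassmann_chart scale E F) = {G. cpl G F}"
  by (auto simp: grassmann_chart_def complements_iff gpairD(2))

lemma model_grassmann [simp]: "chart_model (grassmann_chart scale E F) = OP E F"
  by (simp add: grassmann_chart_def)

lemma map_grassmann:
  assumes p: "gpair E F" and G: "cpl G F"
  shows "chart_map (grassmann_chart scale E F) G = slope E F G"
  using chart_paramD(3)[OF chart_param_grassmann[OF p] slope_op[OF gpairD(1)[OF p] G]]
  by (simp add: graph_slope[OF gpairD(1)[OF p] G])

lemma atlas_grassmann: "atlas GrM = {grassmann_chart scale E F | E F. gpair E F}"
  by (simp add: grassmann_manifold_def gpair_def)

lemma mantop_grassmann [simp]: "mantop GrM = grassmann_topology scale"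
  by (simp add: grassmann_manifold_def)

lemma normed_op_cpl: "cpl E F \<Longrightarrow> normed_space_on (OP E F)"
  by (intro normed_op cplD)

lemma atlas_ok_grassmann: "atlas_ok GrM"
  unfolding atlas_ok_def
proof (intro conjI ballI)
  show "(\<Union>c\<in>atlas GrM. chart_dom c) = topspace (mantop GrM)"
  proof (intro equalityI subsetI)
    fix G assume "G \<in> (\<Union>c\<in>atlas GrM. chart_dom c)"
    then obtain E F where p: "gpair E F" "cpl G F" by (auto simp: atlas_grassmann dom_grassmann)
    then show "G \<in> topspace (mantop GrM)"
      using cpl_Gr[OF p(2) gpairD(2)[OF p(1)]] by (simp add: topspace_grassmann)
  next
    fix G assume "G \<in> topspace (mantop GrM)"
    then have "G \<in> Gr" by (simp add: topspace_grassmann)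
    then obtain F where p: "gpair G F" by (elim exE[OF Gr_gpair']) (rule that)
    have "G \<in> chart_dom (grassmann_chart scale G F)"
      using p gpairD(1)[OF p] by (simp add: dom_grassmann)
    then show "G \<in> (\<Union>c\<in>atlas GrM. chart_dom c)" using p by (auto simp: atlas_grassmann)
  qed
  fix c assume "c \<in> atlas GrM"
  then obtain E F where p: "gpair E F" and c: "c = grassmann_chart scale E F" by (auto simp: atlas_grassmann)
  note q = chart_param_grassmann[OF p] and cp = gpairD(1)[OF p]
  show "chart_ok (mantop GrM) c"
    unfolding c
  proof (rule chart_ok_paramI[OF q])
    show "openin (mantop GrM) (chart_dom (grassmann_chart scale E F))"
      using openin_complements[OF gpairD(2)[OF p]] p by (simp add: dom_grassmann)
    show "normed_space_on (chart_model (grassmann_chart scale E F))" using normed_op_cpl[OF cp] by simp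
    fix S assume S: "S \<subseteq> chart_dom (grassmann_chart scale E F)"
    have "graph_map E ` {v \<in> points (OP E F). graph_map E v \<in> S} = S"
      using S chart_paramD(5)[OF q] chart_paramD(1)[OF q] by (auto simp: image_iff) (metis imageI subsetD)
    then show "openin (mantop GrM) S \<longleftrightarrow>
        openin (ntop (chart_model (grassmann_chart scale E F))) {v \<in> points (OP E F). graph_map E v \<in> S}"
      using openin_graph_image[OF p, of "{v \<in> points (OP E F). graph_map E v \<in> S}"] by simp
  qed simp
qed

lemma analytic_graph_to_slope:
  assumes c: "cpl E F" and c': "cpl E' F'"
  shows "nspace_analytic (OP E F) (OP E' F') {T \<in> points (OP E F). cpl (graph_map E T) F'} (\<lambda>T. slope E' F' (graph_map E T))"
  using analytic_slope_image[OF normed_op_cpl[OF c] analytic_shear_chart[OF c] unit_pair_shear[OF c] c c']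
  by (simp add: shear_image[OF c])

theorem banach_manifold_grassmann: "banach_manifold GrM"
proof (rule banach_manifoldI)
  show "Hausdorff_space (mantop GrM)" using Hausdorff_grassmann by simp
  show "atlas_ok GrM" by (rule atlas_ok_grassmann)
  fix c assume "c \<in> atlas GrM"
  then obtain E F where p: "gpair E F" and c: "c = grassmann_chart scale E F" by (auto simp: atlas_grassmann)
  note cp = gpairD(1)[OF p]
  show "banach_space_on (chart_model c)" unfolding c model_grassmann by (intro banach_op cplD[OF cp])
  fix d assume "d \<in> atlas GrM"
  then obtain E' F' where p': "gpair E' F'" and d: "d = grassmann_chart scale E' F'" by (auto simp: atlas_grassmann)
  note cp' = gpairD(1)[OF p']
  show "nspace_analytic (chart_model c) (chart_model d)
          (chart_map c ` {p \<in> chart_dom c. p \<in> chart_dom d}) (chart_map d \<circ> (\<lambda>p. p) \<circ> chart_inv c)"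
    unfolding c
    by (rule param_analytic[OF chart_param_grassmann[OF p], where F = "\<lambda>T. slope E' F' (graph_map E T)"])
      (use normed_op_cpl[OF cp] normed_op_cpl[OF cp'] analytic_graph_to_slope[OF cp cp'] p' in
        \<open>simp_all add: d dom_grassmann map_grassmann\<close>)
qed

text \<open>Shearing by the negative coordinate of G takes G back to E and H to a complement of E,
  which has a coordinate in L(F,E). In contrast to separate coordinates of G and H, the image is the
  full product of the two operator spaces.\<close>

definition pair_coord :: "'a set \<Rightarrow> 'a set \<Rightarrow> 'a set \<times> 'a set \<Rightarrow> ('a \<Rightarrow> 'a) \<times> ('a \<Rightarrow> 'a)" where
  "pair_coord E F = (\<lambda>(G, H). (slope E F G, slope F E (shear E F (- slope E F G) ` H)))"

definition pair_param :: "'a set \<Rightarrow> 'a set \<Rightarrow> ('a \<Rightarrow> 'a) \<times> ('a \<Rightarrow> 'a) \<Rightarrow> 'a set \<times> 'a set" where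
  "pair_param E F = (\<lambda>(T, S). (graph_map E T, shear E F T ` graph_map F S))"

definition pair_chart :: "'a set \<Rightarrow> 'a set \<Rightarrow> ('k, 'a set \<times> 'a set, ('a \<Rightarrow> 'a) \<times> ('a \<Rightarrow> 'a)) chart" where
  "pair_chart E F = \<lparr>chart_dom = {(G, H). cpl G F \<and> cpl G H}, chart_map = pair_coord E F,
     chart_model = prod_nspace (OP E F) (OP F E)\<rparr>"

definition PM :: "('k, 'a set \<times> 'a set, ('a \<Rightarrow> 'a) \<times> ('a \<Rightarrow> 'a)) manifold" where
  "PM = \<lparr>mantop = subtopology (prod_topology (grassmann_topology scale) (grassmann_topology scale))
                         (complementary_pairs scale),
         atlas = {pair_chart E F | E F. gpair E F}\<rparr>"

lemma pairs_iff: "(G, H) \<in> complementary_pairs scale \<longleftrightarrow> gpair G H"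
  using gpair_sym gpair_iff cpl_Gr unfolding complementary_pairs_def gpair_def by blast

lemma pairs_topspace: "complementary_pairs scale \<subseteq> topspace (prod_topology (grassmann_topology scale) (grassmann_topology scale))"
  by (auto simp: complementary_pairs_def topspace_grassmann)

lemma topspace_PM: "topspace (mantop PM) = complementary_pairs scale"
  using pairs_topspace by (simp add: PM_def topspace_subtopology inf.absorb2)

lemma shear_image_inverse:
  assumes "cpl E F" "T \<in> points (OP E F)"
  shows "shear E F (- T) ` shear E F T ` S = S" "shear E F T ` shear E F (- T) ` S = S"
  by (simp_all add: image_image shear_inverse[OF assms])

text \<open>The shear by the coordinate of G carries E to G, and automorphisms preserve
  complementarity.\<close>

lemma shear_slope_cpl_iff:
  assumes c: "cpl E F" and G: "cpl G F"
  shows "cpl (shear E F (- slope E F G) ` H) E \<longleftrightarrow> cpl G H"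
proof -
  let ?T = "slope E F G"
  have T: "?T \<in> points (OP E F)" by (rule slope_op[OF c G])
  note u = unit_pair_shear[OF c T]
  have GE: "shear E F ?T ` E = G" using graph_slope[OF c G] by (simp add: shear_image[OF c])
  have EG: "shear E F (- ?T) ` G = E"
    using shear_image_inverse(1)[OF c T, of E] by (simp only: GE)
  show ?thesis
  proof
    assume "cpl (shear E F (- ?T) ` H) E"
    then have "cpl (shear E F ?T ` E) (shear E F ?T ` shear E F (- ?T) ` H)"
      by (rule unit_pair_cpl[OF u cpl_sym])
    then show "cpl G H" by (simp only: GE shear_image_inverse[OF c T])
  next
    assume "cpl G H"
    then have "cpl (shear E F (- ?T) ` G) (shear E F (- ?T) ` H)"
      by (rule unit_pair_cpl[OF unit_pair_sym[OF u]])
    then show "cpl (shear E F (- ?T) ` H) E" unfolding EG by (rule cpl_sym)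
  qed
qed

lemma chart_param_pair:
  assumes c: "cpl E F"
  shows "chart_param (pair_chart E F) (points (OP E F) \<times> points (OP F E)) (pair_param E F)"
  unfolding chart_param_def pair_chart_def chart.simps
proof (intro conjI equalityI subsetI ballI)
  note c' = cpl_sym[OF c]
  fix v assume "v \<in> points (OP E F) \<times> points (OP F E)"
  then obtain T S where v: "v = (T, S)" "T \<in> points (OP E F)" "S \<in> points (OP F E)" by auto
  show "pair_coord E F (pair_param E F v) = v"
    using v by (simp add: pair_coord_def pair_param_def slope_graph[OF c] slope_graph[OF c'] shear_image_inverse[OF c])
next
  note c' = cpl_sym[OF c]
  fix p assume "p \<in> pair_param E F ` (points (OP E F) \<times> points (OP F E))"
  then obtain T S where v: "p = pair_param E F (T, S)" "T \<in> points (OP E F)" "S \<in> points (OP F E)" by auto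
  have "cpl (shear E F T ` E) (shear E F T ` graph_map F S)"
    by (intro unit_pair_cpl[OF unit_pair_shear[OF c v(2)]] cpl_sym[OF graph_cpl[OF c' v(3)]])
  then show "p \<in> {(G, H). cpl G F \<and> cpl G H}"
    using graph_cpl[OF c v(2)] by (simp add: v(1) pair_param_def shear_image[OF c])
next
  note c' = cpl_sym[OF c]
  fix p assume "p \<in> {(G, H). cpl G F \<and> cpl G H}"
  then obtain G H where p: "p = (G, H)" "cpl G F" "cpl G H" by auto
  let ?T = "slope E F G" and ?K = "shear E F (- slope E F G) ` H"
  have T: "?T \<in> points (OP E F)" by (rule slope_op[OF c p(2)])
  have K: "cpl ?K E" using shear_slope_cpl_iff[OF c p(2)] p(3) by blast
  have "p = pair_param E F (?T, slope F E ?K)"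
    by (simp add: p(1) pair_param_def graph_slope[OF c p(2)] graph_slope[OF c' K] shear_image_inverse[OF c T])
  then show "p \<in> pair_param E F ` (points (OP E F) \<times> points (OP F E))"
    using T slope_op[OF c' K] by blast
qed

text \<open>The second coordinate is the slope of the image of \<open>H1\<close> under the inverse
  shear composed with g2, again an analytic family of automorphisms. So
  \<open>analytic_slope_image\<close> is applied twice. Transitions of pairs and trivializations are
  instances.\<close>

lemma analytic_pair_coord:
  assumes V: "normed_space_on V"
    and g1: "nspace_analytic V BL U g1" and u1: "\<And>x. x \<in> U \<Longrightarrow> unit_pair (g1 x) (g1' x)" and c1: "cpl E1 K1"
    and g2: "nspace_analytic V BL U g2" and u2: "\<And>x. x \<in> U \<Longrightarrow> unit_pair (g2 x) (g2' x)" and c2: "cpl H1 L1"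
    and c: "cpl E F"
  shows "nspace_analytic V (prod_nspace (OP E F) (OP F E))
    {v \<in> U. cpl (g1 v ` E1) F \<and> cpl (g1 v ` E1) (g2 v ` H1)} (\<lambda>v. pair_coord E F (g1 v ` E1, g2 v ` H1))"
proof -
  note c' = cpl_sym[OF c]
  interpret V: normed_space_on V by fact
  interpret B: normed_space_on BL by (rule normed_BL)
  interpret O: normed_space_on "OP E F" by (rule normed_op_cpl[OF c])
  interpret O': normed_space_on "OP F E" by (rule normed_op_cpl[OF c'])
  interpret VB: two_spaces V BL by unfold_locales
  interpret VO: two_spaces V "OP E F" by unfold_locales
  define U1 where "U1 = {v \<in> U. cpl (g1 v ` E1) F}"
  define T where "T = (\<lambda>v. slope E F (g1 v ` E1))"
  have T: "nspace_analytic V (OP E F) U1 T"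
    unfolding T_def U1_def by (rule analytic_slope_image[OF V g1 u1 c1 c])
  have us: "unit_pair (shear E F (T v)) (shear E F (- T v))" if "v \<in> U1" for v
    by (rule unit_pair_shear[OF c analyticD(2)[OF T that]])
  have s: "nspace_analytic V BL U1 (\<lambda>v. shear E F (- T v))"
    by (rule analytic_inverse[OF V analytic_shear[OF V c T] us])
  have "nspace_analytic V BL U1 g2"
    by (rule VB.analytic_subset[OF g2 analyticD(1)[OF T]]) (auto simp: U1_def)
  then have g: "nspace_analytic V BL U1 (\<lambda>v. shear E F (- T v) \<circ> g2 v)"
    by (rule analytic_comp[OF V s])
  have u: "unit_pair (shear E F (- T v) \<circ> g2 v) (g2' v \<circ> shear E F (T v))" if v: "v \<in> U1" for v
    by (rule unit_pair_comp[OF unit_pair_sym[OF us[OF v]] u2]) (use v in \<open>simp add: U1_def\<close>)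
  have S: "nspace_analytic V (OP F E) {v \<in> U1. cpl ((shear E F (- T v) \<circ> g2 v) ` H1) E}
      (\<lambda>v. slope F E ((shear E F (- T v) \<circ> g2 v) ` H1))"
    by (rule analytic_slope_image[OF V g u c2 c'])
  have dom: "{v \<in> U1. cpl ((shear E F (- T v) \<circ> g2 v) ` H1) E} = {v \<in> U. cpl (g1 v ` E1) F \<and> cpl (g1 v ` E1) (g2 v ` H1)}"
  proof -
    have "cpl ((shear E F (- T v) \<circ> g2 v) ` H1) E \<longleftrightarrow> cpl (g1 v ` E1) (g2 v ` H1)" if "cpl (g1 v ` E1) F" for v
      unfolding image_comp[symmetric] T_def by (rule shear_slope_cpl_iff[OF c that])
    then show ?thesis by (auto simp: U1_def)
  qed
  have "nspace_analytic V (OP E F) {v \<in> U. cpl (g1 v ` E1) F \<and> cpl (g1 v ` E1) (g2 v ` H1)} T"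
    by (rule VO.analytic_subset[OF T]) (use analyticD(1)[OF S] dom in \<open>auto simp: U1_def\<close>)
  from analytic_Pair[OF V O.normed_space_on_axioms O'.normed_space_on_axioms this S[unfolded dom]]
  show ?thesis by (simp add: pair_coord_def T_def image_comp)
qed

lemma analytic_fst:
  assumes "normed_space_on V" "normed_space_on W" "openin (ntop (prod_nspace V W)) U"
  shows "nspace_analytic (prod_nspace V W) V U fst"
proof -
  interpret V: normed_space_on V by fact
  interpret W: normed_space_on W by fact
  interpret P: normed_space_on "prod_nspace V W" by (rule normed_prod_nspace) fact+
  interpret two_spaces "prod_nspace V W" V by unfold_locales
  show ?thesis by (rule analytic_linear[OF assms(3), where K = 1]) (auto simp: linear_map_on_def)
qed

lemma analytic_snd:
  assumes "normed_space_on V" "normed_space_on W" "openin (ntop (prod_nspace V W)) U"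
  shows "nspace_analytic (prod_nspace V W) W U snd"
proof -
  interpret V: normed_space_on V by fact
  interpret W: normed_space_on W by fact
  interpret P: normed_space_on "prod_nspace V W" by (rule normed_prod_nspace) fact+
  interpret two_spaces "prod_nspace V W" W by unfold_locales
  show ?thesis by (rule analytic_linear[OF assms(3), where K = 1]) (auto simp: linear_map_on_def)
qed

text \<open>Presents a parametrized pair as images of the fixed subspaces E and F under analytic
  automorphisms, the input that \<open>analytic_pair_coord\<close> expects.\<close>

lemma pair_param_shears:
  assumes c: "cpl E F"
  shows "nspace_analytic (prod_nspace (OP E F) (OP F E)) BL (points (OP E F) \<times> points (OP F E)) (\<lambda>v. shear E F (fst v))"
    and "nspace_analytic (prod_nspace (OP E F) (OP F E)) BL (points (OP E F) \<times> points (OP F E)) (\<lambda>v. shear F E (snd v))"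
    and "v \<in> points (OP E F) \<times> points (OP F E) \<Longrightarrow> unit_pair (shear E F (fst v)) (shear E F (- fst v))"
    and "v \<in> points (OP E F) \<times> points (OP F E) \<Longrightarrow> unit_pair (shear F E (snd v)) (shear F E (- snd v))"
    and "pair_param E F v = (shear E F (fst v) ` E, (shear E F (fst v) \<circ> shear F E (snd v)) ` F)"
proof -
  note c' = cpl_sym[OF c]
  note n = normed_op_cpl[OF c] normed_op_cpl[OF c']
  have op: "openin (ntop (prod_nspace (OP E F) (OP F E))) (points (OP E F) \<times> points (OP F E))"
    using openin_points[OF normed_prod_nspace[OF n]] by simp
  show "nspace_analytic (prod_nspace (OP E F) (OP F E)) BL (points (OP E F) \<times> points (OP F E)) (\<lambda>v. shear E F (fst v))"
    by (rule analytic_shear[OF normed_prod_nspace[OF n] c analytic_fst[OF n op]])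
  show "nspace_analytic (prod_nspace (OP E F) (OP F E)) BL (points (OP E F) \<times> points (OP F E)) (\<lambda>v. shear F E (snd v))"
    by (rule analytic_shear[OF normed_prod_nspace[OF n] c' analytic_snd[OF n op]])
  show "v \<in> points (OP E F) \<times> points (OP F E) \<Longrightarrow> unit_pair (shear E F (fst v)) (shear E F (- fst v))"
    "v \<in> points (OP E F) \<times> points (OP F E) \<Longrightarrow> unit_pair (shear F E (snd v)) (shear F E (- snd v))"
    using unit_pair_shear[OF c, of "fst v"] unit_pair_shear[OF c', of "snd v"] by (auto simp: mem_Times_iff)
  show "pair_param E F v = (shear E F (fst v) ` E, (shear E F (fst v) \<circ> shear F E (snd v)) ` F)"
    unfolding image_comp[symmetric] shear_image[OF c'] shear_image[OF c]
    by (simp add: pair_param_def case_prod_unfold)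
qed

lemma pair_param_shears':
  assumes c: "cpl E F"
  shows "nspace_analytic (prod_nspace (OP E F) (OP F E)) BL (points (OP E F) \<times> points (OP F E))
      (\<lambda>v. shear E F (fst v) \<circ> shear F E (snd v))"
    and "v \<in> points (OP E F) \<times> points (OP F E) \<Longrightarrow>
      unit_pair (shear E F (fst v) \<circ> shear F E (snd v)) (shear F E (- snd v) \<circ> shear E F (- fst v))"
  by (rule analytic_comp[OF normed_prod_nspace[OF normed_op_cpl[OF c] normed_op_cpl[OF cpl_sym[OF c]]]
        pair_param_shears(1)[OF c] pair_param_shears(2)[OF c]])
    (rule unit_pair_comp[OF pair_param_shears(3)[OF c] pair_param_shears(4)[OF c]])

text \<open>Both components of the parametrization are moving subspaces, hence continuous by
  \<open>openin_image_preimage\<close>.\<close>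

lemma openin_pair_param_preimage:
  assumes c: "cpl E F" and S: "openin (mantop PM) S"
  shows "openin (ntop (prod_nspace (OP E F) (OP F E))) {v \<in> points (OP E F) \<times> points (OP F E). pair_param E F v \<in> S}"
proof (subst openin_subopen, intro ballI)
  note c' = cpl_sym[OF c]
  let ?P = "prod_nspace (OP E F) (OP F E)"
  let ?W = "points (OP E F) \<times> points (OP F E)"
  have nP: "normed_space_on ?P" by (intro normed_prod_nspace normed_op_cpl c c')
  fix v assume v: "v \<in> {v \<in> ?W. pair_param E F v \<in> S}"
  obtain S' where S': "openin (prod_topology (grassmann_topology scale) (grassmann_topology scale)) S'"
    "S = S' \<inter> complementary_pairs scale"
    using S by (auto simp: PM_def openin_subtopology)
  obtain G H where GH: "pair_param E F v = (G, H)" by (cases "pair_param E F v")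
  then have GHS: "(G, H) \<in> S'" using v S' by simp
  obtain A B where AB: "openin (grassmann_topology scale) A" "openin (grassmann_topology scale) B"
    "G \<in> A" "H \<in> B" "A \<times> B \<subseteq> S'"
    using S'(1)[unfolded openin_prod_topology_alt, rule_format, OF GHS] by (elim exE conjE) (rule that)
  let ?A = "{v \<in> ?W. shear E F (fst v) ` E \<in> A}"
  let ?B = "{v \<in> ?W. (shear E F (fst v) \<circ> shear F E (snd v)) ` F \<in> B}"
  have A: "openin (ntop ?P) ?A"
    by (rule openin_image_preimage[OF nP pair_param_shears(1)[OF c] pair_param_shears(3)[OF c] c AB(1)])
  have B: "openin (ntop ?P) ?B"
    by (rule openin_image_preimage[OF nP pair_param_shears'(1)[OF c] pair_param_shears'(2)[OF c] c' AB(2)])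
  have "v \<in> ?A \<inter> ?B" using v GH AB by (simp add: pair_param_shears(5)[OF c])
  moreover have "?A \<inter> ?B \<subseteq> {v \<in> ?W. pair_param E F v \<in> S}"
  proof
    fix w assume w: "w \<in> ?A \<inter> ?B"
    have Gr: "A \<subseteq> Gr" "B \<subseteq> Gr" using AB openin_subset topspace_grassmann by blast+
    have "pair_param E F w \<in> A \<times> B" using w by (simp add: pair_param_shears(5)[OF c])
    moreover have "pair_param E F w \<in> chart_dom (pair_chart E F)"
      by (rule chart_paramD(4)[OF chart_param_pair[OF c]]) (use w in simp)
    \<comment> \<open>Parametrized pairs are complementary by construction of the chart, so an open
      rectangle in the product topology suffices.\<close>
    ultimately have "pair_param E F w \<in> S' \<inter> complementary_pairs scale"
      using AB(5) Gr by (auto simp: pair_chart_def pairs_iff gpair_iff)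
    then show "w \<in> {v \<in> ?W. pair_param E F v \<in> S}" using w S' by simp
  qed
  ultimately show "\<exists>T. openin (ntop ?P) T \<and> v \<in> T \<and> T \<subseteq> {v \<in> ?W. pair_param E F v \<in> S}"
    using openin_Int[OF A B] by (intro exI[of _ "?A \<inter> ?B"]) simp
qed

text \<open>Around (G, H) the product topology is described by charts centred at G and at H. In
  these coordinates \<open>pair_coord\<close> is analytic, so an open set of parameters contains a
  product of neighbourhoods.\<close>

lemma openin_pair_param_image:
  assumes p: "gpair E F" and S: "S \<subseteq> chart_dom (pair_chart E F)"
    and W: "openin (ntop (prod_nspace (OP E F) (OP F E))) {v \<in> points (OP E F) \<times> points (OP F E). pair_param E F v \<in> S}"
  shows "openin (mantop PM) S"
proof -
  note c = gpairD(1)[OF p]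
  note q = chart_param_pair[OF c]
  let ?t = "grassmann_topology scale"
  let ?W = "{v \<in> points (OP E F) \<times> points (OP F E). pair_param E F v \<in> S}"
  have Sp: "S \<subseteq> complementary_pairs scale"
  proof
    fix x assume x: "x \<in> S"
    obtain G H where GH: "x = (G, H)" by (cases x)
    have "cpl G F" "cpl G H" using x S GH by (auto simp: pair_chart_def)
    then show "x \<in> complementary_pairs scale"
      using GH cpl_Gr[OF _ gpairD(2)[OF p], of G] cpl_Gr[OF cpl_sym, of G H] by (simp add: pairs_iff gpair_iff)
  qed
  have "openin (prod_topology ?t ?t) S"
    unfolding openin_prod_topology_alt
  proof (intro allI impI)
    fix G H assume GH: "(G, H) \<in> S"
    then have pGH: "gpair G H" using Sp pairs_iff by blast
    note d = gpairD(1)[OF pGH]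
    note d' = cpl_sym[OF d]
    let ?P = "prod_nspace (OP G H) (OP H G)"
    let ?X = "points (OP G H) \<times> points (OP H G)"
    have nP: "normed_space_on ?P" by (intro normed_prod_nspace normed_op_cpl d d')
    have nQ: "normed_space_on (prod_nspace (OP E F) (OP F E))" by (intro normed_prod_nspace normed_op_cpl c cpl_sym[OF c])
    interpret T: two_spaces ?P "prod_nspace (OP E F) (OP F E)" using nP nQ by (simp add: two_spaces_def)
    \<comment> \<open>The two graphs vary independently here, so their being complementary is a
      condition on v.\<close>
    let ?U = "{v \<in> ?X. cpl (shear G H (fst v) ` G) F \<and> cpl (shear G H (fst v) ` G) (shear H G (snd v) ` H)}"
    let ?k = "\<lambda>v. pair_coord E F (shear G H (fst v) ` G, shear H G (snd v) ` H)"
    have an: "nspace_analytic ?P (prod_nspace (OP E F) (OP F E)) ?U ?k"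
      by (rule analytic_pair_coord[OF nP pair_param_shears(1)[OF d] pair_param_shears(3)[OF d] d
            pair_param_shears(2)[OF d] pair_param_shears(4)[OF d] d' c])
    have op: "openin (ntop ?P) {v \<in> ?U. ?k v \<in> ?W}" by (rule T.analytic_openin_preimage[OF an W])
    have kS: "pair_param E F (?k v) = (shear G H (fst v) ` G, shear H G (snd v) ` H)" if "v \<in> ?U" for v
    proof -
      have "(shear G H (fst v) ` G, shear H G (snd v) ` H) \<in> chart_dom (pair_chart E F)"
        using that by (simp add: pair_chart_def)
      from chart_paramD(5)[OF q this] show ?thesis by (simp add: pair_chart_def)
    qed
    have z: "0 \<in> ?X" using zero_op[OF d] zero_op[OF d'] by (simp add: zero_prod_def)
    have "(G, H) \<in> chart_dom (pair_chart E F)" using GH S by blast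
    then have zU: "0 \<in> ?U" using z by (simp add: pair_chart_def)
    have "?k 0 \<in> points (OP E F) \<times> points (OP F E)" using analyticD(2)[OF an zU] by simp
    then have "0 \<in> {v \<in> ?U. ?k v \<in> ?W}" using zU kS[OF zU] GH by simp
    then have z00: "(0, 0) \<in> {v \<in> ?U. ?k v \<in> ?W}" by (simp only: zero_prod_def)
    obtain A B where AB: "openin (ntop (OP G H)) A" "openin (ntop (OP H G)) B" "0 \<in> A" "0 \<in> B"
      "A \<times> B \<subseteq> {v \<in> ?U. ?k v \<in> ?W}"
      using op[unfolded ntop_prod_nspace[OF normed_op_cpl[OF d] normed_op_cpl[OF d']] openin_prod_topology_alt, rule_format, OF z00]
      by (elim exE conjE) (rule that)
    have sub: "A \<subseteq> points (OP G H)" "B \<subseteq> points (OP H G)"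
      using openin_subset[OF AB(1)] openin_subset[OF AB(2)]
      by (simp_all add: normed_space_on.topspace_ntop normed_op_cpl d d')
    have oA: "openin ?t (graph_map G ` A)" using openin_graph_image[OF pGH sub(1)] AB by simp
    have oB: "openin ?t (graph_map H ` B)" using openin_graph_image[OF gpair_sym[OF pGH] sub(2)] AB by simp
    have "graph_map G ` A \<times> graph_map H ` B \<subseteq> S"
    proof clarify
      fix T T' assume T: "T \<in> A" "T' \<in> B"
      then have v: "(T, T') \<in> {v \<in> ?U. ?k v \<in> ?W}" using AB(5) by blast
      then have "pair_param E F (?k (T, T')) \<in> S" by simp
      then show "(graph_map G T, graph_map H T') \<in> S"
        using kS[of "(T, T')"] v by (simp add: shear_image[OF d] shear_image[OF d'])
    qed
    moreover have "G \<in> graph_map G ` A" "H \<in> graph_map H ` B"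
      using AB(3,4) image_eqI[of G "graph_map G" 0] image_eqI[of H "graph_map H" 0] by simp_all
    ultimately show "\<exists>U V. openin ?t U \<and> openin ?t V \<and> G \<in> U \<and> H \<in> V \<and> U \<times> V \<subseteq> S"
      using oA oB by blast
  qed
  then show ?thesis
    using Sp by (auto simp: PM_def openin_subtopology intro!: exI[of _ S])
qed

lemma atlas_PM: "atlas PM = {pair_chart E F | E F. gpair E F}"
  by (simp add: PM_def)

lemma pair_chart_simps:
  "chart_dom (pair_chart E F) = {(G, H). cpl G F \<and> cpl G H}" "chart_map (pair_chart E F) = pair_coord E F"
  "chart_model (pair_chart E F) = prod_nspace (OP E F) (OP F E)"
  by (simp_all add: pair_chart_def)

lemma normed_pair: "cpl E F \<Longrightarrow> normed_space_on (prod_nspace (OP E F) (OP F E))"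
  by (rule normed_prod_nspace[OF normed_op_cpl normed_op_cpl[OF cpl_sym]])

lemma atlas_ok_PM: "atlas_ok PM"
  unfolding atlas_ok_def
proof (intro conjI ballI)
  show "(\<Union>c\<in>atlas PM. chart_dom c) = topspace (mantop PM)"
  proof (intro equalityI subsetI)
    fix x assume "x \<in> (\<Union>c\<in>atlas PM. chart_dom c)"
    then obtain E F where p: "gpair E F" "x \<in> chart_dom (pair_chart E F)" by (auto simp: atlas_PM)
    obtain G H where GH: "x = (G, H)" by (cases x)
    have "cpl G F" "cpl G H" using p GH by (auto simp: pair_chart_simps)
    then show "x \<in> topspace (mantop PM)"
      using GH cpl_Gr[OF _ gpairD(2)[OF p(1)], of G] cpl_Gr[OF cpl_sym, of G H] by (simp add: pairs_iff gpair_iff topspace_PM)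
  next
    fix x assume x: "x \<in> topspace (mantop PM)"
    obtain G H where GH: "x = (G, H)" by (cases x)
    then have p: "gpair G H" using x by (simp add: topspace_PM pairs_iff)
    then have "x \<in> chart_dom (pair_chart G H)" using GH by (simp add: pair_chart_simps gpairD)
    then show "x \<in> (\<Union>c\<in>atlas PM. chart_dom c)" using p by (auto simp: atlas_PM)
  qed
  fix c assume "c \<in> atlas PM"
  then obtain E F where p: "gpair E F" and c: "c = pair_chart E F" by (auto simp: atlas_PM)
  note cp = gpairD(1)[OF p]
  note q = chart_param_pair[OF cp]
  show "chart_ok (mantop PM) c"
    unfolding c
  proof (rule chart_ok_paramI[OF q])
    have n: "normed_space_on (prod_nspace (OP E F) (OP F E))" by (rule normed_pair[OF cp])
    then show "normed_space_on (chart_model (pair_chart E F))" by (simp add: pair_chart_simps)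
    have "{v \<in> points (OP E F) \<times> points (OP F E). pair_param E F v \<in> chart_dom (pair_chart E F)} = points (prod_nspace (OP E F) (OP F E))"
      using chart_paramD(4)[OF q] by auto
    then show "openin (mantop PM) (chart_dom (pair_chart E F))"
      using openin_points[OF n] by (intro openin_pair_param_image[OF p order_refl]) simp
    fix S assume S: "S \<subseteq> chart_dom (pair_chart E F)"
    show "openin (mantop PM) S \<longleftrightarrow> openin (ntop (chart_model (pair_chart E F)))
       {v \<in> points (OP E F) \<times> points (OP F E). pair_param E F v \<in> S}"
      unfolding pair_chart_simps
      using openin_pair_param_preimage[OF cp] openin_pair_param_image[OF p S] by blast
  qed (simp add: pair_chart_simps)
qed

lemma analytic_pair_param_coord:
  assumes c1: "cpl E1 F1" and c: "cpl E F"
  shows "nspace_analytic (prod_nspace (OP E1 F1) (OP F1 E1)) (prod_nspace (OP E F) (OP F E))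
    {v \<in> points (OP E1 F1) \<times> points (OP F1 E1). pair_param E1 F1 v \<in> chart_dom (pair_chart E F)}
    (\<lambda>v. pair_coord E F (pair_param E1 F1 v))"
  using analytic_pair_coord[OF normed_pair[OF c1] pair_param_shears(1)[OF c1] pair_param_shears(3)[OF c1] c1
      pair_param_shears'(1)[OF c1] pair_param_shears'(2)[OF c1] cpl_sym[OF c1] c]
  by (simp add: pair_chart_simps pair_param_shears(5)[OF c1])

theorem banach_manifold_PM: "banach_manifold PM"
proof (rule banach_manifoldI)
  show "Hausdorff_space (mantop PM)"
    unfolding PM_def manifold.simps
    by (intro Hausdorff_space_subtopology) (simp add: Hausdorff_space_prod_topology Hausdorff_grassmann)
  show "atlas_ok PM" by (rule atlas_ok_PM)
  fix c assume "c \<in> atlas PM"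
  then obtain E F where p: "gpair E F" and c: "c = pair_chart E F" by (auto simp: atlas_PM)
  note cp = gpairD(1)[OF p]
  show "banach_space_on (chart_model c)"
    unfolding c pair_chart_simps by (intro banach_prod_nspace banach_op cplD[OF cp])
  fix d assume "d \<in> atlas PM"
  then obtain E' F' where p': "gpair E' F'" and d: "d = pair_chart E' F'" by (auto simp: atlas_PM)
  note cp' = gpairD(1)[OF p']
  show "nspace_analytic (chart_model c) (chart_model d)
          (chart_map c ` {p \<in> chart_dom c. p \<in> chart_dom d}) (chart_map d \<circ> (\<lambda>p. p) \<circ> chart_inv c)"
    unfolding c
    by (rule param_analytic[OF chart_param_pair[OF cp], where F = "\<lambda>v. pair_coord E' F' (pair_param E F v)"])
      (use normed_pair[OF cp] normed_pair[OF cp'] analytic_pair_param_coord[OF cp cp'] in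
        \<open>simp_all add: d pair_chart_simps(2,3)\<close>)
qed

theorem analytic_fst_PM: "manifold_analytic PM GrM (topspace (mantop PM)) fst"
proof (rule manifold_analyticI[OF atlas_ok_PM atlas_ok_grassmann openin_topspace])
  show "fst ` topspace (mantop PM) \<subseteq> topspace (mantop GrM)"
    by (auto simp: topspace_PM topspace_grassmann complementary_pairs_def)
  fix c d assume "c \<in> atlas PM" "d \<in> atlas GrM"
  then obtain E F E' F' where p: "gpair E F" and c: "c = pair_chart E F"
    and p': "gpair E' F'" and d: "d = grassmann_chart scale E' F'" by (auto simp: atlas_PM atlas_grassmann)
  note cp = gpairD(1)[OF p] and cp' = gpairD(1)[OF p']
  have top: "x \<in> topspace (mantop PM)" if "x \<in> chart_dom c" for x
    using atlas_ok_PM that \<open>c \<in> atlas PM\<close> by (auto simp: atlas_ok_def)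
  have Q: "{p \<in> chart_dom c. p \<in> topspace (mantop PM) \<and> fst p \<in> chart_dom d} = {p \<in> chart_dom c. fst p \<in> chart_dom d}"
    using top by auto
  have an: "nspace_analytic (prod_nspace (OP E F) (OP F E)) (OP E' F')
      {v \<in> points (OP E F) \<times> points (OP F E). cpl (shear E F (fst v) ` E) F'} (\<lambda>v. slope E' F' (shear E F (fst v) ` E))"
    by (rule analytic_slope_image[OF normed_pair[OF cp] pair_param_shears(1)[OF cp] pair_param_shears(3)[OF cp] cp cp'])
  show "nspace_analytic (chart_model c) (chart_model d)
      (chart_map c ` {p \<in> chart_dom c. p \<in> topspace (mantop PM) \<and> fst p \<in> chart_dom d}) (chart_map d \<circ> fst \<circ> chart_inv c)"
    unfolding Q unfolding c
    by (rule param_analytic[OF chart_param_pair[OF cp], where F = "\<lambda>v. slope E' F' (shear E F (fst v) ` E)"])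
      (use normed_pair[OF cp] normed_op_cpl[OF cp'] an p' in
        \<open>simp_all add: d pair_chart_simps(2,3) dom_grassmann map_grassmann pair_param_shears(5)[OF cp]\<close>)
qed

end

lemma affine_banach_subspace_points:
  assumes "normed_space_on Y" shows "affine_banach_subspace Y (points Y)"
proof -
  interpret normed_space_on Y by fact
  have "closedin (ntop Y) (points Y)" using closedin_topspace[of "ntop Y"] by simp
  then show ?thesis
    unfolding affine_banach_subspace_def
    by (auto simp: direction_points[OF assms zero_mem] zero_mem add_mem smult_mem intro!: bexI[of _ 0])
qed

lemma analytic_diff_const:
  assumes "normed_space_on V" "normed_space_on W" "nspace_analytic V W U f" "c \<in> points W"
  shows "nspace_analytic V W U (\<lambda>x. f x - c)"
proof -
  interpret V: normed_space_on V by fact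
  interpret W: normed_space_on W by fact
  interpret two_spaces V W by unfold_locales
  have "nspace_analytic V W U (\<lambda>x. f x + (- c))"
    by (intro analytic_add analytic_const assms W.uminus_mem analyticD(1)[OF assms(3)])
  then show ?thesis by simp
qed

lemma analytic_snd_comp:
  assumes "normed_space_on V" "normed_space_on W" "normed_space_on Z" "nspace_analytic V (prod_nspace W Z) U f"
  shows "nspace_analytic V Z U (\<lambda>x. snd (f x))"
proof -
  interpret V: normed_space_on V by fact
  interpret W: normed_space_on W by fact
  interpret Z: normed_space_on Z by fact
  interpret P: normed_space_on "prod_nspace W Z" by (rule normed_prod_nspace) fact+
  interpret two_spaces V "prod_nspace W Z" by unfold_locales
  show ?thesis
    by (rule analytic_compose_linear[OF assms(4,3), where K = 1]) (auto simp: linear_map_on_def)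
qed

context banach_scaling begin

section \<open>The fibers\<close>

text \<open>One choice serves twice: it is the origin of the fiber over E, and its complements form
  the neighbourhood of E on which the bundle is trivialized.\<close>

definition some_compl :: "'a set \<Rightarrow> 'a set" where
  "some_compl E = (SOME F. gpair E F)"

lemma gpair_some_compl: "E \<in> Gr \<Longrightarrow> gpair E (some_compl E)"
  unfolding some_compl_def by (rule someI_ex[OF Gr_gpair'])

lemma cpl_some_compl: "E \<in> Gr \<Longrightarrow> cpl E (some_compl E)" "E \<in> Gr \<Longrightarrow> cpl (some_compl E) E"
  using gpairD(1)[OF gpair_some_compl, of E] cpl_sym[OF gpairD(1)[OF gpair_some_compl], of E] by simp_all

definition fib :: "'a set \<Rightarrow> ('a set \<times> 'a set) set" where
  "fib E = fiber PM fst {E}"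

definition fiber_coord :: "'a set \<Rightarrow> 'a set \<times> 'a set \<Rightarrow> 'a \<Rightarrow> 'a" where
  "fiber_coord E p = slope (some_compl E) E (snd p)"

abbreviation fiber_chart :: "'a set \<Rightarrow> ('k, 'a set \<times> 'a set, 'a \<Rightarrow> 'a) chart" where
  "fiber_chart E \<equiv> \<lparr>chart_dom = fib E, chart_map = fiber_coord E, chart_model = OP (some_compl E) E\<rparr>"

lemma cpl_gpair: "E \<in> Gr \<Longrightarrow> cpl E H \<Longrightarrow> gpair E H"
  by (rule gpair_sym) (simp add: gpair_iff cpl_sym)

lemma gpair_iff_cpl: "E \<in> Gr \<Longrightarrow> gpair E H \<longleftrightarrow> cpl H E"
  using cpl_gpair[of E H] gpairD(1)[of E H] cpl_sym[of E H] cpl_sym[of H E] by blast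

lemma mem_fib: "E \<in> Gr \<Longrightarrow> p \<in> fib E \<longleftrightarrow> fst p = E \<and> cpl (snd p) E"
  by (cases p) (auto simp: fib_def fiber_def topspace_PM pairs_iff gpair_iff_cpl)

lemma chart_param_fiber:
  assumes E: "E \<in> Gr"
  shows "chart_param (fiber_chart E) (points (OP (some_compl E) E)) (\<lambda>S. (E, graph_map (some_compl E) S))"
  unfolding chart_param_def chart.simps
proof (intro conjI ballI)
  note c = cpl_some_compl(2)[OF E]
  show "(\<lambda>S. (E, graph_map (some_compl E) S)) ` points (OP (some_compl E) E) = fib E"
  proof (intro equalityI subsetI)
    fix p assume "p \<in> fib E"
    then have p: "fst p = E" "cpl (snd p) E" using mem_fib[OF E] by auto
    then have "snd p \<in> graph_map (some_compl E) ` points (OP (some_compl E) E)" using graph_map_onto[OF c] by simp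
    then show "p \<in> (\<lambda>S. (E, graph_map (some_compl E) S)) ` points (OP (some_compl E) E)"
      using p(1) by (cases p) auto
  qed (auto simp: mem_fib[OF E] graph_cpl[OF c])
  show "fiber_coord E (E, graph_map (some_compl E) S) = S" if "S \<in> points (OP (some_compl E) E)" for S
    using slope_graph[OF c that] by (simp add: fiber_coord_def)
qed

lemma fib_subset: "fib E \<subseteq> topspace (mantop PM)"
  by (auto simp: fib_def fiber_def)

lemma topspace_fib: "topspace (subtopology (mantop PM) (fib E)) = fib E"
  using fib_subset by (auto simp: topspace_subtopology)

lemma openin_fib_self: "openin (subtopology (mantop PM) (fib E)) (fib E)"
  using openin_topspace[of "subtopology (mantop PM) (fib E)"] by (simp only: topspace_fib)

text \<open>On the fiber the first component is constant, so the subspace topology is that of the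
  second component; the complements of E are already open in the Grassmannian.\<close>

lemma openin_fib:
  assumes E: "E \<in> Gr" and S: "S \<subseteq> fib E"
  shows "openin (subtopology (mantop PM) (fib E)) S \<longleftrightarrow> openin (grassmann_topology scale) {H. (E, H) \<in> S}"
proof
  let ?t = "grassmann_topology scale"
  have fp: "complementary_pairs scale \<inter> fib E = fib E" using fib_subset[of E] by (auto simp: topspace_PM)
  have top: "subtopology (mantop PM) (fib E) = subtopology (prod_topology ?t ?t) (fib E)"
    by (simp add: PM_def subtopology_subtopology fp)
  {
    assume "openin (subtopology (mantop PM) (fib E)) S"
    then obtain S' where S': "openin (prod_topology ?t ?t) S'" "S = S' \<inter> fib E"
      unfolding top openin_subtopology by blast
    show "openin ?t {H. (E, H) \<in> S}"
    proof (subst openin_subopen, intro ballI)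
      fix H assume H: "H \<in> {H. (E, H) \<in> S}"
      then have "(E, H) \<in> S'" using S' by simp
      from S'(1)[unfolded openin_prod_topology_alt, rule_format, OF this]
      obtain U V where UV: "openin ?t U" "openin ?t V" "E \<in> U" "H \<in> V" "U \<times> V \<subseteq> S'"
        by (elim exE conjE) (rule that)
      \<comment> \<open>Restricting V to complements of E keeps the pairs (E, H) inside the
        fiber.\<close>
      have "openin ?t (V \<inter> {H. cpl H E})" by (intro openin_Int UV openin_complements E)
      moreover have "H \<in> V \<inter> {H. cpl H E}" using H S UV mem_fib[OF E, of "(E, H)"] by auto
      moreover have "V \<inter> {H. cpl H E} \<subseteq> {H. (E, H) \<in> S}"
        using UV(3,5) S'(2) mem_fib[OF E] by auto
      ultimately show "\<exists>T. openin ?t T \<and> H \<in> T \<and> T \<subseteq> {H. (E, H) \<in> S}" by blast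
    qed
  }
  assume "openin ?t {H. (E, H) \<in> S}"
  then have "openin (prod_topology ?t ?t) (topspace ?t \<times> {H. (E, H) \<in> S})"
    by (simp add: openin_prod_Times_iff)
  moreover have "S = (topspace ?t \<times> {H. (E, H) \<in> S}) \<inter> fib E"
  proof (intro equalityI subsetI)
    fix p assume p: "p \<in> S"
    then have "fst p = E" using S mem_fib[OF E, of p] by blast
    then show "p \<in> (topspace ?t \<times> {H. (E, H) \<in> S}) \<inter> fib E"
      using p S E by (cases p) (auto simp: topspace_grassmann)
  next
    fix p assume p: "p \<in> (topspace ?t \<times> {H. (E, H) \<in> S}) \<inter> fib E"
    then have "fst p = E" "(E, snd p) \<in> S" using mem_fib[OF E, of p] by auto
    then show "p \<in> S" by (cases p) auto
  qed
  ultimately show "openin (subtopology (mantop PM) (fib E)) S"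
    unfolding top openin_subtopology by blast
qed

lemma chart_ok_fiber:
  assumes E: "E \<in> Gr"
  shows "chart_ok (subtopology (mantop PM) (fib E)) (fiber_chart E)"
proof (rule chart_ok_paramI[OF chart_param_fiber[OF E]])
  note c = cpl_some_compl(2)[OF E]
  have p: "gpair (some_compl E) E" by (rule gpair_sym[OF gpair_some_compl[OF E]])
  show "openin (subtopology (mantop PM) (fib E)) (chart_dom (fiber_chart E))"
    by (simp add: openin_fib_self)
  show "normed_space_on (chart_model (fiber_chart E))" using normed_op_cpl[OF c] by simp
  fix S assume "S \<subseteq> chart_dom (fiber_chart E)"
  then have S: "S \<subseteq> fib E" by simp
  let ?W = "{v \<in> points (OP (some_compl E) E). (E, graph_map (some_compl E) v) \<in> S}"
  have "graph_map (some_compl E) ` ?W = {H. (E, H) \<in> S}"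
  proof (intro equalityI subsetI)
    fix H assume H: "H \<in> {H. (E, H) \<in> S}"
    then have "cpl H E" using S mem_fib[OF E] by auto
    then have "slope (some_compl E) E H \<in> points (OP (some_compl E) E)" "graph_map (some_compl E) (slope (some_compl E) E H) = H"
      by (simp_all add: slope_op[OF c] graph_slope[OF c])
    then show "H \<in> graph_map (some_compl E) ` ?W" using H by (intro image_eqI[of _ _ "slope (some_compl E) E H"]) auto
  qed auto
  then show "openin (subtopology (mantop PM) (fib E)) S \<longleftrightarrow> openin (ntop (chart_model (fiber_chart E))) ?W"
    using openin_fib[OF E S] openin_graph_image[OF p, of ?W] by simp
qed simp

abbreviation fiberM :: "'a set \<Rightarrow> ('k, 'a set \<times> 'a set, 'a \<Rightarrow> 'a) manifold" where
  "fiberM E \<equiv> affine_manifold (subtopology (mantop PM) (fib E)) (fiber_coord E) (OP (some_compl E) E) (points (OP (some_compl E) E))"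

lemma atlas_fiberM:
  assumes E: "E \<in> Gr"
  shows "atlas (fiberM E) = {\<lparr>chart_dom = fib E, chart_map = (\<lambda>p. fiber_coord E p - a), chart_model = OP (some_compl E) E\<rparr>
    | a. a \<in> points (OP (some_compl E) E)}"
  unfolding atlas_affine_manifold[OF normed_op_cpl[OF cpl_some_compl(2)[OF E]]] topspace_fib ..

lemma atlas_ok_fiberM:
  assumes E: "E \<in> Gr" shows "atlas_ok (fiberM E)"
proof (rule atlas_ok_affine[OF normed_op_cpl[OF cpl_some_compl(2)[OF E]]], unfold topspace_fib)
  show "chart_ok (subtopology (mantop PM) (fib E)) (fiber_chart E)" by (rule chart_ok_fiber[OF E])
  show "fiber_coord E ` fib E = points (OP (some_compl E) E)"
    using chart_paramD(1)[OF chart_param_fiber[OF E]] by simp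
qed

lemma homeomorphic_fiber:
  assumes E: "E \<in> Gr"
  shows "homeomorphic_map (subtopology (mantop PM) (fib E))
    (subtopology (ntop (OP (some_compl E) E)) (points (OP (some_compl E) E))) (fiber_coord E)"
  using chart_ok_homeomorphic[OF chart_ok_fiber[OF E]] chart_paramD(1)[OF chart_param_fiber[OF E]]
  by (simp add: subtopology_subtopology)

lemma fiber_coord_inverse:
  "\<lbrakk>E \<in> Gr; S \<in> points (OP (some_compl E) E)\<rbrakk> \<Longrightarrow> the_inv_into (fib E) (fiber_coord E) S = (E, graph_map (some_compl E) S)"
  using chart_paramD(7)[OF chart_param_fiber] by (simp add: chart_inv_def)

section \<open>The trivializations\<close>

definition nbhd :: "'a set \<Rightarrow> 'a set set" where
  "nbhd E = {G. cpl G (some_compl E)}"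

definition mover :: "'a set \<Rightarrow> 'a set \<Rightarrow> 'a \<Rightarrow> 'a" where
  "mover E G = shear E (some_compl E) (slope E (some_compl E) G)"

definition mover_inv :: "'a set \<Rightarrow> 'a set \<Rightarrow> 'a \<Rightarrow> 'a" where
  "mover_inv E G = shear E (some_compl E) (- slope E (some_compl E) G)"

definition triv :: "'a set \<Rightarrow> 'a set \<times> ('a set \<times> 'a set) \<Rightarrow> 'a set \<times> 'a set" where
  "triv E = (\<lambda>(G, p). (G, mover E G ` snd p))"

definition triv_inv :: "'a set \<Rightarrow> 'a set \<times> 'a set \<Rightarrow> 'a set \<times> ('a set \<times> 'a set)" where
  "triv_inv E = (\<lambda>(G, H). (G, (E, mover_inv E G ` H)))"

lemma mover:
  assumes E: "E \<in> Gr" and G: "G \<in> nbhd E"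
  shows "unit_pair (mover E G) (mover_inv E G)" "mover E G ` E = G" "mover_inv E G ` G = E"
    "mover E G ` mover_inv E G ` H = H" "mover_inv E G ` mover E G ` H = H"
    "cpl (mover_inv E G ` H) E \<longleftrightarrow> cpl G H"
proof -
  note c = cpl_some_compl(1)[OF E]
  have G': "cpl G (some_compl E)" using G by (simp add: nbhd_def)
  have T: "slope E (some_compl E) G \<in> points (OP E (some_compl E))" by (rule slope_op[OF c G'])
  show "unit_pair (mover E G) (mover_inv E G)" unfolding mover_def mover_inv_def by (rule unit_pair_shear[OF c T])
  show 1: "mover E G ` E = G" unfolding mover_def shear_image[OF c] by (rule graph_slope[OF c G'])
  show 2: "mover E G ` mover_inv E G ` H = H" "mover_inv E G ` mover E G ` H = H" for H
    by (simp_all only: mover_def mover_inv_def shear_image_inverse[OF c T])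
  show "mover_inv E G ` G = E" using 2(2)[of E] by (simp only: 1)
  show "cpl (mover_inv E G ` H) E \<longleftrightarrow> cpl G H"
    unfolding mover_inv_def by (rule shear_slope_cpl_iff[OF c G'])
qed

lemma mover_cpl_iff:
  assumes "E \<in> Gr" "G \<in> nbhd E" shows "cpl G (mover E G ` H) \<longleftrightarrow> cpl H E"
  using mover(6)[OF assms, of "mover E G ` H"] by (simp only: mover(5)[OF assms])

lemma nbhd_Gr: "\<lbrakk>E \<in> Gr; G \<in> nbhd E\<rbrakk> \<Longrightarrow> G \<in> Gr"
  using cpl_Gr gpairD(2)[OF gpair_some_compl] by (simp add: nbhd_def)

lemma fiber_nbhd:
  assumes E: "E \<in> Gr" shows "fiber PM fst (nbhd E) = {(G, H). G \<in> nbhd E \<and> cpl G H}"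
proof -
  have "gpair G H \<longleftrightarrow> cpl G H" if "G \<in> nbhd E" for G H
    using cpl_gpair[OF nbhd_Gr[OF E that], of H] gpairD(1)[of G H] by blast
  then show ?thesis by (auto simp: fiber_def topspace_PM pairs_iff)
qed

lemma triv_mem:
  assumes E: "E \<in> Gr" and p: "p \<in> nbhd E \<times> fib E" shows "triv E p \<in> fiber PM fst (nbhd E)"
proof -
  obtain G E' H where p': "p = (G, (E', H))" by (cases p) auto
  have "G \<in> nbhd E" "cpl H E" using p mem_fib[OF E] by (auto simp: p')
  then show ?thesis unfolding fiber_nbhd[OF E] using mover_cpl_iff[OF E] by (auto simp: p' triv_def)
qed

lemma triv_inv_mem:
  assumes E: "E \<in> Gr" and p: "p \<in> fiber PM fst (nbhd E)" shows "triv_inv E p \<in> nbhd E \<times> fib E"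
proof -
  obtain G H where p': "p = (G, H)" by (cases p) auto
  have "G \<in> nbhd E" "cpl G H" using p unfolding fiber_nbhd[OF E] by (auto simp: p')
  then show ?thesis using mover(6)[OF E] mem_fib[OF E] by (auto simp: p' triv_inv_def)
qed

lemma triv_triv_inv: "\<lbrakk>E \<in> Gr; p \<in> fiber PM fst (nbhd E)\<rbrakk> \<Longrightarrow> triv E (triv_inv E p) = p"
  using mover(4) by (cases p) (auto simp: triv_inv_def triv_def fiber_nbhd)

lemma triv_inv_triv:
  assumes E: "E \<in> Gr" and p: "p \<in> nbhd E \<times> fib E" shows "triv_inv E (triv E p) = p"
proof -
  obtain G E' H where p': "p = (G, (E', H))" by (cases p) auto
  have "G \<in> nbhd E" "E' = E" using p mem_fib[OF E] by (auto simp: p')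
  then show ?thesis using mover(5)[OF E] by (simp add: p' triv_def triv_inv_def)
qed

lemma bij_triv: "E \<in> Gr \<Longrightarrow> bij_betw (triv E) (nbhd E \<times> fib E) (fiber PM fst (nbhd E))"
  by (rule bij_betw_byWitness[where f' = "triv_inv E"])
    (use triv_triv_inv triv_inv_triv triv_mem triv_inv_mem in blast)+

lemma the_inv_triv:
  assumes E: "E \<in> Gr" and p: "p \<in> fiber PM fst (nbhd E)"
  shows "the_inv_into (nbhd E \<times> fib E) (triv E) p = triv_inv E p"
  using the_inv_into_f_f[OF bij_betw_imp_inj_on[OF bij_triv[OF E]] triv_inv_mem[OF E p]]
  by (simp add: triv_triv_inv[OF E p])

lemma triv_fiber:
  assumes E: "E \<in> Gr" and G: "G \<in> nbhd E" shows "triv E ` ({G} \<times> fib E) = fib G"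
proof (intro equalityI subsetI)
  fix p assume "p \<in> triv E ` ({G} \<times> fib E)"
  then obtain q where q: "q \<in> fib E" "p = triv E (G, q)" by auto
  have "cpl G (mover E G ` snd q)" using mover_cpl_iff[OF E G, of "snd q"] q mem_fib[OF E, of q] by simp
  from cpl_sym[OF this] show "p \<in> fib G"
    using q mem_fib[OF nbhd_Gr[OF E G], of p] by (simp add: triv_def)
next
  fix p assume "p \<in> fib G"
  then have p: "fst p = G" "cpl G (snd p)" using mem_fib[OF nbhd_Gr[OF E G], of p] cpl_sym[of "snd p" G] by auto
  then have "p \<in> fiber PM fst (nbhd E)" using G by (cases p) (simp add: fiber_nbhd[OF E])
  from triv_triv_inv[OF E this] triv_inv_mem[OF E this]
  have tp: "triv E (triv_inv E p) = p" and "triv_inv E p \<in> nbhd E \<times> fib E" .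
  moreover have "fst (triv_inv E p) = G" using p by (cases p) (simp add: triv_inv_def)
  ultimately have "triv_inv E p \<in> {G} \<times> fib E" by (cases "triv_inv E p") auto
  then show "p \<in> triv E ` ({G} \<times> fib E)" using imageI[of "triv_inv E p" _ "triv E"] by (simp only: tp)
qed

lemma openin_nbhd: "E \<in> Gr \<Longrightarrow> openin (mantop GrM) (nbhd E)"
  using openin_complements[OF gpairD(2)[OF gpair_some_compl]] by (simp add: nbhd_def)

lemma analytic_mover:
  assumes E: "E \<in> Gr" and V: "normed_space_on V" and g: "nspace_analytic V BL U g"
    and u: "\<And>x. x \<in> U \<Longrightarrow> unit_pair (g x) (g' x)" and c1: "cpl E1 K1"
  shows "nspace_analytic V BL {v \<in> U. g v ` E1 \<in> nbhd E} (\<lambda>v. mover E (g v ` E1))"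
    and "nspace_analytic V BL {v \<in> U. g v ` E1 \<in> nbhd E} (\<lambda>v. mover_inv E (g v ` E1))"
proof -
  have *: "nspace_analytic V BL {v \<in> U. g v ` E1 \<in> nbhd E} (\<lambda>v. mover E (g v ` E1))"
    unfolding mover_def
    by (rule analytic_shear[OF V cpl_some_compl(1)[OF E]])
      (use analytic_slope_image[OF V g u c1 cpl_some_compl(1)[OF E]] in \<open>simp add: nbhd_def\<close>)
  then show "nspace_analytic V BL {v \<in> U. g v ` E1 \<in> nbhd E} (\<lambda>v. mover E (g v ` E1))" .
  show "nspace_analytic V BL {v \<in> U. g v ` E1 \<in> nbhd E} (\<lambda>v. mover_inv E (g v ` E1))"
    by (rule analytic_inverse[OF V *]) (simp add: mover(1)[OF E])
qed

text \<open>In coordinates the image is a pair of moving subspaces: the first is a sheared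
  \<open>E1\<close>, the second the complement \<open>?F0\<close> moved by a shear in the fiber
  followed by the mover. This is an instance of \<open>analytic_pair_coord\<close>.\<close>

theorem analytic_triv:
  assumes E: "E \<in> Gr"
  shows "manifold_analytic (prod_manifold GrM (fiberM E)) PM (nbhd E \<times> fib E) (triv E)"
proof (rule manifold_analyticI[OF atlas_ok_prod[OF atlas_ok_grassmann atlas_ok_fiberM[OF E]] atlas_ok_PM])
  let ?F0 = "some_compl E"
  note c0 = cpl_some_compl[OF E]
  show "openin (mantop (prod_manifold GrM (fiberM E))) (nbhd E \<times> fib E)"
    using openin_nbhd[OF E] openin_fib_self[of E]
    by (simp add: prod_manifold_def openin_prod_Times_iff affine_manifold_def)
  show "triv E ` (nbhd E \<times> fib E) \<subseteq> topspace (mantop PM)"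
    using triv_mem[OF E] by (auto simp: fiber_def)
  fix c d assume "c \<in> atlas (prod_manifold GrM (fiberM E))" "d \<in> atlas PM"
  then obtain E1 F1 a E' F' where p1: "gpair E1 F1" and a: "a \<in> points (OP ?F0 E)"
    and c: "c = \<lparr>chart_dom = chart_dom (grassmann_chart scale E1 F1) \<times> fib E,
        chart_map = map_prod (chart_map (grassmann_chart scale E1 F1)) (\<lambda>p. fiber_coord E p - a),
        chart_model = prod_nspace (OP E1 F1) (OP ?F0 E)\<rparr>"
    and p: "gpair E' F'" and d: "d = pair_chart E' F'"
    by (auto simp: prod_manifold_def atlas_grassmann atlas_fiberM[OF E] atlas_PM)
  note c1 = gpairD(1)[OF p1] and cp = gpairD(1)[OF p]
  note n1 = normed_op_cpl[OF c1] and n0 = normed_op_cpl[OF c0(2)]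
  let ?V = "prod_nspace (OP E1 F1) (OP ?F0 E)"
  let ?W = "points (OP E1 F1) \<times> points (OP ?F0 E)"
  have nV: "normed_space_on ?V" by (rule normed_prod_nspace[OF n1 n0])
  interpret V: normed_space_on ?V by (rule nV)
  interpret O0: normed_space_on "OP ?F0 E" by (rule n0)
  interpret B: normed_space_on BL by (rule normed_BL)
  interpret VB: two_spaces ?V BL by unfold_locales
  interpret VO: two_spaces ?V "OP ?F0 E" by unfold_locales
  \<comment> \<open>Charts of the fiber subtract the base point a, so their inverse adds it.\<close>
  let ?\<psi> = "map_prod (graph_map E1) (\<lambda>D. (E, graph_map ?F0 (D + a)))"
  have par: "chart_param c ?W ?\<psi>"
    using chart_param_prod[OF chart_param_grassmann[OF p1] chart_param_translate[OF n0 chart_param_fiber[OF E] a]]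
    by (simp add: c)
  have opW: "openin (ntop ?V) ?W" using openin_points[OF nV] by simp
  let ?g1 = "\<lambda>v. shear E1 F1 (fst v)"
  have g1: "nspace_analytic ?V BL ?W ?g1" by (rule analytic_shear[OF nV c1 analytic_fst[OF n1 n0 opW]])
  have u1: "unit_pair (?g1 v) (shear E1 F1 (- fst v))" if "v \<in> ?W" for v
    using unit_pair_shear[OF c1, of "fst v"] that by auto
  let ?s = "\<lambda>v. shear ?F0 E (snd v + a)"
  have sa: "snd v + a \<in> points (OP ?F0 E)" if "v \<in> ?W" for v
    using that a O0.add_mem by auto
  have "nspace_analytic ?V (OP ?F0 E) ?W (\<lambda>v. snd v + a)"
    by (rule VO.analytic_add[OF analytic_snd[OF n1 n0 opW] VO.analytic_const[OF opW a]])
  then have s: "nspace_analytic ?V BL ?W ?s" by (rule analytic_shear[OF nV c0(2)])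
  define U where "U = {v \<in> ?W. ?g1 v ` E1 \<in> nbhd E}"
  have m: "nspace_analytic ?V BL U (\<lambda>v. mover E (?g1 v ` E1))"
    unfolding U_def by (rule analytic_mover[OF E nV g1 u1 c1])
  note opU = analyticD(1)[OF m]
  have UW: "v \<in> U \<Longrightarrow> v \<in> ?W" "v \<in> U \<Longrightarrow> ?g1 v ` E1 \<in> nbhd E" for v by (simp_all add: U_def)
  have sub: "U \<subseteq> ?W" using UW by blast
  let ?g2 = "\<lambda>v. mover E (?g1 v ` E1) \<circ> ?s v"
  have g2: "nspace_analytic ?V BL U ?g2"
    by (rule analytic_comp[OF nV m VB.analytic_subset[OF s opU sub]])
  have u2: "unit_pair (?g2 v) (shear ?F0 E (- (snd v + a)) \<circ> mover_inv E (?g1 v ` E1))" if "v \<in> U" for v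
    using UW[OF that] by (intro unit_pair_comp mover(1)[OF E] unit_pair_shear[OF c0(2)] sa)
  have an: "nspace_analytic ?V (prod_nspace (OP E' F') (OP F' E'))
      {v \<in> U. cpl (?g1 v ` E1) F' \<and> cpl (?g1 v ` E1) (?g2 v ` ?F0)}
      (\<lambda>v. pair_coord E' F' (?g1 v ` E1, ?g2 v ` ?F0))"
    by (rule analytic_pair_coord[OF nV VB.analytic_subset[OF g1 opU sub] u1[OF UW(1)] c1 g2 u2 c0(2) cp])
  have tr: "triv E (?\<psi> v) = (?g1 v ` E1, ?g2 v ` ?F0)" for v
    unfolding image_comp[symmetric] shear_image[OF c1] shear_image[OF c0(2)]
    by (simp add: triv_def map_prod_def case_prod_unfold del: image_comp)
  have psi: "?\<psi> v \<in> nbhd E \<times> fib E \<longleftrightarrow> v \<in> U" if v: "v \<in> ?W" for v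
  proof -
    have "snd (?\<psi> v) \<in> fib E"
      using graph_cpl[OF c0(2) sa[OF v]] by (simp add: map_prod_def case_prod_unfold mem_fib[OF E])
    then show ?thesis
      using v by (auto simp: U_def map_prod_def case_prod_unfold shear_image[OF c1])
  qed
  have dom: "{v \<in> U. cpl (?g1 v ` E1) F' \<and> cpl (?g1 v ` E1) (?g2 v ` ?F0)} =
      {v \<in> ?W. ?\<psi> v \<in> nbhd E \<times> fib E \<and> triv E (?\<psi> v) \<in> chart_dom d}"
  proof (rule Collect_cong)
    fix v
    have td: "triv E (?\<psi> v) \<in> chart_dom d \<longleftrightarrow> cpl (?g1 v ` E1) F' \<and> cpl (?g1 v ` E1) (?g2 v ` ?F0)"
      unfolding tr d pair_chart_simps by simp
    show "v \<in> U \<and> cpl (?g1 v ` E1) F' \<and> cpl (?g1 v ` E1) (?g2 v ` ?F0) \<longleftrightarrow>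
        v \<in> ?W \<and> ?\<psi> v \<in> nbhd E \<times> fib E \<and> triv E (?\<psi> v) \<in> chart_dom d"
    proof (cases "v \<in> ?W")
      case True
      show ?thesis unfolding td psi[OF True] using True by argo
    next
      case False
      then have "v \<notin> U" using UW(1)[of v] by argo
      then show ?thesis using False by argo
    qed
  qed
  show "nspace_analytic (chart_model c) (chart_model d)
      (chart_map c ` {p \<in> chart_dom c. p \<in> nbhd E \<times> fib E \<and> triv E p \<in> chart_dom d}) (chart_map d \<circ> triv E \<circ> chart_inv c)"
  proof (rule param_analytic[OF par])
    show "normed_space_on (chart_model c)" using nV by (simp add: c)
    show "normed_space_on (chart_model d)" using normed_pair[OF cp] by (simp add: d pair_chart_simps)
    show "nspace_analytic (chart_model c) (chart_model d)
        {v \<in> ?W. ?\<psi> v \<in> nbhd E \<times> fib E \<and> triv E (?\<psi> v) \<in> chart_dom d} (\<lambda>v. pair_coord E' F' (?g1 v ` E1, ?g2 v ` ?F0))"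
      using an unfolding dom by (simp add: c d pair_chart_simps)
    show "pair_coord E' F' (?g1 v ` E1, ?g2 v ` ?F0) = chart_map d (triv E (?\<psi> v))" for v
      unfolding tr d pair_chart_simps ..
  qed
qed

text \<open>The fiber coordinate of the inverse is the second component of
  \<open>pair_coord E (some_compl E)\<close>, since both shear H back by the coordinate of G. Its
  analyticity is that of the pair chart.\<close>

theorem analytic_triv_inv:
  assumes E: "E \<in> Gr"
  shows "manifold_analytic PM (prod_manifold GrM (fiberM E)) (fiber PM fst (nbhd E))
    (the_inv_into (nbhd E \<times> fib E) (triv E))"
proof (rule manifold_analyticI[OF atlas_ok_PM atlas_ok_prod[OF atlas_ok_grassmann atlas_ok_fiberM[OF E]]])
  let ?F0 = "some_compl E"
  let ?i = "the_inv_into (nbhd E \<times> fib E) (triv E)"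
  note c0 = cpl_some_compl[OF E]
  \<comment> \<open>The trivialized part of the bundle is a single chart domain, which makes it
    open.\<close>
  have fd: "fiber PM fst (nbhd E) = chart_dom (pair_chart E ?F0)"
    unfolding fiber_nbhd[OF E] pair_chart_simps by (simp add: nbhd_def)
  have "pair_chart E ?F0 \<in> atlas PM" using gpair_some_compl[OF E] by (auto simp: atlas_PM)
  then have "chart_ok (mantop PM) (pair_chart E ?F0)" using atlas_ok_PM by (simp add: atlas_ok_def)
  then show "openin (mantop PM) (fiber PM fst (nbhd E))" unfolding fd by (rule chart_okD)
  have i: "?i p = triv_inv E p" if "p \<in> fiber PM fst (nbhd E)" for p by (rule the_inv_triv[OF E that])
  have top: "topspace (mantop (prod_manifold GrM (fiberM E))) = Gr \<times> fib E"
    using fib_subset[of E] by (simp add: prod_manifold_def affine_manifold_def topspace_grassmann inf.absorb2)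
  show "?i ` fiber PM fst (nbhd E) \<subseteq> topspace (mantop (prod_manifold GrM (fiberM E)))"
    unfolding top
  proof (rule image_subsetI)
    fix p assume p: "p \<in> fiber PM fst (nbhd E)"
    show "?i p \<in> Gr \<times> fib E"
      unfolding i[OF p] using triv_inv_mem[OF E p] nbhd_Gr[OF E, of "fst (triv_inv E p)"] by (simp add: mem_Times_iff)
  qed
  fix c d assume "c \<in> atlas PM" "d \<in> atlas (prod_manifold GrM (fiberM E))"
  then obtain E1 F1 a E2 F2 where p1: "gpair E1 F1" and c: "c = pair_chart E1 F1"
    and p2: "gpair E2 F2" and a: "a \<in> points (OP ?F0 E)"
    and d: "d = \<lparr>chart_dom = chart_dom (grassmann_chart scale E2 F2) \<times> fib E,
        chart_map = map_prod (chart_map (grassmann_chart scale E2 F2)) (\<lambda>p. fiber_coord E p - a),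
        chart_model = prod_nspace (OP E2 F2) (OP ?F0 E)\<rparr>"
    by (auto simp: prod_manifold_def atlas_grassmann atlas_fiberM[OF E] atlas_PM)
  note c1 = gpairD(1)[OF p1] and c2 = gpairD(1)[OF p2]
  note n0 = normed_op_cpl[OF c0(2)] and n2 = normed_op_cpl[OF c2]
  let ?V = "prod_nspace (OP E1 F1) (OP F1 E1)"
  let ?W = "points (OP E1 F1) \<times> points (OP F1 E1)"
  note nV = normed_pair[OF c1]
  interpret V: normed_space_on ?V by (rule nV)
  interpret O0: normed_space_on "OP ?F0 E" by (rule n0)
  interpret O2: normed_space_on "OP E2 F2" by (rule n2)
  interpret VO0: two_spaces ?V "OP ?F0 E" by unfold_locales
  interpret VO2: two_spaces ?V "OP E2 F2" by unfold_locales
  note par = chart_param_pair[OF c1]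
  let ?\<psi> = "pair_param E1 F1"
  let ?D = "{v \<in> ?W. ?\<psi> v \<in> fiber PM fst (nbhd E) \<and> ?i (?\<psi> v) \<in> chart_dom d}"
  define A where "A = {v \<in> ?W. ?\<psi> v \<in> chart_dom (pair_chart E ?F0)}"
  have "nspace_analytic ?V (prod_nspace (OP E ?F0) (OP ?F0 E)) A (\<lambda>v. pair_coord E ?F0 (?\<psi> v))"
    unfolding A_def by (rule analytic_pair_param_coord[OF c1 c0(1)])
  from analytic_diff_const[OF nV n0 analytic_snd_comp[OF nV normed_op_cpl[OF c0(1)] n0 this] a]
  have an1: "nspace_analytic ?V (OP ?F0 E) A (\<lambda>v. snd (pair_coord E ?F0 (?\<psi> v)) - a)" .
  define B where "B = {v \<in> ?W. cpl (shear E1 F1 (fst v) ` E1) F2}"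
  have an2: "nspace_analytic ?V (OP E2 F2) B (\<lambda>v. slope E2 F2 (shear E1 F1 (fst v) ` E1))"
    unfolding B_def by (rule analytic_slope_image[OF nV pair_param_shears(1)[OF c1] pair_param_shears(3)[OF c1] c1 c2])
  have dom: "?D = A \<inter> B"
  proof -
    have "?\<psi> v \<in> fiber PM fst (nbhd E) \<and> ?i (?\<psi> v) \<in> chart_dom d \<longleftrightarrow>
        ?\<psi> v \<in> chart_dom (pair_chart E ?F0) \<and> cpl (shear E1 F1 (fst v) ` E1) F2" for v
    proof (cases "?\<psi> v \<in> fiber PM fst (nbhd E)")
      case True
      then have "?i (?\<psi> v) = triv_inv E (?\<psi> v)" "triv_inv E (?\<psi> v) \<in> nbhd E \<times> fib E"
        using i triv_inv_mem[OF E] by simp_all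
      then have "?i (?\<psi> v) \<in> chart_dom d \<longleftrightarrow> cpl (shear E1 F1 (fst v) ` E1) F2"
        by (auto simp: d dom_grassmann[OF p2] triv_inv_def pair_param_shears(5)[OF c1])
      then show ?thesis using True fd by simp
    qed (simp add: fd)
    then show ?thesis by (auto simp: A_def B_def)
  qed
  have opAB: "openin (ntop ?V) (A \<inter> B)" by (intro openin_Int analyticD(1)[OF an1] analyticD(1)[OF an2])
  have an: "nspace_analytic ?V (prod_nspace (OP E2 F2) (OP ?F0 E)) (A \<inter> B)
      (\<lambda>v. (slope E2 F2 (shear E1 F1 (fst v) ` E1), snd (pair_coord E ?F0 (?\<psi> v)) - a))"
    by (rule analytic_Pair[OF nV n2 n0 VO2.analytic_subset[OF an2 opAB] VO0.analytic_subset[OF an1 opAB]]) auto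
  show "nspace_analytic (chart_model c) (chart_model d)
      (chart_map c ` {p \<in> chart_dom c. p \<in> fiber PM fst (nbhd E) \<and> ?i p \<in> chart_dom d}) (chart_map d \<circ> ?i \<circ> chart_inv c)"
    unfolding c
  proof (rule param_analytic[OF par])
    show "normed_space_on (chart_model (pair_chart E1 F1))" using nV by (simp add: pair_chart_simps)
    show "normed_space_on (chart_model d)" using normed_prod_nspace[OF n2 n0] by (simp add: d)
    show "nspace_analytic (chart_model (pair_chart E1 F1)) (chart_model d) ?D
      (\<lambda>v. (slope E2 F2 (shear E1 F1 (fst v) ` E1), snd (pair_coord E ?F0 (?\<psi> v)) - a))"
      using an unfolding dom by (simp add: d pair_chart_simps)
    fix v assume v: "?\<psi> v \<in> fiber PM fst (nbhd E) \<and> ?i (?\<psi> v) \<in> chart_dom d"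
    obtain G H where GH: "?\<psi> v = (G, H)" by (cases "?\<psi> v")
    then have G: "G = shear E1 F1 (fst v) ` E1" by (simp add: pair_param_shears(5)[OF c1])
    have iv: "?i (?\<psi> v) = (G, (E, mover_inv E G ` H))" using i v GH by (simp add: triv_inv_def)
    then have "cpl G F2" using v by (auto simp: d dom_grassmann[OF p2])
    then show "(slope E2 F2 (shear E1 F1 (fst v) ` E1), snd (pair_coord E ?F0 (?\<psi> v)) - a) = chart_map d (?i (?\<psi> v))"
      unfolding iv by (simp add: d map_grassmann[OF p2] G[symmetric] GH pair_coord_def fiber_coord_def mover_inv_def)
  qed
qed

section \<open>Affine maps between the fibers\<close>

text \<open>\<open>conj_op\<close> is the coordinate expression of \<open>H \<mapsto> g ` H\<close>, where \<open>g ` E1 = E2\<close>, \<open>M = g\<close> and \<open>N = g\<^sup>-\<^sup>1\<close>. As a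
  function of \<open>M\<close> and \<open>N\<close> it is bilinear; the outer projection, which does nothing for \<open>M = g\<close>, makes
  it well defined for all \<open>M\<close> and \<open>N\<close>.\<close>

definition conj_op :: "'a set \<Rightarrow> 'a set \<Rightarrow> 'a set \<Rightarrow> 'a set \<Rightarrow> ('a \<Rightarrow> 'a) \<Rightarrow> ('a \<Rightarrow> 'a) \<Rightarrow> ('a \<Rightarrow> 'a) \<Rightarrow> 'a \<Rightarrow> 'a" where
  "conj_op E1 F1 E2 F2 M N x = (if x \<in> points (OP F1 E1)
     then (\<lambda>y. if y \<in> F2 then - proj E2 F2 (M (proj E1 F1 (N y) - x (proj F1 E1 (N y)))) else 0) else 0)"

text \<open>For w = g' y the splitting w = k + e with k in the graph of x and e in \<open>E1\<close>
  has e = proj E1 F1 w - x (proj F1 E1 w). Applying g splits y along the image graph and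
  \<open>E2\<close>, so the slope at y is - g e.\<close>

lemma slope_image_graph:
  assumes c1: "cpl E1 F1" and c2: "cpl E2 F2" and u: "unit_pair g g'" and gE: "g ` E1 = E2"
    and x: "x \<in> points (OP F1 E1)"
  shows "slope F2 E2 (g ` graph_map F1 x) = conj_op E1 F1 E2 F2 g g' x"
proof
  note c1' = cpl_sym[OF c1] and c2' = cpl_sym[OF c2]
  have g: "g \<in> points BL" "\<And>y. g (g' y) = y" using u by (auto simp: unit_pair_def)
  let ?K = "g ` graph_map F1 x"
  have K: "cpl ?K E2" using unit_pair_cpl[OF u graph_cpl[OF c1' x]] gE by simp
  fix y
  show "slope F2 E2 ?K y = conj_op E1 F1 E2 F2 g g' x y"
  proof (cases "y \<in> F2")
    case True
    define w where "w = g' y"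
    define e where "e = proj E1 F1 w - x (proj F1 E1 w)"
    define k where "k = proj F1 E1 w + x (proj F1 E1 w)"
    have xE: "x (proj F1 E1 w) \<in> E1" by (rule opD(6)[OF cplD(1,2)[OF c1'] x])
    have e: "e \<in> E1" unfolding e_def by (intro subspace_diff cplD[OF c1] proj_mem(1)[OF c1] xE)
    have k: "k \<in> graph_map F1 x" unfolding k_def graph_map_def using proj_mem(1)[OF c1'] by blast
    have "w = k + e" by (simp add: k_def e_def proj_swap[OF c1])
    then have "y = g k + g e" using g by (metis BLD(1) w_def)
    moreover have "g e \<in> E2" using e gE by blast
    ultimately have "proj ?K E2 y = g k" "y = g k + g e" using k by (auto intro!: proj_eq[OF K])
    then have "slope F2 E2 ?K y = - g e" using True by (simp add: slope_def)
    also have "g e = proj E2 F2 (g e)" using proj_ident[OF c2] \<open>g e \<in> E2\<close> by simp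
    finally show ?thesis using True x by (simp add: conj_op_def e_def w_def)
  qed (simp add: slope_def conj_op_def x)
qed

text \<open>The expression is affine in x for fixed M and N: with p the projections onto
  \<open>E1\<close> and \<open>E2\<close> and q the one onto \<open>F1\<close>, its constant part is
  - p2 M p1 N and its linear part p2 M x q N. Both are bilinear and bounded in M and N, which makes
  the affine-map norm bounded as well.\<close>

lemma conj_op_bilinear:
  assumes c1: "cpl E1 F1" and c2: "cpl E2 F2" and a: "a \<in> points (OP F1 E1)"
  shows "\<exists>K. bilinear_on BL BL (affine_maps (OP F1 E1) (points (OP F1 E1)) (OP F2 E2) a) (conj_op E1 F1 E2 F2) K"
proof -
  note c1' = cpl_sym[OF c1] and c2' = cpl_sym[OF c2]
  let ?V = "OP F1 E1" and ?W = "OP F2 E2"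
  let ?Z = "affine_maps ?V (points ?V) ?W a"
  note sV = cplD(1,2)[OF c1'] and sW = cplD(1,2)[OF c2']
  interpret V: normed_space_on ?V by (rule normed_op_cpl[OF c1'])
  interpret W: normed_space_on ?W by (rule normed_op_cpl[OF c2'])
  interpret T: two_spaces ?V ?W by unfold_locales
  interpret Z: normed_space_on ?Z by (rule T.normed_affine_maps[OF a])
  interpret B: normed_space_on BL by (rule normed_BL)
  have pB: "proj E1 F1 \<in> points BL" "proj F1 E1 \<in> points BL" "proj E2 F2 \<in> points BL"
    by (rule proj_BL, rule c1 c1' c2)+
  define P1 where "P1 = nrm BL (proj E1 F1)"
  define Q1 where "Q1 = nrm BL (proj F1 E1)"
  define P2 where "P2 = nrm BL (proj E2 F2)"
  have nn: "P1 \<ge> 0" "Q1 \<ge> 0" "P2 \<ge> 0" unfolding P1_def Q1_def P2_def by (intro BL_nonneg pB)+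
  let ?\<beta> = "conj_op E1 F1 E2 F2"
  have PM: "norm (proj E2 F2 (M z)) \<le> P2 * nrm BL M * norm z" if M: "M \<in> points BL" for M z
  proof -
    have "norm (proj E2 F2 (M z)) \<le> P2 * norm (M z)" unfolding P2_def by (rule BLD[OF pB(3)])
    also have "\<dots> \<le> P2 * (nrm BL M * norm z)" by (intro mult_left_mono BLD[OF M] nn)
    finally show ?thesis by (simp add: mult.assoc)
  qed
  have xN: "norm (x (proj F1 E1 (N y))) \<le> nrm ?V x * Q1 * nrm BL N * norm y"
    if x: "x \<in> points ?V" and N: "N \<in> points BL" for x N y
  proof -
    have "norm (x (proj F1 E1 (N y))) \<le> nrm ?V x * norm (proj F1 E1 (N y))"
      by (rule opD(5)[OF sV x proj_mem(1)[OF c1']])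
    also have "\<dots> \<le> nrm ?V x * (Q1 * norm (N y))"
      unfolding Q1_def by (intro mult_left_mono BLD[OF pB(2)] V.nrm_nonneg x)
    also have "\<dots> \<le> nrm ?V x * (Q1 * (nrm BL N * norm y))"
      by (intro mult_left_mono BLD[OF N] V.nrm_nonneg x nn)
    finally show ?thesis by (simp add: mult.assoc)
  qed
  have PN: "norm (proj E1 F1 (N y)) \<le> P1 * nrm BL N * norm y" if N: "N \<in> points BL" for N y
  proof -
    have "norm (proj E1 F1 (N y)) \<le> P1 * norm (N y)" unfolding P1_def by (rule BLD[OF pB(1)])
    also have "\<dots> \<le> P1 * (nrm BL N * norm y)" by (intro mult_left_mono BLD[OF N] nn)
    finally show ?thesis by (simp add: mult.assoc)
  qed
  have bnd: "norm (?\<beta> M N x y) \<le> P2 * nrm BL M * ((P1 + nrm ?V x * Q1) * nrm BL N) * norm y"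
    if M: "M \<in> points BL" and N: "N \<in> points BL" and x: "x \<in> points ?V" and y: "y \<in> F2" for M N x y
  proof -
    have "norm (?\<beta> M N x y) \<le> P2 * nrm BL M * norm (proj E1 F1 (N y) - x (proj F1 E1 (N y)))"
      using PM[OF M] x y by (simp add: conj_op_def)
    also have "\<dots> \<le> P2 * nrm BL M * (P1 * nrm BL N * norm y + nrm ?V x * Q1 * nrm BL N * norm y)"
      by (intro mult_left_mono order_trans[OF norm_triangle_ineq4] add_mono PN[OF N] xN[OF x N] mult_nonneg_nonneg nn BL_nonneg M)
    finally show ?thesis by (simp add: algebra_simps)
  qed
  have op: "?\<beta> M N x \<in> points ?W" if M: "M \<in> points BL" and N: "N \<in> points BL" and x: "x \<in> points ?V" for M N x
  proof (rule opI[OF sW _ _ _ _ bnd[OF M N x]])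
    show "?\<beta> M N x y = 0" if "y \<notin> F2" for y using that x by (simp add: conj_op_def)
    show "?\<beta> M N x y \<in> E2" if "y \<in> F2" for y
      using that x subspace_neg[OF sW(2) proj_mem(1)[OF c2]] by (simp add: conj_op_def)
    show "?\<beta> M N x (y + z) = ?\<beta> M N x y + ?\<beta> M N x z" if "y \<in> F2" "z \<in> F2" for y z
      using that x subspace_add[OF sW(1) that]
      by (simp add: conj_op_def BLD[OF N] BLD[OF pB(1)] BLD[OF pB(2)] BLD[OF M] BLD[OF pB(3)]
          opD(3)[OF sV x proj_mem(1)[OF c1'] proj_mem(1)[OF c1']])
    show "?\<beta> M N x (scale k y) = scale k (?\<beta> M N x y)" if "y \<in> F2" for k y
      using that x subspace_scale[OF sW(1) that, of k]
      by (simp add: conj_op_def BLD[OF N] BLD[OF pB(1)] BLD(2)[OF pB(2)] opD(4)[OF sV x proj_mem(1)[OF c1']]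
          scale_right_diff_distrib[symmetric] BLD(2)[OF M] BLD(2)[OF pB(3)])
  qed
  \<comment> \<open>The part with \<open>proj E1 F1 (N y)\<close> cancels against the value at x =
    0, and the two minus signs combine.\<close>
  have lin: "T.linear_part (?\<beta> M N) x y = (if y \<in> F2 then proj E2 F2 (M (x (proj F1 E1 (N y)))) else 0)"
    if M: "M \<in> points BL" and N: "N \<in> points BL" and x: "x \<in> points ?V" for M N x y
    using x V.zero_mem by (simp add: T.linear_part_def conj_op_def BLD[OF M] BLD[OF pB(3)])
  have lbnd: "nrm ?W (T.linear_part (?\<beta> M N) x) \<le> (P2 * nrm BL M * (Q1 * nrm BL N)) * nrm ?V x"
    if M: "M \<in> points BL" and N: "N \<in> points BL" and x: "x \<in> points ?V" for M N x
  proof (rule nrm_op_least[OF sW])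
    show "0 \<le> P2 * nrm BL M * (Q1 * nrm BL N) * nrm ?V x"
      by (intro mult_nonneg_nonneg nn BL_nonneg M N V.nrm_nonneg x)
    fix y assume y: "y \<in> F2"
    have "norm (T.linear_part (?\<beta> M N) x y) \<le> P2 * nrm BL M * norm (x (proj F1 E1 (N y)))"
      using PM[OF M] y by (simp add: lin[OF M N x])
    also have "\<dots> \<le> P2 * nrm BL M * (nrm ?V x * Q1 * nrm BL N * norm y)"
      by (intro mult_left_mono xN[OF x N] mult_nonneg_nonneg nn BL_nonneg M)
    finally show "norm (T.linear_part (?\<beta> M N) x y) \<le> P2 * nrm BL M * (Q1 * nrm BL N) * nrm ?V x * norm y"
      by (simp add: mult_ac)
  qed
  have linm: "T.linear_part (?\<beta> M N) \<in> points (bounded_ops ?V ?W)"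
    if M: "M \<in> points BL" and N: "N \<in> points BL" for M N
  proof (rule T.bounded_opsI[OF _ _ _ _ lbnd[OF M N]])
    show "T.linear_part (?\<beta> M N) x = 0" if "x \<notin> points ?V" for x using that by (simp add: T.linear_part_def)
    show "T.linear_part (?\<beta> M N) x \<in> points ?W" if "x \<in> points ?V" for x
      using that W.diff_mem[OF op[OF M N that] op[OF M N V.zero_mem]] by (simp add: T.linear_part_def)
    show "T.linear_part (?\<beta> M N) (x + y) = T.linear_part (?\<beta> M N) x + T.linear_part (?\<beta> M N) y"
      if x: "x \<in> points ?V" and y: "y \<in> points ?V" for x y
      by (auto simp: fun_eq_iff lin[OF M N] V.add_mem x y BLD[OF M] BLD[OF pB(3)])
    show "T.linear_part (?\<beta> M N) (nscale ?V k x) = nscale ?W k (T.linear_part (?\<beta> M N) x)"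
      if x: "x \<in> points ?V" for k x
      using V.smult_mem[OF x, of k] by (auto simp: fun_eq_iff lin[OF M N] x BLD(2)[OF M] BLD(2)[OF pB(3)])
  qed
  have mZ: "?\<beta> M N \<in> points ?Z" if M: "M \<in> points BL" and N: "N \<in> points BL" for M N
    unfolding T.points_affine_maps[OF a] using linm[OF M N] op[OF M N V.zero_mem] by (simp add: conj_op_def)
  \<comment> \<open>One summand for each part of the norm: the linear part, and the value at the
    base point a.\<close>
  define K where "K = P2 * Q1 + P2 * (P1 + nrm ?V a * Q1)"
  have nZ: "nscale ?Z c S = (\<lambda>x y. scale c (S x y))" for c S
    by (simp add: affine_maps_def)
  have "bilinear_on BL BL ?Z ?\<beta> K"
  proof
    show "0 \<le> K" unfolding K_def using nn V.nrm_nonneg[OF a] by simp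
    fix M N assume M: "M \<in> points BL" and N: "N \<in> points BL"
    show "?\<beta> M N \<in> points ?Z" by (rule mZ[OF M N])
    have "nrm ?Z (?\<beta> M N) = nrm (bounded_ops ?V ?W) (T.linear_part (?\<beta> M N)) + nrm ?W (?\<beta> M N a)"
      by (rule T.nrm_affine_maps[OF a mZ[OF M N]])
    also have "\<dots> \<le> P2 * nrm BL M * (Q1 * nrm BL N) + P2 * nrm BL M * ((P1 + nrm ?V a * Q1) * nrm BL N)"
    proof (rule add_mono)
      show "nrm (bounded_ops ?V ?W) (T.linear_part (?\<beta> M N)) \<le> P2 * nrm BL M * (Q1 * nrm BL N)"
        by (rule T.nrm_bounded_ops_least[OF _ lbnd[OF M N]]) (intro mult_nonneg_nonneg nn BL_nonneg M N)
      show "nrm ?W (?\<beta> M N a) \<le> P2 * nrm BL M * ((P1 + nrm ?V a * Q1) * nrm BL N)"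
        by (rule nrm_op_least[OF sW _ bnd[OF M N a]])
          (intro mult_nonneg_nonneg add_nonneg_nonneg nn BL_nonneg M N V.nrm_nonneg a)
    qed
    also have "\<dots> = K * nrm BL M * nrm BL N" by (simp add: K_def algebra_simps)
    finally show "nrm ?Z (?\<beta> M N) \<le> K * nrm BL M * nrm BL N" .
    show "?\<beta> (nscale BL c M) N = nscale ?Z c (?\<beta> M N)" for c
      unfolding nZ by (auto simp: fun_eq_iff conj_op_def BLD(2)[OF pB(3)])
    show "?\<beta> M (nscale BL c N) = nscale ?Z c (?\<beta> M N)" for c
    proof (intro ext)
      fix x y
      have "proj E1 F1 (scale c (N y)) - x (proj F1 E1 (scale c (N y))) =
          scale c (proj E1 F1 (N y) - x (proj F1 E1 (N y)))" if "x \<in> points ?V"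
        by (simp add: BLD(2)[OF pB(1)] BLD(2)[OF pB(2)] opD(4)[OF sV that] proj_mem(1)[OF c1'] scale_right_diff_distrib)
      then show "?\<beta> M (nscale BL c N) x y = nscale ?Z c (?\<beta> M N) x y"
        unfolding nZ by (simp add: conj_op_def BLD(2)[OF M] BLD(2)[OF pB(3)])
    qed
    fix M' assume M': "M' \<in> points BL"
    show "?\<beta> (M + M') N = ?\<beta> M N + ?\<beta> M' N"
      by (auto simp: fun_eq_iff conj_op_def BLD(1)[OF pB(3)])
  next
    fix M N N' assume M: "M \<in> points BL" and N: "N \<in> points BL" "N' \<in> points BL"
    show "?\<beta> M (N + N') = ?\<beta> M N + ?\<beta> M N'"
    proof (intro ext)
      fix x y
      have "proj E1 F1 (N y + N' y) - x (proj F1 E1 (N y + N' y)) =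
          (proj E1 F1 (N y) - x (proj F1 E1 (N y))) + (proj E1 F1 (N' y) - x (proj F1 E1 (N' y)))" if "x \<in> points ?V"
        by (simp add: BLD(1)[OF pB(1)] BLD(1)[OF pB(2)] opD(3)[OF sV that] proj_mem(1)[OF c1'])
      then show "?\<beta> M (N + N') x y = (?\<beta> M N + ?\<beta> M N') x y"
        by (simp add: conj_op_def BLD(1)[OF M] BLD(1)[OF pB(3)])
    qed
  qed
  then show ?thesis by blast
qed

text \<open>In fiber coordinates the trivialization is \<open>conj_op\<close> of the mover and its
  inverse, which is a continuous affine map because \<open>conj_op\<close> takes values in
  \<open>affine_maps\<close>.\<close>

lemma affine_triv:
  assumes E: "E \<in> Gr" and G: "G \<in> nbhd E"
  shows "affine_map_on (OP (some_compl E) E) (points (OP (some_compl E) E)) (OP (some_compl G) G)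
    (\<lambda>x. fiber_coord G (triv E (G, the_inv_into (fib E) (fiber_coord E) x)))"
proof -
  note G' = nbhd_Gr[OF E G]
  let ?V = "OP (some_compl E) E" and ?W = "OP (some_compl G) G"
  have n: "normed_space_on ?V" by (rule normed_op_cpl[OF cpl_some_compl(2)[OF E]])
  have z: "0 \<in> points ?V" by (rule zero_op[OF cpl_some_compl(2)[OF E]])
  let ?S = "conj_op E (some_compl E) G (some_compl G) (mover E G) (mover_inv E G)"
  obtain K where "bilinear_on BL BL (affine_maps ?V (points ?V) ?W 0) (conj_op E (some_compl E) G (some_compl G)) K"
    using conj_op_bilinear[OF cpl_some_compl(1)[OF E] cpl_some_compl(1)[OF G'] z] by blast
  then have "?S \<in> points (affine_maps ?V (points ?V) ?W 0)"
    by (rule bilinear_on.mem) (use mover(1)[OF E G] in \<open>simp_all add: unit_pair_def\<close>)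
  then have "affine_map_on ?V (points ?V) ?W ?S" by (simp add: affine_maps_def)
  then show ?thesis
  proof (rule affine_map_on_cong[OF n])
    fix x assume x: "x \<in> points ?V"
    show "?S x = fiber_coord G (triv E (G, the_inv_into (fib E) (fiber_coord E) x))"
      using slope_image_graph[OF cpl_some_compl(1)[OF E] cpl_some_compl(1)[OF G'] mover(1,2)[OF E G] x]
      by (simp add: fiber_coord_inverse[OF E x] triv_def fiber_coord_def)
  qed
qed

text \<open>The transition at G is conjugation by the automorphism that goes from \<open>E1\<close>
  to G and back to \<open>E2\<close>. It and its inverse are analytic in G, and
  \<open>conj_op\<close> is bilinear in the two.\<close>

theorem analytic_transition:
  assumes E1: "E1 \<in> Gr" and E2: "E2 \<in> Gr" and a: "a \<in> points (OP (some_compl E1) E1)"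
  defines "Y1 \<equiv> OP (some_compl E1) E1" and "Y2 \<equiv> OP (some_compl E2) E2"
  defines "Z \<equiv> affine_maps Y1 (points Y1) Y2 a"
  shows "manifold_analytic GrM (affine_manifold (subtopology (ntop Z) (points Z)) id Z (points Z)) (nbhd E1 \<inter> nbhd E2)
    (\<lambda>G x. if x \<in> points Y1 then fiber_coord E2 (snd (the_inv_into (nbhd E2 \<times> fib E2) (triv E2)
        (triv E1 (G, the_inv_into (fib E1) (fiber_coord E1) x)))) else 0)" (is "manifold_analytic _ ?N _ ?\<phi>")
proof -
  let ?F1 = "some_compl E1" and ?F2 = "some_compl E2"
  note c1 = cpl_some_compl[OF E1] and c2 = cpl_some_compl[OF E2]
  have a': "a \<in> points Y1" using a by (simp add: Y1_def)
  interpret Y1: normed_space_on Y1 unfolding Y1_def by (rule normed_op_cpl[OF c1(2)])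
  interpret Y2: normed_space_on Y2 unfolding Y2_def by (rule normed_op_cpl[OF c2(2)])
  interpret Y: two_spaces Y1 Y2 by unfold_locales
  have nZ: "normed_space_on Z" unfolding Z_def by (rule Y.normed_affine_maps[OF a'])
  interpret Z: normed_space_on Z by (rule nZ)
  have top: "subtopology (ntop Z) (points Z) = ntop Z" using subtopology_topspace[of "ntop Z"] by simp
  \<comment> \<open>The second argument is the inverse of the first, as
    \<open>slope_image_graph\<close> requires.\<close>
  let ?c = "\<lambda>G. conj_op E1 ?F1 E2 ?F2 (mover_inv E2 G \<circ> mover E1 G) (mover_inv E1 G \<circ> mover E2 G)"
  have \<phi>: "?\<phi> G = ?c G" if G: "G \<in> nbhd E1 \<inter> nbhd E2" for G
  proof
    fix x
    have G1: "G \<in> nbhd E1" and G2: "G \<in> nbhd E2" using G by auto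
    show "?\<phi> G x = ?c G x"
    proof (cases "x \<in> points Y1")
      case True
      then have x: "x \<in> points (OP ?F1 E1)" by (simp add: Y1_def)
      have u: "unit_pair (mover_inv E2 G \<circ> mover E1 G) (mover_inv E1 G \<circ> mover E2 G)"
        by (rule unit_pair_comp[OF unit_pair_sym[OF mover(1)[OF E2 G2]] mover(1)[OF E1 G1]])
      have im: "(mover_inv E2 G \<circ> mover E1 G) ` E1 = E2"
        unfolding image_comp[symmetric] mover(2)[OF E1 G1] by (rule mover(3)[OF E2 G2])
      have "cpl G (mover E1 G ` graph_map ?F1 x)"
        using mover_cpl_iff[OF E1 G1] graph_cpl[OF c1(2) x] by simp
      then have "triv E1 (G, (E1, graph_map ?F1 x)) \<in> fiber PM fst (nbhd E2)"
        using G2 by (simp add: fiber_nbhd[OF E2] triv_def)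
      from the_inv_triv[OF E2 this]
      have "the_inv_into (nbhd E2 \<times> fib E2) (triv E2) (triv E1 (G, (E1, graph_map ?F1 x))) =
          triv_inv E2 (triv E1 (G, (E1, graph_map ?F1 x)))" .
      also have "\<dots> = (G, (E2, mover_inv E2 G ` mover E1 G ` graph_map ?F1 x))"
        by (simp add: triv_inv_def triv_def)
      finally have "the_inv_into (nbhd E2 \<times> fib E2) (triv E2) (triv E1 (G, (E1, graph_map ?F1 x))) =
          (G, (E2, mover_inv E2 G ` mover E1 G ` graph_map ?F1 x))" .
      then have "?\<phi> G x = slope ?F2 E2 ((mover_inv E2 G \<circ> mover E1 G) ` graph_map ?F1 x)"
        using True by (simp add: fiber_coord_inverse[OF E1 x] fiber_coord_def image_comp)
      then show ?thesis using slope_image_graph[OF c1(1) c2(1) u im x] by simp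
    qed (simp add: conj_op_def Y1_def)
  qed
  obtain K where bil: "bilinear_on BL BL Z (conj_op E1 ?F1 E2 ?F2) K"
    using conj_op_bilinear[OF c1(1) c2(1) a] unfolding Z_def Y1_def Y2_def by blast
  have mv: "mover E G \<in> points BL" "mover_inv E G \<in> points BL" if "E \<in> Gr" "G \<in> nbhd E" for E G
    using mover(1)[OF that] by (simp_all add: unit_pair_def)
  have cZ: "?c G \<in> points Z" if "G \<in> nbhd E1 \<inter> nbhd E2" for G
    using that by (intro bilinear_on.mem[OF bil] BL_comp mv E1 E2) auto
  have okN: "atlas_ok ?N"
    unfolding top
  proof (rule atlas_ok_affine[OF nZ])
    have "chart_param \<lparr>chart_dom = points Z, chart_map = id, chart_model = Z\<rparr> (points Z) id"
      by (simp add: chart_param_def)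
    then show "chart_ok (ntop Z) \<lparr>chart_dom = topspace (ntop Z), chart_map = id, chart_model = Z\<rparr>"
      by (intro chart_ok_paramI[where \<psi> = id])
        (auto simp: nZ openin_points inf.absorb2 Collect_conj_eq intro!: arg_cong[where f = "openin (ntop Z)"])
  qed simp
  show ?thesis
  proof (rule manifold_analyticI[OF atlas_ok_grassmann okN])
    show "openin (mantop GrM) (nbhd E1 \<inter> nbhd E2)" by (intro openin_Int openin_nbhd E1 E2)
    have mtN: "mantop ?N = ntop Z" by (simp add: affine_manifold_def top)
    show "?\<phi> ` (nbhd E1 \<inter> nbhd E2) \<subseteq> topspace (mantop ?N)"
      unfolding mtN using \<phi> cZ by auto
    fix c d assume "c \<in> atlas GrM" "d \<in> atlas ?N"
    then obtain E3 F3 S0 where p: "gpair E3 F3" and c: "c = grassmann_chart scale E3 F3" and S0: "S0 \<in> points Z"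
      and d: "d = \<lparr>chart_dom = points Z, chart_map = (\<lambda>p. p - S0), chart_model = Z\<rparr>"
      unfolding top atlas_affine_manifold[OF nZ] by (auto simp: atlas_grassmann)
    note c3 = gpairD(1)[OF p]
    note n3 = normed_op_cpl[OF c3]
    let ?O = "OP E3 F3"
    interpret O3: normed_space_on ?O by (rule n3)
    interpret B: normed_space_on BL by (rule normed_BL)
    interpret OB: two_spaces ?O BL by unfold_locales
    let ?G = "\<lambda>T. shear E3 F3 T ` E3"
    note m1 = analytic_mover[OF E1 n3 analytic_shear_chart[OF c3] unit_pair_shear[OF c3] c3]
    note m2 = analytic_mover[OF E2 n3 analytic_shear_chart[OF c3] unit_pair_shear[OF c3] c3]
    let ?D = "{T \<in> points ?O. graph_map E3 T \<in> nbhd E1 \<inter> nbhd E2 \<and> ?\<phi> (graph_map E3 T) \<in> chart_dom d}"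
    \<comment> \<open>The charts of the target are global, so the domain is cut out by the two
      neighbourhoods, each open as the domain of an analytic mover.\<close>
    have D: "?D = {T \<in> points ?O. ?G T \<in> nbhd E1} \<inter> {T \<in> points ?O. ?G T \<in> nbhd E2}"
    proof -
      have "?\<phi> H \<in> chart_dom d" if "H \<in> nbhd E1 \<inter> nbhd E2" for H
        using \<phi>[OF that] cZ[OF that] by (simp add: d)
      then show ?thesis by (auto simp: shear_image[OF c3])
    qed
    have opD: "openin (ntop ?O) ?D"
      unfolding D by (intro openin_Int analyticD(1)[OF m1(1)] analyticD(1)[OF m2(1)])
    have sub: "?D \<subseteq> {T \<in> points ?O. ?G T \<in> nbhd E1}" "?D \<subseteq> {T \<in> points ?O. ?G T \<in> nbhd E2}"
      unfolding D by auto
    have g: "nspace_analytic ?O BL ?D (\<lambda>T. mover_inv E2 (?G T) \<circ> mover E1 (?G T))"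
      by (rule analytic_comp[OF n3 OB.analytic_subset[OF m2(2) opD sub(2)] OB.analytic_subset[OF m1(1) opD sub(1)]])
    have g': "nspace_analytic ?O BL ?D (\<lambda>T. mover_inv E1 (?G T) \<circ> mover E2 (?G T))"
      by (rule analytic_comp[OF n3 OB.analytic_subset[OF m1(2) opD sub(1)] OB.analytic_subset[OF m2(1) opD sub(2)]])
    have an: "nspace_analytic ?O Z ?D (\<lambda>T. ?c (?G T) - S0)"
      by (rule analytic_diff_const[OF n3 nZ bilinear_on.analytic_bilinear[OF bil n3 g g'] S0])
    show "nspace_analytic (chart_model c) (chart_model d)
        (chart_map c ` {p \<in> chart_dom c. p \<in> nbhd E1 \<inter> nbhd E2 \<and> ?\<phi> p \<in> chart_dom d}) (chart_map d \<circ> ?\<phi> \<circ> chart_inv c)"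
      unfolding c
    proof (rule param_analytic[OF chart_param_grassmann[OF p]])
      show "normed_space_on (chart_model (grassmann_chart scale E3 F3))" using n3 by simp
      show "normed_space_on (chart_model d)" using nZ by (simp add: d)
      show "nspace_analytic (chart_model (grassmann_chart scale E3 F3)) (chart_model d) ?D (\<lambda>T. ?c (?G T) - S0)"
        using an by (simp add: d)
      fix T assume "graph_map E3 T \<in> nbhd E1 \<inter> nbhd E2 \<and> ?\<phi> (graph_map E3 T) \<in> chart_dom d"
      then have "?\<phi> (graph_map E3 T) = ?c (?G T)" using \<phi> by (simp add: shear_image[OF c3])
      then show "?c (?G T) - S0 = chart_map d (?\<phi> (graph_map E3 T))" by (simp only: d chart.simps)
    qed
  qed
qed

end

theorem corollary3p6:
  fixes smul :: "'k::real_normed_field \<Rightarrow> 'a::banach \<Rightarrow> 'a"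
  assumes "banach_scaling smul"
    and dim_gt_1: "\<exists>b. \<not> module.dependent smul b \<and> module.span smul b = UNIV \<and> (infinite b \<or> card b > 1)"
  shows "\<exists>(\<A> :: ('k, 'a set \<times> 'a set, ('a \<Rightarrow> 'a) \<times> ('a \<Rightarrow> 'a)) chart set)
            (Y :: 'a set \<Rightarrow> ('k, 'a \<Rightarrow> 'a) nspace) A h.
           affine_banach_bundle
             \<lparr>mantop = subtopology (prod_topology (grassmann_topology smul) (grassmann_topology smul))
                         (complementary_pairs smul),
              atlas = \<A>\<rparr>
             (grassmann_manifold smul) fst Y A h"
proof -
  interpret banach_scaling smul by fact
  let ?Y = "\<lambda>E. OP (some_compl E) E"
  let ?A = "\<lambda>E. points (OP (some_compl E) E)"
  \<comment> \<open>Each fiber is identified with the whole space L(F,E), so maps between fibers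
    form the whole space of continuous affine maps.\<close>
  have B: "{S \<in> points (affine_maps (?Y E1) (?A E1) (?Y E2) a). S ` ?A E1 \<subseteq> ?A E2} =
      points (affine_maps (?Y E1) (?A E1) (?Y E2) a)" for E1 E2 a
    by (auto simp: affine_maps_def affine_map_on_def)
  have "affine_banach_bundle PM GrM fst ?Y ?A fiber_coord"
    unfolding affine_banach_bundle_def Let_def fib_def[symmetric] B
  proof (intro conjI ballI exI[of _ nbhd] exI[of _ triv] impI)
    show "banach_manifold PM" by (rule banach_manifold_PM)
    show "banach_manifold GrM" by (rule banach_manifold_grassmann)
    show "manifold_analytic PM GrM (topspace (mantop PM)) fst" by (rule analytic_fst_PM)
    show "fst ` topspace (mantop PM) = topspace (mantop GrM)"
    proof (intro equalityI subsetI)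
      fix E assume "E \<in> topspace (mantop GrM)"
      then have "(E, some_compl E) \<in> topspace (mantop PM)"
        using gpair_some_compl by (simp add: topspace_grassmann topspace_PM pairs_iff)
      then show "E \<in> fst ` topspace (mantop PM)" by force
    qed (auto simp: topspace_PM topspace_grassmann complementary_pairs_def)
    fix E assume "E \<in> topspace (mantop GrM)"
    then have E: "E \<in> Gr" by (simp add: topspace_grassmann)
    note c = cpl_some_compl[OF E]
    show "banach_space_on (?Y E)" by (intro banach_op cplD[OF c(2)])
    show "affine_banach_subspace (?Y E) (?A E)" by (rule affine_banach_subspace_points[OF normed_op_cpl[OF c(2)]])
    show "homeomorphic_map (subtopology (mantop PM) (fib E)) (subtopology (ntop (?Y E)) (?A E)) (fiber_coord E)"
      by (rule homeomorphic_fiber[OF E])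
    show "openin (mantop GrM) (nbhd E)" by (rule openin_nbhd[OF E])
    show "E \<in> nbhd E" using c(1) by (simp add: nbhd_def)
    show "bianalytic (prod_manifold GrM (fiberM E)) PM (nbhd E \<times> fib E) (fiber PM fst (nbhd E)) (triv E)"
      unfolding bianalytic_def by (intro conjI bij_triv[OF E] analytic_triv[OF E] analytic_triv_inv[OF E])
    show "triv E ` ({G} \<times> fib E) = fib G" if "G \<in> nbhd E" for G by (rule triv_fiber[OF E that])
    show "affine_map_on (?Y E) (?A E) (?Y G) (\<lambda>x. fiber_coord G (triv E (G, the_inv_into (fib E) (fiber_coord E) x)))"
      if "G \<in> nbhd E" for G by (rule affine_triv[OF E that])
    fix E2 a assume "E2 \<in> topspace (mantop GrM)" "a \<in> ?A E"
    then show "manifold_analytic GrM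
        (affine_manifold (subtopology (ntop (affine_maps (?Y E) (?A E) (?Y E2) a)) (points (affine_maps (?Y E) (?A E) (?Y E2) a)))
          id (affine_maps (?Y E) (?A E) (?Y E2) a) (points (affine_maps (?Y E) (?A E) (?Y E2) a)))
        (nbhd E \<inter> nbhd E2)
        (\<lambda>G x. if x \<in> ?A E then fiber_coord E2 (snd (the_inv_into (nbhd E2 \<times> fib E2) (triv E2)
            (triv E (G, the_inv_into (fib E) (fiber_coord E) x)))) else 0)"
      by (intro analytic_transition[OF E]) (simp_all add: topspace_grassmann)
  qed
  then show ?thesis unfolding PM_def by blast
qed

end
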